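(* Let $0\le t<T<\infty$, let $f\in C^{0,2}_{ac}([t,T]\times\mathbb R^d)$ and let $X=(X_s)_{s\in[t,T]}=(X^1,\dots,X^d)$ be a continuous $\mathbb R^d$-valued process on a probability space such that $[X,X]=([X^i,X^j])_{1\le i,j\le d}$ exists. Suppose that one of the following two conditions is fulfilled. 1. $f\in C^{0,2}_{ac,count}([t,T]\times\mathbb R^d)$. 2. The mutual covariations $[X^i,X^j]$, $1\le i,j\le d$, are absolutely continuous. Then the following Itô formula holds (in particular the forward integral in it exists): for $s\in[t,T]$, $$f(s,X_s)=f(t,X_t)+\int_t^s\partial_r f(r,X_r)\,dr+\int_t^s\partial_x f(r,X_r)\,d^-X_r+\frac12\sum_{i,j=1}^d\int_t^s\partial^2_{ij}f(r,X_r)\,d[X^i,X^j]_r .$$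
   Context: Convention: a continuous function (or path) $\phi$ on $[t,T]$ is extended to $\mathbb R$ by $\phi(s)=\phi(t)$ for $s\le t$ and $\phi(s)=\phi(T)$ for $s\ge T$. **Function spaces.** For a compact interval $I$, $C^{0,2}_{ac}(I\times\mathbb R^d)$ is the linear space of continuous functions $f:I\times\mathbb R^d\to\mathbb R$ such that: (1) $f(s,\cdot)\in C^2(\mathbb R^d)$ for all $s\in I$; (2) for any $x\in\mathbb R^d$, $s\mapsto f(s,x)$ is absolutely continuous, and for almost all $s\in I$, $x\mapsto\partial_s f(s,x)$ is continuous; (3) for any compact $K\subset\mathbb R^d$, $\sup_{x\in K}|\partial_s f(\cdot,x)|\in L^1(I)$; (4) for every second order space derivative $g$ of $f$: (a) $g$ is continuous in the space variable $x$ varying on each compact $K$, uniformly with respect to $s\in I$; (b) for every $x\in\mathbb R^d$, $s\mapsto g(s,x)$ is a.e. continuous (i.e. continuous at Lebesgue-almost every $s$). $C^{0,2}_{ac,count}(I\times\mathbb R^d)$ is defined in the same way, with (4)(b) replaced by: for every $x\in\mathbb R^d$, $s\mapsto g(s,x)$ has at most countably many discontinuities. **Forward integral.** For a continuous $\mathbb R^d$-valued process $X$ and an $\mathbb R^d$-valued process $Y$ with integrable paths, $\int_t^s Y_r\,d^-X_r$ denotes the limit in probability as $\varepsilon\to0$ (with $\varepsilon>0$) of $\int_t^s Y_r\cdot\frac{X_{r+\varepsilon}-X_r}{\varepsilon}\,dr$; the forward integral is said to exist if this limit exists in probability for every $s\in[t,T]$ and the limit process admits a continuous version (which is then the one denoted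 by the integral). **Covariation.** For real continuous processes $U,V$, $[U,V]_s$ is the limit in probability as $\varepsilon\to0$ of $\frac1\varepsilon\int_t^s(U_{r+\varepsilon}-U_r)(V_{r+\varepsilon}-V_r)\,dr$; it exists if the limit exists in probability for every $s\in[t,T]$ and admits a continuous version. For an $\mathbb R^d$-valued process $X$, $[X,X]$ exists if all $[X^i,X^j]$ exist, and $[X,X]=([X^i,X^j])_{i,j}$. *)

theory Defs
  imports "HOL-Probability.Probability"
begin

section \<open>Functions on an interval\<close>

definition absolutely_continuous_on :: "real set \<Rightarrow> (real \<Rightarrow> real) \<Rightarrow> bool" where
  "absolutely_continuous_on I \<phi> \<longleftrightarrow>
     (\<forall>\<epsilon>>0. \<exists>\<delta>>0. \<forall>D S. D division_of S \<and> S \<subseteq> I \<and> (\<Sum>K\<in>D. measure lborel K) < \<delta> \<longrightarrow>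
        (\<Sum>K\<in>D. \<bar>\<phi> (Sup K) - \<phi> (Inf K)\<bar>) < \<epsilon>)"

text \<open>Lebesgue--Stieltjes integral over \<open>[a,b]\<close> against a continuous function \<open>A\<close> of bounded
  variation, through any decomposition of \<open>A\<close> as a difference of continuous nondecreasing
  functions; the value does not depend on the decomposition. Since \<open>A\<close> is continuous, the
  endpoints carry no mass.\<close>

definition has_stieltjes_integral ::
    "(real \<Rightarrow> real) \<Rightarrow> (real \<Rightarrow> real) \<Rightarrow> real \<Rightarrow> real \<Rightarrow> real \<Rightarrow> bool" where
  "has_stieltjes_integral g A a b z \<longleftrightarrow>
     (\<exists>P N. mono P \<and> mono N \<and> continuous_on UNIV P \<and> continuous_on UNIV N \<and>
        (\<forall>r\<in>{a..b}. A r = P r - N r) \<and>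
        set_integrable (interval_measure P) {a..b} g \<and>
        set_integrable (interval_measure N) {a..b} g \<and>
        z = (LINT r:{a..b}|interval_measure P. g r) - (LINT r:{a..b}|interval_measure N. g r))"

definition stieltjes_integrable ::
    "(real \<Rightarrow> real) \<Rightarrow> (real \<Rightarrow> real) \<Rightarrow> real \<Rightarrow> real \<Rightarrow> bool" where
  "stieltjes_integrable g A a b \<longleftrightarrow> (\<exists>z. has_stieltjes_integral g A a b z)"

definition stieltjes_integral ::
    "(real \<Rightarrow> real) \<Rightarrow> (real \<Rightarrow> real) \<Rightarrow> real \<Rightarrow> real \<Rightarrow> real" where
  "stieltjes_integral g A a b = (THE z. has_stieltjes_integral g A a b z)"


section \<open>Derivatives and function spaces\<close>

definition partial_deriv :: "'n::finite \<Rightarrow> (real ^ 'n \<Rightarrow> real) \<Rightarrow> real ^ 'n \<Rightarrow> real" where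
  "partial_deriv i g x = deriv (\<lambda>h. g (x + h *\<^sub>R axis i 1)) 0"

definition C1 :: "(real ^ 'n::finite \<Rightarrow> real) set" where
  "C1 = {g. \<forall>i. (\<forall>x. (\<lambda>h. g (x + h *\<^sub>R axis i 1)) field_differentiable (at 0)) \<and>
              continuous_on UNIV (partial_deriv i g)}"

definition C2 :: "(real ^ 'n::finite \<Rightarrow> real) set" where
  "C2 = {g \<in> C1. \<forall>i. partial_deriv i g \<in> C1}"

definition grad_x :: "(real \<Rightarrow> real ^ 'n \<Rightarrow> real) \<Rightarrow> real \<Rightarrow> real ^ 'n \<Rightarrow> real ^ 'n::finite" where
  "grad_x f s x = (\<chi> i. partial_deriv i (f s) x)"

definition hess_x ::
    "(real \<Rightarrow> real ^ 'n \<Rightarrow> real) \<Rightarrow> 'n::finite \<Rightarrow> 'n \<Rightarrow> real \<Rightarrow> real ^ 'n \<Rightarrow> real" where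
  "hess_x f i j s x = partial_deriv i (partial_deriv j (f s)) x"

definition time_deriv ::
    "real set \<Rightarrow> (real \<Rightarrow> real ^ 'n \<Rightarrow> real) \<Rightarrow> real \<Rightarrow> real ^ 'n::finite \<Rightarrow> real" where
  "time_deriv I f s x = vector_derivative (\<lambda>r. f r x) (at s within I)"

text \<open>A function on \<open>I \<times> \<real>\<^sup>d\<close> is a total function whose values at times outside \<open>I\<close> are
  irrelevant. The time derivative is required to exist at almost every time \<open>s\<close>, simultaneously for
  all \<open>x\<close>. The measure is the completed one, as the supremum over \<open>K\<close> is meaningful only for
  almost every \<open>s\<close>.\<close>

definition C02_ac_base :: "real set \<Rightarrow> (real \<Rightarrow> real ^ 'n::finite \<Rightarrow> real) set" where
  "C02_ac_base I = {f.
     continuous_on (I \<times> UNIV) (\<lambda>(s, x). f s x) \<and>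
     (\<forall>s\<in>I. f s \<in> C2) \<and>
     (\<forall>x. absolutely_continuous_on I (\<lambda>s. f s x)) \<and>
     (AE s in lebesgue. s \<in> I \<longrightarrow>
        (\<forall>x. (\<lambda>r. f r x) differentiable (at s within I)) \<and>
        continuous_on UNIV (time_deriv I f s)) \<and>
     (\<forall>K. compact K \<longrightarrow> set_integrable lebesgue I (\<lambda>s. SUP x\<in>K. \<bar>time_deriv I f s x\<bar>)) \<and>
     (\<forall>i j K. compact K \<longrightarrow>
        (\<forall>x\<in>K. uniform_limit I (\<lambda>y s. hess_x f i j s y) (\<lambda>s. hess_x f i j s x) (at x within K)))}"

definition C02_ac :: "real set \<Rightarrow> (real \<Rightarrow> real ^ 'n::finite \<Rightarrow> real) set" where
  "C02_ac I = {f \<in> C02_ac_base I.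
     \<forall>i j x. AE s in lebesgue. s \<in> I \<longrightarrow> continuous (at s within I) (\<lambda>r. hess_x f i j r x)}"

definition C02_ac_count :: "real set \<Rightarrow> (real \<Rightarrow> real ^ 'n::finite \<Rightarrow> real) set" where
  "C02_ac_count I = {f \<in> C02_ac_base I.
     \<forall>i j x. countable {s \<in> I. \<not> continuous (at s within I) (\<lambda>r. hess_x f i j r x)}}"


section \<open>Processes, covariation and forward integral\<close>

definition continuous_process ::
    "'w measure \<Rightarrow> real \<Rightarrow> real \<Rightarrow> (real \<Rightarrow> 'w \<Rightarrow> 'b::topological_space) \<Rightarrow> bool" where
  "continuous_process M t T X \<longleftrightarrow>
     (\<forall>s\<in>{t..T}. X s \<in> borel_measurable M) \<and>
     (\<forall>\<omega>\<in>space M. continuous_on {t..T} (\<lambda>s. X s \<omega>))"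

definition tendsto_in_prob ::
    "'w measure \<Rightarrow> ('e \<Rightarrow> 'w \<Rightarrow> real) \<Rightarrow> ('w \<Rightarrow> real) \<Rightarrow> 'e filter \<Rightarrow> bool" where
  "tendsto_in_prob M Z L F \<longleftrightarrow>
     (\<forall>\<^sub>F e in F. Z e \<in> borel_measurable M) \<and> L \<in> borel_measurable M \<and>
     (\<forall>\<delta>>0. ((\<lambda>e. measure M {\<omega> \<in> space M. \<delta> < \<bar>Z e \<omega> - L \<omega>\<bar>}) \<longlongrightarrow> 0) F)"

text \<open>Increment over \<open>[r, r + \<epsilon>]\<close> of the path of \<open>X\<close> extended by constants outside \<open>[t,T]\<close>.\<close>

definition incr ::
    "real \<Rightarrow> real \<Rightarrow> (real \<Rightarrow> 'w \<Rightarrow> 'b::real_normed_vector) \<Rightarrow> real \<Rightarrow> real \<Rightarrow> 'w \<Rightarrow> 'b" where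
  "incr t T X \<epsilon> r \<omega> = ext_cont (\<lambda>s. X s \<omega>) t T (r + \<epsilon>) - ext_cont (\<lambda>s. X s \<omega>) t T r"

text \<open>\<open>Q\<close> is a continuous version of the covariation \<open>[U,V]\<close> on \<open>[t,T]\<close>.\<close>

definition has_covariation ::
    "'w measure \<Rightarrow> real \<Rightarrow> real \<Rightarrow> (real \<Rightarrow> 'w \<Rightarrow> real) \<Rightarrow> (real \<Rightarrow> 'w \<Rightarrow> real) \<Rightarrow>
     (real \<Rightarrow> 'w \<Rightarrow> real) \<Rightarrow> bool" where
  "has_covariation M t T U V Q \<longleftrightarrow>
     continuous_process M t T Q \<and>
     (\<forall>s\<in>{t..T}. tendsto_in_prob M
        (\<lambda>\<epsilon> \<omega>. 1 / \<epsilon> * (LINT r:{t..s}|lebesgue. incr t T U \<epsilon> r \<omega> * incr t T V \<epsilon> r \<omega>))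
        (Q s) (at_right 0))"

text \<open>\<open>J\<close> is a continuous version of the forward integral of \<open>Y\<close> against \<open>X\<close> on \<open>[t,T]\<close>.\<close>

definition has_forward_integral ::
    "'w measure \<Rightarrow> real \<Rightarrow> real \<Rightarrow> (real \<Rightarrow> 'w \<Rightarrow> real ^ 'n) \<Rightarrow> (real \<Rightarrow> 'w \<Rightarrow> real ^ 'n::finite) \<Rightarrow>
     (real \<Rightarrow> 'w \<Rightarrow> real) \<Rightarrow> bool" where
  "has_forward_integral M t T Y X J \<longleftrightarrow>
     (\<forall>s\<in>{t..T}. Y s \<in> borel_measurable M) \<and>
     (\<forall>\<omega>\<in>space M. set_integrable lebesgue {t..T} (\<lambda>r. Y r \<omega>)) \<and>
     continuous_process M t T J \<and>
     (\<forall>s\<in>{t..T}. tendsto_in_prob M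
        (\<lambda>\<epsilon> \<omega>. LINT r:{t..s}|lebesgue. Y r \<omega> \<bullet> (incr t T X \<epsilon> r \<omega> /\<^sub>R \<epsilon>))
        (J s) (at_right 0))"

end

theory Submission
  imports Defs
begin

text \<open>
  The second space derivatives of \<open>f\<close> are continuous in \<open>x\<close> uniformly in time, while \<open>f\<close> is jointly
  continuous. Difference quotients of \<open>f\<close> in \<open>x\<close>, which are continuous in time, therefore converge
  uniformly in time, so the gradient and the Hessian are jointly continuous and the integrand
  \<open>\<partial>\<^sup>2f(r, X\<^sub>r)\<close> has continuous paths.

  Every sequence \<open>\<epsilon>\<^sub>n \<rightarrow> 0\<close> has a subsequence along which, almost surely, the regularized covariations
  converge at all times of a countable dense set; by polarization and monotonicity they converge at
  all times, and as measures against continuous integrands. The rest is deterministic. Write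
  \<open>f(r+\<epsilon>, X(r+\<epsilon>)) - f(r, X\<^sub>r)\<close> as the time increment \<open>f(r+\<epsilon>, X(r+\<epsilon>)) - f(r, X(r+\<epsilon>))\<close> plus a second
  order Taylor expansion of \<open>f(r, \<cdot>)\<close>, divide by \<open>\<epsilon>\<close> and integrate over \<open>[t,s]\<close>. The left side tends
  to \<open>f(s, X\<^sub>s) - f(t, X\<^sub>t)\<close>, the time increment to \<open>\<integral>\<partial>\<^sub>rf(r, X\<^sub>r) dr\<close>, the Hessian term to the
  covariation integral and the remainder to \<open>0\<close>; hence the gradient term converges as well.
\<close>

section \<open>Absolutely continuous functions\<close>

text \<open>The increment is split at time \<open>r\<close> and position
  \<open>X(r+\<epsilon>)\<close>, so that gradient and Hessian appear at \<open>(r, X_r)\<close>, as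
  the forward integral demands. The price is a time increment taken at a frozen later position,
  while the time derivative is merely integrable in time; its modulus in the space variable along
  the path, dominated by an integrable function, settles this. Covariations come without a sign or
  bounded variation. The covariation of \<open>X^i + X^j\<close> with itself is a limit of
  nondecreasing functions, hence monotone; polarization then makes each \<open>[X^i, X^j]\<close> an
  admissible integrator. The null set of an almost sure limit depends on the chosen subsequence, so
  the forward integral cannot be defined as such a limit. It is defined by the formula itself, on
  one event where all polarized covariations are monotone, and convergence in probability follows
  from the criterion of further subsequences. Absolute continuity is stated through divisions of an
  interval, which fits a gauge proof of the fundamental theorem of calculus directly.\<close>

lemma absolutely_continuous_has_integral:
  fixes \<phi> \<phi>' :: "real \<Rightarrow> real"
  assumes ac: "absolutely_continuous_on {a..b} \<phi>" and ab: "a \<le> b" and N: "negligible N"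
    and d: "\<And>x. x \<in> {a..b} - N \<Longrightarrow> (\<phi> has_vector_derivative \<phi>' x) (at x within {a..b})"
  shows "(\<phi>' has_integral (\<phi> b - \<phi> a)) {a..b}"
proof -
  \<comment> \<open>With the value \<open>0\<close> on \<open>N\<close>, a tag in \<open>N\<close>
    adds nothing to the Riemann sum and its error is just the increment of \<open>\<phi>\<close>.
    The values of \<open>\<phi>'\<close> are restored at the end because \<open>N\<close> is
    negligible.\<close>
  define g where "g = (\<lambda>x. if x \<in> N then 0 else \<phi>' x)"
  have "(g has_integral (\<phi> b - \<phi> a)) (cbox a b)"
    unfolding has_integral
  proof (intro allI impI)
    fix e :: real assume e: "e > 0"
    \<comment> \<open>The summand \<open>1\<close> keeps \<open>c * (b - a) < e / 2\<close> strict
      and the quotient defined when \<open>a = b\<close>.\<close>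
    define c where "c = e / (2 * (b - a + 1))"
    have c: "c > 0" "c * (b - a) < e / 2"
      using e ab by (auto simp: c_def field_simps)
    obtain \<delta> where \<delta>: "\<delta> > 0" and ac': "\<And>D S. \<lbrakk>D division_of S; S \<subseteq> {a..b}; (\<Sum>K\<in>D. measure lborel K) < \<delta>\<rbrakk>
        \<Longrightarrow> (\<Sum>K\<in>D. \<bar>\<phi> (Sup K) - \<phi> (Inf K)\<bar>) < e / 2"
      using ac e unfolding absolutely_continuous_on_def by (metis half_gt_zero)
    have Nl: "N \<in> sets lebesgue" "emeasure lebesgue N = 0"
      using N by (auto simp: negligible_iff_null_sets)
    obtain U where U: "open U" "N \<subseteq> U" "emeasure lebesgue (U - N) < ennreal \<delta>"
      using sets_lebesgue_outer_open[OF Nl(1) \<delta>] by metis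
    have Um: "emeasure lborel U < ennreal \<delta>"
    proof -
      have "emeasure lebesgue U = emeasure lebesgue (U - N)"
        using emeasure_Diff_null_set[of N lebesgue U] Nl U(1) by (auto simp: null_sets_def)
      then show ?thesis using U by (simp add: borel_open)
    qed
    \<comment> \<open>Tags in \<open>N\<close> only see intervals inside \<open>U\<close>, whose total length absolute continuity controls.\<close>
    have "\<forall>x. \<exists>r>0. x \<in> {a..b} \<longrightarrow>
       (x \<in> N \<longrightarrow> ball x r \<subseteq> U) \<and>
       (x \<notin> N \<longrightarrow> (\<forall>y\<in>{a..b}. norm (y-x) < r \<longrightarrow> norm (\<phi> y - \<phi> x - (y-x) *\<^sub>R \<phi>' x) \<le> c * norm (y-x)))"
    proof
      fix x
      show "\<exists>r>0. x \<in> {a..b} \<longrightarrow>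
       (x \<in> N \<longrightarrow> ball x r \<subseteq> U) \<and>
       (x \<notin> N \<longrightarrow> (\<forall>y\<in>{a..b}. norm (y-x) < r \<longrightarrow> norm (\<phi> y - \<phi> x - (y-x) *\<^sub>R \<phi>' x) \<le> c * norm (y-x)))"
      proof (cases "x \<in> {a..b}")
        case True
        show ?thesis
        proof (cases "x \<in> N")
          case True
          then show ?thesis using U open_contains_ball by blast
        next
          case False
          then have "(\<phi> has_vector_derivative \<phi>' x) (at x within {a..b})" using d True by auto
          then show ?thesis
            using c False unfolding has_vector_derivative_def has_derivative_within_alt by blast
        qed
      qed (auto intro: exI[of _ 1])
    qed
    then obtain r where r: "\<And>x. r x > 0"
      "\<And>x. \<lbrakk>x \<in> {a..b}; x \<in> N\<rbrakk> \<Longrightarrow> ball x (r x) \<subseteq> U"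
      "\<And>x y. \<lbrakk>x \<in> {a..b}; x \<notin> N; y \<in> {a..b}; norm (y-x) < r x\<rbrakk>
        \<Longrightarrow> norm (\<phi> y - \<phi> x - (y-x) *\<^sub>R \<phi>' x) \<le> c * norm (y-x)"
      by metis
    show "\<exists>\<gamma>. gauge \<gamma> \<and> (\<forall>p. p tagged_division_of cbox a b \<and> \<gamma> fine p \<longrightarrow>
        norm ((\<Sum>(x, k)\<in>p. measure lborel k *\<^sub>R g x) - (\<phi> b - \<phi> a)) < e)"
    proof (intro exI conjI allI impI; (elim conjE)?)
      show "gauge (\<lambda>x. ball x (r x))" using r(1) gauge_ball_dependent by blast
      fix p assume p: "p tagged_division_of cbox a b" and fine: "(\<lambda>x. ball x (r x)) fine p"
      define p0 where "p0 = {(x,K)\<in>p. x \<in> N}"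
      define p1 where "p1 = {(x,K)\<in>p. x \<notin> N}"
      have fin: "finite p" using p by blast
      have pu: "p = p0 \<union> p1" "p0 \<inter> p1 = {}" "finite p0" "finite p1" "p0 \<subseteq> p" "p1 \<subseteq> p"
        using fin by (auto simp: p0_def p1_def intro: finite_subset)
      have K: "\<exists>u v. K = {u..v} \<and> u \<le> x \<and> x \<le> v \<and> a \<le> u \<and> v \<le> b \<and> {u..v} \<subseteq> ball x (r x)" if xK: "(x,K) \<in> p" for x K
      proof -
        obtain u v where uv: "K = cbox u v" using tagged_division_ofD(4)[OF p xK] by blast
        moreover note tagged_division_ofD(2,3)[OF p xK] fineD[OF fine xK]
        ultimately show ?thesis by (intro exI[of _ u] exI[of _ v]) (auto simp: subset_eq)
      qed
      have tel: "\<phi> b - \<phi> a = (\<Sum>(x,K)\<in>p. \<phi>(Sup K) - \<phi>(Inf K))" "b - a = (\<Sum>(x,K)\<in>p. Sup K - Inf K)"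
        using additive_tagged_division_1[OF ab, of p \<phi>] additive_tagged_division_1[OF ab, of p "\<lambda>x. x"] p by auto
      have nn: "0 \<le> (case z of (x,K) \<Rightarrow> Sup K - Inf K)" if "z \<in> p" for z
        using that K[of "fst z" "snd z"] by (auto split: prod.splits)
      \<comment> \<open>Straddle estimate: as \<open>u \<le> x \<le> v\<close>, the errors at the
        two ends add up to \<open>c * (v - u)\<close>, and these lengths sum to at most
        \<open>b - a\<close>.\<close>
      have s1: "norm (\<Sum>(x,K)\<in>p1. measure lborel K *\<^sub>R g x - (\<phi>(Sup K) - \<phi>(Inf K))) \<le> c * (b - a)"
      proof -
        have "norm (\<Sum>(x,K)\<in>p1. measure lborel K *\<^sub>R g x - (\<phi>(Sup K) - \<phi>(Inf K)))
          \<le> (\<Sum>z\<in>p1. c * (case z of (x,K) \<Rightarrow> Sup K - Inf K))"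
        proof (rule sum_norm_le, safe)
          fix x Ka assume "(x,Ka) \<in> p1"
          then have xp: "(x,Ka) \<in> p" "x \<notin> N" by (auto simp: p1_def)
          obtain u v where uv: "Ka = {u..v}" "u \<le> x" "x \<le> v" "a \<le> u" "v \<le> b" "{u..v} \<subseteq> ball x (r x)"
            using K[OF xp(1)] by blast
          have "u \<in> ball x (r x)" "v \<in> ball x (r x)" using subsetD[OF uv(6)] uv(2,3) by force+
          then have "norm (\<phi> u - \<phi> x - (u-x) *\<^sub>R \<phi>' x) \<le> c * norm (u-x)"
             "norm (\<phi> v - \<phi> x - (v-x) *\<^sub>R \<phi>' x) \<le> c * norm (v-x)"
            using uv(2-5) xp by (auto intro!: r(3) simp del: real_norm_def real_scaleR_def simp: dist_norm norm_minus_commute)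
          then have "\<bar>(v - u) * \<phi>' x - (\<phi> v - \<phi> u)\<bar> \<le> c * (v - u)"
            using uv(2,3) by (simp add: algebra_simps)
          then show "norm (measure lborel Ka *\<^sub>R g x - (\<phi> (Sup Ka) - \<phi> (Inf Ka))) \<le> c * (Sup Ka - Inf Ka)"
            using uv xp by (simp add: g_def)
        qed
        also have "\<dots> = c * (\<Sum>z\<in>p1. (case z of (x,K) \<Rightarrow> Sup K - Inf K))" by (simp add: sum_distrib_left)
        also have "\<dots> \<le> c * (\<Sum>z\<in>p. (case z of (x,K) \<Rightarrow> Sup K - Inf K))"
          using c nn fin pu by (intro mult_left_mono sum_mono2) auto
        finally show ?thesis using tel by simp
      qed
      have p0t: "p0 tagged_division_of \<Union>(snd ` p0)"
        using p pu tagged_partial_division_of_Union_self tagged_partial_division_subset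
        by (metis tagged_division_of_def)
      have p0d: "snd ` p0 division_of \<Union>(snd ` p0)"
        using division_of_tagged_division[OF p0t] .
      have p0U: "\<Union>(snd ` p0) \<subseteq> U"
      proof safe
        fix z x K' assume "(x,K') \<in> p0" "z \<in> snd (x,K')"
        then have "(x,K') \<in> p" "x \<in> N" "z \<in> K'" by (auto simp: p0_def)
        obtain u v where uv: "K' = {u..v}" "u \<le> x" "x \<le> v" "a \<le> u" "v \<le> b" "{u..v} \<subseteq> ball x (r x)"
          using K[OF \<open>(x,K') \<in> p\<close>] by blast
        then have "x \<in> {a..b}" by auto
        with r(2) \<open>x \<in> N\<close> \<open>z \<in> K'\<close> uv(1,6) show "z \<in> U" by blast
      qed
      have p0ab: "\<Union>(snd ` p0) \<subseteq> {a..b}"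
        using K pu by fastforce
      have p0c: "\<Union>(snd ` p0) \<in> sets borel" "K \<in> snd ` p0 \<Longrightarrow> K \<in> sets borel" for K
        using p0d by (auto intro!: borel_closed closed_Union dest: division_ofD(4))
      have "(\<Sum>K\<in>snd ` p0. measure lborel K) = measure lborel (\<Union>(snd ` p0))"
        using content_division[OF p0d] p0c by simp
      also have "\<dots> \<le> measure lborel U"
      proof (rule measure_mono_fmeasurable[OF p0U])
        show "\<Union> (snd ` p0) \<in> sets lborel"
using p0c by simp
        show "U \<in> fmeasurable lborel"
          using Um U(1) by (auto simp: fmeasurable_def intro: order.strict_trans)
      qed
      also have "\<dots> < \<delta>"
        using Um \<delta> by (cases "emeasure lborel U") (auto simp: measure_def ennreal_less_iff)
      finally have small: "(\<Sum>K\<in>snd ` p0. \<bar>\<phi> (Sup K) - \<phi> (Inf K)\<bar>) < e / 2"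
        using ac'[OF p0d p0ab] by simp
      have eq: "(\<Sum>(x,K)\<in>p0. \<bar>\<phi> (Sup K) - \<phi> (Inf K)\<bar>) = (\<Sum>K\<in>snd ` p0. \<bar>\<phi> (Sup K) - \<phi> (Inf K)\<bar>)"
      proof -
        \<comment> \<open>The lemma on sums over tagged divisions wants the value \<open>0\<close>
          on every \<open>cbox u v\<close> without interior. This includes the empty set, where
          \<open>Sup\<close> and \<open>Inf\<close> mean nothing; hence the case
          distinction.\<close>
        define d where "d = (\<lambda>K. if K = {} then 0 else \<bar>\<phi> (Sup K) - \<phi> (Inf K)\<bar>)"
        have "(\<Sum>(x,K)\<in>p0. d K) = (\<Sum>K\<in>snd ` p0. d K)"
        proof (rule sum.over_tagged_division_lemma[OF p0t])
          fix u v :: real assume "box u v = {}"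
          then have "u \<ge> v" by simp
          then show "d (cbox u v) = 0"
            by (cases "u = v") (auto simp: d_def)
        qed
        moreover have "(\<Sum>(x,K)\<in>p0. d K) = (\<Sum>(x,K)\<in>p0. \<bar>\<phi> (Sup K) - \<phi> (Inf K)\<bar>)"
          using tagged_division_ofD(2)[OF p0t] by (intro sum.cong) (auto simp: d_def, blast)
        moreover have "(\<Sum>K\<in>snd ` p0. d K) = (\<Sum>K\<in>snd ` p0. \<bar>\<phi> (Sup K) - \<phi> (Inf K)\<bar>)"
          using division_ofD(3)[OF p0d] by (intro sum.cong) (auto simp: d_def)
        ultimately show ?thesis by simp
      qed
      have s0: "norm (\<Sum>(x,K)\<in>p0. measure lborel K *\<^sub>R g x - (\<phi>(Sup K) - \<phi>(Inf K))) < e/2"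
      proof -
        have "norm (\<Sum>(x,K)\<in>p0. measure lborel K *\<^sub>R g x - (\<phi>(Sup K) - \<phi>(Inf K)))
          \<le> (\<Sum>(x,K)\<in>p0. \<bar>\<phi> (Sup K) - \<phi> (Inf K)\<bar>)"
          by (rule sum_norm_le) (auto simp: g_def p0_def)
        then show ?thesis using eq small by simp
      qed
      have "(\<Sum>(x, k)\<in>p. measure lborel k *\<^sub>R g x) - (\<phi> b - \<phi> a) = (\<Sum>(x,K)\<in>p. measure lborel K *\<^sub>R g x - (\<phi>(Sup K) - \<phi>(Inf K)))"
        unfolding tel by (simp add: sum_subtractf split_def)
      also have "\<dots> = (\<Sum>(x,K)\<in>p0. measure lborel K *\<^sub>R g x - (\<phi>(Sup K) - \<phi>(Inf K))) + (\<Sum>(x,K)\<in>p1. measure lborel K *\<^sub>R g x - (\<phi>(Sup K) - \<phi>(Inf K)))"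
        unfolding pu(1) by (rule sum.union_disjoint) (use pu in auto)
      finally show "norm ((\<Sum>(x, k)\<in>p. measure lborel k *\<^sub>R g x) - (\<phi> b - \<phi> a)) < e"
        using s0 s1 c norm_triangle_lt[OF add_strict_mono[OF s0 le_less_trans[OF s1 c(2)]]] by simp
    qed
  qed
  then have "(g has_integral (\<phi> b - \<phi> a)) {a..b}" by simp
  then show ?thesis
    by (rule has_integral_spike[OF N, rotated]) (auto simp: g_def)
qed

section \<open>Space derivatives\<close>

lemma C1_has_real_derivative_axis:
  fixes g :: "real ^ 'n::finite \<Rightarrow> real"
  assumes "g \<in> C1"
  shows "((\<lambda>h. g (x + h *\<^sub>R axis i 1)) has_real_derivative partial_deriv i g (x + h0 *\<^sub>R axis i 1)) (at h0)"
proof -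
  let ?y = "x + h0 *\<^sub>R axis i 1"
  have "(\<lambda>h. g (?y + h *\<^sub>R axis i 1)) field_differentiable (at 0)"
    using assms by (simp add: C1_def)
  then have "((\<lambda>h. g (?y + h *\<^sub>R axis i 1)) has_real_derivative partial_deriv i g ?y) (at (h0 + - h0))"
    unfolding partial_deriv_def by (simp add: DERIV_deriv_iff_field_differentiable)
  then have "((\<lambda>h. g (?y + (h + - h0) *\<^sub>R axis i 1)) has_real_derivative partial_deriv i g ?y) (at h0)"
    using DERIV_shift[of "\<lambda>h. g (?y + h *\<^sub>R axis i 1)" _ h0 "- h0"] by simp
  moreover have "(\<lambda>h. g (?y + (h + - h0) *\<^sub>R axis i 1)) = (\<lambda>h. g (x + h *\<^sub>R axis i 1))"
    by (simp add: algebra_simps)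
  ultimately show ?thesis by simp
qed

lemma C1_mvt_axis:
  fixes g :: "real ^ 'n::finite \<Rightarrow> real"
  assumes "g \<in> C1"
  obtains \<theta> where "\<bar>\<theta>\<bar> \<le> \<bar>h\<bar>" "g (x + h *\<^sub>R axis i 1) - g x = h * partial_deriv i g (x + \<theta> *\<^sub>R axis i 1)"
proof (cases "h = 0")
  case True
  then show ?thesis using that[of 0] by simp
next
  case False
  note d = C1_has_real_derivative_axis[OF assms, of x i]
  show ?thesis
  proof (cases "h > 0")
    case True
    from MVT2[OF this, of "\<lambda>h. g (x + h *\<^sub>R axis i 1)", OF d] obtain z where
      "0 < z" "z < h" "g (x + h *\<^sub>R axis i 1) - g x = (h - 0) * partial_deriv i g (x + z *\<^sub>R axis i 1)"
      by auto
    with that[of z] show ?thesis by simp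
  next
    case F: False
    then have "h < 0" using False by simp
    with MVT2[OF this, of "\<lambda>h. g (x + h *\<^sub>R axis i 1)", OF d] obtain z where
      "h < z" "z < 0" "g x - g (x + h *\<^sub>R axis i 1) = (0 - h) * partial_deriv i g (x + z *\<^sub>R axis i 1)"
      by auto
    with that[of z] show ?thesis by (simp add: algebra_simps)
  qed
qed

lemma norm_sum_axis_le:
  fixes v :: "real ^ 'n::finite"
  shows "norm (\<Sum>i\<in>S. v $ i *\<^sub>R axis i (1::real)) \<le> (\<Sum>i\<in>S. \<bar>v $ i\<bar>)"
  by (rule order_trans[OF norm_sum]) (simp add: norm_axis_1)

text \<open>The way from \<open>x\<close> to \<open>x + v\<close> changes one coordinate at a time.
  On each leg the mean value theorem gives a partial derivative at an intermediate point, and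
  continuity of the partials compares it with the one at \<open>x\<close>.\<close>

lemma C1_has_derivative:
  fixes g :: "real ^ 'n::finite \<Rightarrow> real"
  assumes g: "g \<in> C1"
  shows "(g has_derivative (\<lambda>v. \<Sum>i\<in>UNIV. partial_deriv i g x * v $ i)) (at x)"
  unfolding has_derivative_at_alt
proof (intro conjI allI impI)
  show "bounded_linear (\<lambda>v. \<Sum>i\<in>UNIV. partial_deriv i g x * v $ i)"
    by (intro bounded_linear_sum bounded_linear_const_mult bounded_linear_vec_nth)
  fix e :: real assume e: "e > 0"
  define n where "n = real CARD('n)"
  have n: "n > 0" by (simp add: n_def)
  have "\<forall>i. \<forall>\<^sub>F y in at x. dist (partial_deriv i g y) (partial_deriv i g x) < e / n"
  proof
    fix i
    have "continuous_on UNIV (partial_deriv i g)" using g by (simp add: C1_def)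
    then have "(partial_deriv i g \<longlongrightarrow> partial_deriv i g x) (at x)"
      by (simp add: continuous_on_def)
    then show "\<forall>\<^sub>F y in at x. dist (partial_deriv i g y) (partial_deriv i g x) < e / n"
      using e n by (auto dest!: tendstoD[of _ _ _ "e/n"])
  qed
  then have "\<forall>\<^sub>F y in at x. \<forall>i. dist (partial_deriv i g y) (partial_deriv i g x) < e / n"
    by (simp add: eventually_all_finite)
  then obtain \<delta> where \<delta>: "\<delta> > 0" "\<And>y i. y \<noteq> x \<Longrightarrow> dist y x < \<delta> \<Longrightarrow> dist (partial_deriv i g y) (partial_deriv i g x) < e / n"
    unfolding eventually_at by auto
  have \<delta>': "\<bar>partial_deriv i g y - partial_deriv i g x\<bar> \<le> e / n" if "dist y x < \<delta>" for y i
    using \<delta>(2)[OF _ that, of i] e n by (cases "y = x") (auto simp: dist_real_def)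
  show "\<exists>d>0. \<forall>y. norm (y - x) < d \<longrightarrow>
      norm (g y - g x - (\<Sum>i\<in>UNIV. partial_deriv i g x * (y - x) $ i)) \<le> e * norm (y - x)"
  proof (intro exI conjI allI impI)
    \<comment> \<open>Intermediate points are no farther from \<open>x\<close> than the sum of the
      \<open>\<bar>v $ i\<bar>\<close>, which is at most \<open>n * norm v\<close>. So the radius
      \<open>\<delta> / n\<close> keeps them within \<open>\<delta>\<close>, and the tolerance
      \<open>e / n\<close> on each leg adds up to \<open>e * norm v\<close>.\<close>
    show "\<delta> / n > 0" using \<delta> n by simp
    fix y assume y: "norm (y - x) < \<delta> / n"
    define v where "v = y - x"
    have vs: "(\<Sum>i\<in>S. \<bar>v $ i\<bar>) \<le> n * norm v" for S
    proof -
      have "(\<Sum>i\<in>S. \<bar>v $ i\<bar>) \<le> (\<Sum>i\<in>UNIV. \<bar>v $ i\<bar>)" by (intro sum_mono2) auto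
      also have "\<dots> \<le> n * norm v"
        unfolding n_def by (rule sum_bounded_above) (simp add: component_le_norm_cart)
      finally show ?thesis .
    qed
    have nv: "n * norm v < \<delta>" using y n by (simp add: v_def field_simps)
    have "finite S \<Longrightarrow> \<bar>g (x + (\<Sum>i\<in>S. v $ i *\<^sub>R axis i 1)) - g x - (\<Sum>i\<in>S. partial_deriv i g x * v $ i)\<bar>
       \<le> e / n * (\<Sum>i\<in>S. \<bar>v $ i\<bar>)" for S
    proof (induction S rule: finite_induct)
      case empty
      then show ?case by simp
    next
      case (insert i S)
      define p where "p = x + (\<Sum>i\<in>S. v $ i *\<^sub>R axis i 1)"
      obtain \<theta> where \<theta>: "\<bar>\<theta>\<bar> \<le> \<bar>v $ i\<bar>" "g (p + v $ i *\<^sub>R axis i 1) - g p = v $ i * partial_deriv i g (p + \<theta> *\<^sub>R axis i 1)"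
        using C1_mvt_axis[OF g] by metis
      have "dist (p + \<theta> *\<^sub>R axis i 1) x \<le> (\<Sum>i\<in>S. \<bar>v $ i\<bar>) + \<bar>\<theta>\<bar>"
        unfolding dist_norm p_def using norm_sum_axis_le[of v S]
        by (simp add: add.assoc) (rule order_trans[OF norm_triangle_ineq], simp add: norm_axis_1)
      also have "\<dots> \<le> (\<Sum>i\<in>insert i S. \<bar>v $ i\<bar>)" using \<theta>(1) insert by simp
      also have "\<dots> < \<delta>" using vs nv by (rule le_less_trans)
      finally have "\<bar>partial_deriv i g (p + \<theta> *\<^sub>R axis i 1) - partial_deriv i g x\<bar> \<le> e / n"
        by (rule \<delta>')
      then have "\<bar>v $ i\<bar> * \<bar>partial_deriv i g (p + \<theta> *\<^sub>R axis i 1) - partial_deriv i g x\<bar> \<le> \<bar>v $ i\<bar> * (e / n)"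
        by (rule mult_left_mono) simp
      then have "\<bar>g (p + v $ i *\<^sub>R axis i 1) - g p - partial_deriv i g x * v $ i\<bar> \<le> e / n * \<bar>v $ i\<bar>"
        unfolding \<theta>(2) abs_mult[symmetric] by (simp add: algebra_simps)
      moreover have e0: "x + (\<Sum>i\<in>insert i S. v $ i *\<^sub>R axis i 1) = p + v $ i *\<^sub>R axis i 1"
        using insert by (simp add: p_def)
      moreover note insert.IH[folded p_def]
      ultimately show ?case unfolding e0 unfolding sum.insert[OF insert.hyps]
        by (simp only: distrib_left)
    qed
    from this[of UNIV] have "\<bar>g (x + (\<Sum>i\<in>UNIV. v $ i *\<^sub>R axis i 1)) - g x - (\<Sum>i\<in>UNIV. partial_deriv i g x * v $ i)\<bar>
       \<le> e / n * (\<Sum>i\<in>UNIV. \<bar>v $ i\<bar>)" by simp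
    also have "\<dots> \<le> e / n * (n * norm v)" using vs e n by (intro mult_left_mono) auto
    also have "\<dots> = e * norm v" using n by simp
    also have "x + (\<Sum>i\<in>UNIV. v $ i *\<^sub>R axis i 1) = y"
      using basis_expansion[of v] by (simp add: v_def scalar_mult_eq_scaleR)
    finally show "norm (g y - g x - (\<Sum>i\<in>UNIV. partial_deriv i g x * (y - x) $ i)) \<le> e * norm (y - x)"
      by (simp add: v_def)
  qed
qed

lemma C1_continuous_on: "g \<in> C1 \<Longrightarrow> continuous_on S g"
  using C1_has_derivative[THEN has_derivative_continuous] continuous_at_imp_continuous_on by blast

lemma C1_has_real_derivative_line:
  fixes g :: "real ^ 'n::finite \<Rightarrow> real"
  assumes "g \<in> C1"
  shows "((\<lambda>\<tau>. g (x + \<tau> *\<^sub>R v)) has_real_derivative (\<Sum>i\<in>UNIV. partial_deriv i g (x + \<tau> *\<^sub>R v) * v $ i)) (at \<tau>)"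
proof -
  have "((\<lambda>\<tau>. x + \<tau> *\<^sub>R v) has_derivative (\<lambda>t. t *\<^sub>R v)) (at \<tau>)"
    by (auto intro!: derivative_eq_intros)
  from has_derivative_compose[OF this C1_has_derivative[OF assms]]
  show ?thesis unfolding has_field_derivative_def
    by (rule has_derivative_eq_rhs) (auto simp: fun_eq_iff sum_distrib_left algebra_simps)
qed

lemma C2_taylor:
  fixes g :: "real ^ 'n::finite \<Rightarrow> real"
  assumes g: "g \<in> C2"
  obtains \<theta> where "0 \<le> \<theta>" "\<theta> \<le> 1"
    "g y = g x + (\<Sum>i\<in>UNIV. partial_deriv i g x * (y - x) $ i)
       + 1/2 * (\<Sum>i\<in>UNIV. \<Sum>j\<in>UNIV. partial_deriv i (partial_deriv j g) (x + \<theta> *\<^sub>R (y - x)) * (y - x) $ i * (y - x) $ j)"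
proof -
  define v where "v = y - x"
  \<comment> \<open>The derivatives of orders 0, 1 and 2 along the segment, in the indexed form that
    \<open>Maclaurin\<close> expects.\<close>
  define D where "D = (\<lambda>(m::nat) \<tau>. if m = 0 then g (x + \<tau> *\<^sub>R v) else
    if m = 1 then (\<Sum>j\<in>UNIV. partial_deriv j g (x + \<tau> *\<^sub>R v) * v $ j) else
    (\<Sum>j\<in>UNIV. (\<Sum>i\<in>UNIV. partial_deriv i (partial_deriv j g) (x + \<tau> *\<^sub>R v) * v $ i) * v $ j))"
  have g1: "g \<in> C1" and g2: "\<And>j. partial_deriv j g \<in> C1" using g by (auto simp: C2_def)
  have d0: "(D 0 has_real_derivative D 1 \<tau>) (at \<tau>)" for \<tau>
    using C1_has_real_derivative_line[OF g1] by (simp add: D_def)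
  have d1: "(D 1 has_real_derivative D 2 \<tau>) (at \<tau>)" for \<tau>
    unfolding D_def by (simp, intro DERIV_sum DERIV_cmult_right C1_has_real_derivative_line g2)
  have "\<exists>t>0. t < 1 \<and> D 0 1 = (\<Sum>m<2. D m 0 / fact m * 1 ^ m) + D 2 t / fact 2 * 1 ^ 2"
  proof (rule Maclaurin)
    show "\<forall>m t. m < 2 \<and> 0 \<le> t \<and> t \<le> 1 \<longrightarrow> (D m has_real_derivative D (Suc m) t) (at t)"
      using d0 d1 by (auto simp: less_Suc_eq numeral_2_eq_2)
  qed simp_all
  then obtain t where t: "0 < t" "t < 1" "D 0 1 = D 0 0 + D 1 0 + D 2 t / 2"
    by (auto simp: numeral_2_eq_2)
  have "D 2 t = (\<Sum>i\<in>UNIV. \<Sum>j\<in>UNIV. partial_deriv i (partial_deriv j g) (x + t *\<^sub>R v) * v $ i * v $ j)"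
    unfolding D_def by (simp add: sum_distrib_right) (rule sum.swap)
  with t show ?thesis
    by (intro that[of t]) (auto simp: D_def v_def)
qed

section \<open>Joint continuity of the gradient and the Hessian\<close>

lemma continuous_on_Times_local:
  fixes F :: "'a::metric_space \<times> 'b::metric_space \<Rightarrow> 'c::topological_space"
  assumes "\<And>x. \<exists>r>0. continuous_on (I \<times> ball x r) F"
  shows "continuous_on (I \<times> UNIV) F"
  unfolding continuous_on_eq_continuous_within
proof
  fix z assume z: "z \<in> I \<times> (UNIV :: 'b set)"
  obtain r where r: "r > 0" "continuous_on (I \<times> ball (snd z) r) F" using assms by blast
  then have "continuous (at z within (I \<times> ball (snd z) r)) F"
    using z by (auto simp: continuous_on_eq_continuous_within)
  moreover have "at z within (I \<times> ball (snd z) r) = at z within (I \<times> UNIV)"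
    by (rule at_within_nhd[of _ "UNIV \<times> ball (snd z) r"]) (use r in \<open>auto simp: open_Times mem_Times_iff\<close>)
  ultimately show "continuous (at z within (I \<times> UNIV)) F" by simp
qed

text \<open>The local content of the condition on compact sets: equicontinuity at each
  \<open>x\<close>, over all times at once. It gives control of oscillations of the Hessian, not of
  its size.\<close>

definition hess_equicontinuous :: "real set \<Rightarrow> (real \<Rightarrow> real ^ 'n::finite \<Rightarrow> real) \<Rightarrow> bool" where
  "hess_equicontinuous I f \<longleftrightarrow> (\<forall>i j x. \<forall>e>0. \<exists>r>0. \<forall>s\<in>I. \<forall>y. dist y x < r \<longrightarrow> \<bar>hess_x f i j s y - hess_x f i j s x\<bar> \<le> e)"

lemma C02_ac_base_hess_equicontinuous:
  assumes "f \<in> C02_ac_base I"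
  shows "hess_equicontinuous I f"
  unfolding hess_equicontinuous_def
proof (intro allI impI)
  fix i j :: 'a and x :: "real ^ 'a" and e :: real assume e: "e > 0"
  have "uniform_limit I (\<lambda>y s. hess_x f i j s y) (\<lambda>s. hess_x f i j s x) (at x within cball x 1)"
    using assms unfolding C02_ac_base_def by (metis (no_types, lifting) centre_in_cball compact_cball mem_Collect_eq zero_le_one)
  then have "\<forall>\<^sub>F y in at x within cball x 1. \<forall>s\<in>I. dist (hess_x f i j s y) (hess_x f i j s x) < e"
    using e by (auto dest: uniform_limitD)
  then obtain d where d: "d > 0" "\<And>y s. y \<in> cball x 1 \<Longrightarrow> y \<noteq> x \<Longrightarrow> dist y x < d \<Longrightarrow> s \<in> I \<Longrightarrow> dist (hess_x f i j s y) (hess_x f i j s x) < e"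
    unfolding eventually_at by auto
  show "\<exists>r>0. \<forall>s\<in>I. \<forall>y. dist y x < r \<longrightarrow> \<bar>hess_x f i j s y - hess_x f i j s x\<bar> \<le> e"
  proof (intro exI[of _ "min d 1"] conjI ballI allI impI)
    fix s y assume "s \<in> I" "dist y x < min d 1"
    then show "\<bar>hess_x f i j s y - hess_x f i j s x\<bar> \<le> e"
      using d(2)[of y s] e by (cases "y = x") (auto simp: dist_real_def dist_commute)
  qed (use d in auto)
qed

text \<open>Central differences: their error is \<open>h / 2\<close> times an oscillation of the second derivative, so no
  bound on that derivative is needed.\<close>

lemma partial_deriv_jointly_continuous:
  fixes f :: "real \<Rightarrow> real ^ 'n::finite \<Rightarrow> real"
  assumes c: "continuous_on (I \<times> UNIV) (\<lambda>(s, x). f s x)" and C2: "\<And>s. s \<in> I \<Longrightarrow> f s \<in> C2"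
    and eq: "hess_equicontinuous I f"
  shows "continuous_on (I \<times> UNIV) (\<lambda>(s, x). partial_deriv j (f s) x)"
proof (rule continuous_on_Times_local)
  fix x0 :: "real ^ 'n"
  obtain r where r: "r > 0" "\<And>s y. s \<in> I \<Longrightarrow> dist y x0 < r \<Longrightarrow> \<bar>hess_x f j j s y - hess_x f j j s x0\<bar> \<le> 1"
    using eq unfolding hess_equicontinuous_def by (meson zero_less_one)
  \<comment> \<open>The quotients are shown to converge uniformly only near \<open>x0\<close>, hence
    the localization. Halving the radius leaves room for steps with
    \<open>\<bar>h\<bar> < r / 2\<close>.\<close>
  let ?S = "I \<times> ball x0 (r/2)"
  let ?F = "\<lambda>h (s, x). (f s (x + h *\<^sub>R axis j 1) - f s (x - h *\<^sub>R axis j 1)) / (2 * h)"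
  \<comment> \<open>The quadratic term is anchored at \<open>x0\<close>, so that it is the same for
    \<open>h\<close> and \<open>-h\<close> and cancels in the central difference. Each side leaves
    an error \<open>h\<^sup>2 / 2\<close>, together \<open>h\<^sup>2\<close>, and division by
    \<open>2 * h\<close> gives \<open>h / 2\<close>.\<close>
  have tay: "\<bar>f s (x + h *\<^sub>R axis j 1) - (f s x + h * partial_deriv j (f s) x + 1/2 * h\<^sup>2 * hess_x f j j s x0)\<bar> \<le> h\<^sup>2 / 2"
    if s: "s \<in> I" and x: "x \<in> ball x0 (r/2)" and h: "\<bar>h\<bar> < r / 2" for s x h
  proof -
    obtain \<theta> where \<theta>: "0 \<le> \<theta>" "\<theta> \<le> 1"
      "f s (x + h *\<^sub>R axis j 1) = f s x + (\<Sum>i\<in>UNIV. partial_deriv i (f s) x * (h *\<^sub>R axis j 1) $ i)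
       + 1/2 * (\<Sum>i\<in>UNIV. \<Sum>k\<in>UNIV. partial_deriv i (partial_deriv k (f s)) (x + \<theta> *\<^sub>R (h *\<^sub>R axis j 1)) * (h *\<^sub>R axis j 1) $ i * (h *\<^sub>R axis j 1) $ k)"
      using C2_taylor[OF C2[OF s], of "x + h *\<^sub>R axis j 1" x] by auto
    have ax: "(h *\<^sub>R axis j 1) $ i = (if i = j then h else 0)" for i
      by (simp add: axis_def)
    have s1: "(\<Sum>i\<in>UNIV. partial_deriv i (f s) x * (h *\<^sub>R axis j 1) $ i) = h * partial_deriv j (f s) x"
      unfolding ax by (simp add: if_distrib mult.commute cong: if_cong)
    define y where "y = x + \<theta> *\<^sub>R (h *\<^sub>R axis j 1)"
    have s2: "(\<Sum>i\<in>UNIV. \<Sum>k\<in>UNIV. partial_deriv i (partial_deriv k (f s)) y * (h *\<^sub>R axis j 1) $ i * (h *\<^sub>R axis j 1) $ k)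
      = h\<^sup>2 * hess_x f j j s y"
    proof -
      have P: "(\<Sum>k\<in>UNIV. P k * c * (if k = j then h else 0)) = P j * c * h" for P :: "'n \<Rightarrow> real" and c
        by (simp add: if_distrib mult.commute cong: if_cong)
      then have "(\<Sum>i\<in>UNIV. \<Sum>k\<in>UNIV. partial_deriv i (partial_deriv k (f s)) y * (h *\<^sub>R axis j 1) $ i * (h *\<^sub>R axis j 1) $ k)
        = (\<Sum>i\<in>UNIV. hess_x f i j s y * (if i = j then h else 0) * h)"
        unfolding ax P by (simp only: hess_x_def)
      also have "\<dots> = (\<Sum>i\<in>UNIV. hess_x f i j s y * h * (if i = j then h else 0))"
        by (simp only: ac_simps)
      also have "\<dots> = hess_x f j j s y * h * h"
        by (rule P)
      finally show ?thesis by (simp add: power2_eq_square)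
    qed
    have "dist y x0 \<le> dist x x0 + \<bar>\<theta>\<bar> * \<bar>h\<bar>"
      unfolding y_def dist_norm using norm_triangle_ineq[of "x - x0" "\<theta> *\<^sub>R (h *\<^sub>R axis j 1)"]
      by (simp add: norm_axis_1 abs_mult algebra_simps)
    also have "\<dots> \<le> dist x x0 + 1 * \<bar>h\<bar>" using \<theta> by (intro add_left_mono mult_right_mono) auto
    also have "\<dots> < r" using x h by (simp add: dist_commute)
    finally have "\<bar>hess_x f j j s y - hess_x f j j s x0\<bar> \<le> 1" using r(2) s by simp
    then have "\<bar>h\<^sup>2 * (hess_x f j j s y - hess_x f j j s x0)\<bar> \<le> h\<^sup>2 * 1"
      unfolding abs_mult by (intro mult_mono) auto
    moreover have "f s (x + h *\<^sub>R axis j 1) - (f s x + h * partial_deriv j (f s) x + 1/2 * h\<^sup>2 * hess_x f j j s x0)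
       = (h\<^sup>2 * (hess_x f j j s y - hess_x f j j s x0)) / 2"
      unfolding \<theta>(3) s1 y_def[symmetric] s2 by (simp add: algebra_simps)
    ultimately show ?thesis by (simp only: abs_divide)
  qed
  have "continuous_on ?S (\<lambda>(s, x). partial_deriv j (f s) x)"
  proof (rule uniform_limit_theorem[where f = ?F and F = "at_right 0"])
    show "\<forall>\<^sub>F h in at_right 0. continuous_on ?S (?F h)"
      unfolding eventually_at_right_field
    proof (intro exI[of _ 1] conjI allI impI)
      fix h :: real assume "h > 0"
      have *: "continuous_on ?S (\<lambda>z. f (fst z) (snd z + c *\<^sub>R axis j 1))" for c
        using continuous_on_compose2[OF c, of ?S "\<lambda>z. (fst z, snd z + c *\<^sub>R axis j 1)"]
        by (force intro!: continuous_intros)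
      show "continuous_on ?S (?F h)" unfolding split_def
        using *[of h] *[of "-h"] \<open>h > 0\<close> by (intro continuous_intros) auto
    qed simp
    show "uniform_limit ?S ?F (\<lambda>(s, x). partial_deriv j (f s) x) (at_right 0)"
      unfolding uniform_limit_iff
    proof (intro allI impI)
      fix e :: real assume e: "e > 0"
      show "\<forall>\<^sub>F h in at_right 0. \<forall>z\<in>?S. dist (?F h z) (case z of (s, x) \<Rightarrow> partial_deriv j (f s) x) < e"
        unfolding eventually_at_right_field
      proof (intro exI[of _ "min e (r/2)"] conjI allI impI ballI)
        fix h z assume h: "0 < h" "h < min e (r/2)" and z: "z \<in> ?S"
        obtain s x where zz: "z = (s,x)" "s \<in> I" "x \<in> ball x0 (r/2)" using z by auto
        have "\<bar>f s (x + h *\<^sub>R axis j 1) - f s (x - h *\<^sub>R axis j 1) - 2 * h * partial_deriv j (f s) x\<bar> \<le> h\<^sup>2"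
          using tay[OF zz(2,3), of h] tay[OF zz(2,3), of "-h"] h
          unfolding minus_mult_left[symmetric] scaleR_minus_left power2_minus diff_conv_add_uminus[symmetric] by argo
        moreover have "?F h z - partial_deriv j (f s) x = (f s (x + h *\<^sub>R axis j 1) - f s (x - h *\<^sub>R axis j 1) - 2 * h * partial_deriv j (f s) x) / (2 * h)"
          using h by (simp add: zz field_simps)
        ultimately have "\<bar>?F h z - partial_deriv j (f s) x\<bar> \<le> h\<^sup>2 / (2 * h)"
          using h by (simp add: divide_right_mono)
        then have "\<bar>?F h z - partial_deriv j (f s) x\<bar> \<le> h / 2"
          using h by (simp add: power2_eq_square field_simps)
        then show "dist (?F h z) (case z of (s, x) \<Rightarrow> partial_deriv j (f s) x) < e"
          using h by (simp add: zz dist_real_def)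
      qed (use e r in auto)
    qed
  qed simp
  then show "\<exists>r>0. continuous_on (I \<times> ball x0 r) (\<lambda>(s, x). partial_deriv j (f s) x)"
    using r by (intro exI[of _ "r/2"]) auto
qed

text \<open>By the mean value theorem, difference quotients of the gradient are Hessian values at
  nearby points, so equicontinuity makes them converge uniformly in time; this gives continuity in
  time at fixed \<open>x\<close>. A second use of equicontinuity, to move from \<open>x'\<close> to
  \<open>x\<close>, joins the time slices.\<close>

lemma hess_jointly_continuous:
  fixes f :: "real \<Rightarrow> real ^ 'n::finite \<Rightarrow> real"
  assumes c: "continuous_on (I \<times> UNIV) (\<lambda>(s, x). f s x)" and C2: "\<And>s. s \<in> I \<Longrightarrow> f s \<in> C2"
    and eq: "hess_equicontinuous I f"
  shows "continuous_on (I \<times> UNIV) (\<lambda>(s, x). hess_x f i j s x)"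
proof -
  note g = partial_deriv_jointly_continuous[OF assms, of j]
  have slice: "continuous_on I (\<lambda>s. hess_x f i j s x)" for x
  proof (rule uniform_limit_theorem[where f = "\<lambda>h s. (partial_deriv j (f s) (x + h *\<^sub>R axis i 1) - partial_deriv j (f s) x) / h" and F = "at_right 0"])
    show "\<forall>\<^sub>F h in at_right 0. continuous_on I (\<lambda>s. (partial_deriv j (f s) (x + h *\<^sub>R axis i 1) - partial_deriv j (f s) x) / h)"
      unfolding eventually_at_right_field
    proof (intro exI[of _ 1] conjI allI impI)
      fix h :: real assume "h > 0"
      have *: "continuous_on I (\<lambda>s. partial_deriv j (f s) y)" for y
        using continuous_on_compose2[OF g, of I "\<lambda>s. (s, y)"] by (force intro!: continuous_intros)
      show "continuous_on I (\<lambda>s. (partial_deriv j (f s) (x + h *\<^sub>R axis i 1) - partial_deriv j (f s) x) / h)"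
        using * \<open>h > 0\<close> by (intro continuous_intros) auto
    qed simp
    show "uniform_limit I (\<lambda>h s. (partial_deriv j (f s) (x + h *\<^sub>R axis i 1) - partial_deriv j (f s) x) / h)
       (\<lambda>s. hess_x f i j s x) (at_right 0)"
      unfolding uniform_limit_iff
    proof (intro allI impI)
      fix e :: real assume e: "e > 0"
      obtain r where r: "r > 0" "\<And>s y. s \<in> I \<Longrightarrow> dist y x < r \<Longrightarrow> \<bar>hess_x f i j s y - hess_x f i j s x\<bar> \<le> e/2"
        using eq e unfolding hess_equicontinuous_def by (meson half_gt_zero)
      show "\<forall>\<^sub>F h in at_right 0. \<forall>s\<in>I. dist ((partial_deriv j (f s) (x + h *\<^sub>R axis i 1) - partial_deriv j (f s) x) / h) (hess_x f i j s x) < e"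
        unfolding eventually_at_right_field
      proof (intro exI[of _ r] conjI allI impI ballI)
        fix h s assume h: "0 < h" "h < r" and s: "s \<in> I"
        have "partial_deriv j (f s) \<in> C1" using C2[OF s] by (simp add: C2_def)
        then obtain \<theta> where \<theta>: "\<bar>\<theta>\<bar> \<le> \<bar>h\<bar>" "partial_deriv j (f s) (x + h *\<^sub>R axis i 1) - partial_deriv j (f s) x = h * hess_x f i j s (x + \<theta> *\<^sub>R axis i 1)"
          using C1_mvt_axis unfolding hess_x_def by metis
        have "dist (x + \<theta> *\<^sub>R axis i 1) x < r" using \<theta>(1) h by (simp add: dist_norm norm_axis_1)
        from r(2)[OF s this] show "dist ((partial_deriv j (f s) (x + h *\<^sub>R axis i 1) - partial_deriv j (f s) x) / h) (hess_x f i j s x) < e"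
          unfolding \<theta>(2) using h e by (simp add: dist_real_def)
      qed (use r in auto)
    qed
  qed simp
  show ?thesis
    unfolding continuous_on_iff
  proof (intro ballI allI impI)
    fix z e assume z: "z \<in> I \<times> (UNIV :: (real ^ 'n) set)" and e: "(e::real) > 0"
    obtain s x where zz: "z = (s,x)" "s \<in> I" using z by auto
    obtain r where r: "r > 0" "\<And>s y. s \<in> I \<Longrightarrow> dist y x < r \<Longrightarrow> \<bar>hess_x f i j s y - hess_x f i j s x\<bar> \<le> e/2"
      using eq e unfolding hess_equicontinuous_def by (meson half_gt_zero)
    obtain d where d: "d > 0" "\<And>s'. s' \<in> I \<Longrightarrow> dist s' s < d \<Longrightarrow> dist (hess_x f i j s' x) (hess_x f i j s x) < e/2"
      using slice[of x] zz e unfolding continuous_on_iff by (meson half_gt_zero)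
    show "\<exists>d>0. \<forall>z'\<in>I \<times> UNIV. dist z' z < d \<longrightarrow> dist (case z' of (s, x) \<Rightarrow> hess_x f i j s x) (case z of (s, x) \<Rightarrow> hess_x f i j s x) < e"
    proof (intro exI[of _ "min r d"] conjI ballI impI)
      fix z' assume z': "z' \<in> I \<times> (UNIV :: (real ^ 'n) set)" "dist z' z < min r d"
      obtain s' x' where zz': "z' = (s',x')" "s' \<in> I" using z' by auto
      have "dist s' s < d" "dist x' x < r"
        using z'(2) dist_fst_le[of z' z] dist_snd_le[of z' z] by (auto simp: zz zz')
      with r(2)[OF zz'(2)] d(2)[OF zz'(2)] show "dist (case z' of (s, x) \<Rightarrow> hess_x f i j s x) (case z of (s, x) \<Rightarrow> hess_x f i j s x) < e"
        unfolding zz zz' dist_real_def prod.case by (smt (verit) field_sum_of_halves)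
    qed (use r d in auto)
  qed
qed

section \<open>Riemann--Stieltjes sums\<close>

definition grid :: "real \<Rightarrow> real \<Rightarrow> nat \<Rightarrow> nat \<Rightarrow> real" where
  "grid a b N k = a + real k * (b - a) / real N"

definition rsum :: "(real \<Rightarrow> real) \<Rightarrow> (real \<Rightarrow> real) \<Rightarrow> real \<Rightarrow> real \<Rightarrow> nat \<Rightarrow> real" where
  "rsum g A a b N = (\<Sum>k<N. g (grid a b N k) * (A (grid a b N (Suc k)) - A (grid a b N k)))"

lemma grid_0 [simp]: "grid a b N 0 = a" by (simp add: grid_def)
lemma grid_N [simp]: "N > 0 \<Longrightarrow> grid a b N N = b" by (simp add: grid_def)
lemma grid_Suc: "grid a b N (Suc k) = grid a b N k + (b - a) / N"
  by (simp add: grid_def ring_distribs add_divide_distrib diff_divide_distrib)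
lemma grid_mem: "a \<le> b \<Longrightarrow> k \<le> N \<Longrightarrow> N > 0 \<Longrightarrow> grid a b N k \<in> {a..b}"
proof -
  assume *: "a \<le> b" "k \<le> N" "N > 0"
  then have "real k * (b - a) / real N \<le> real N * (b - a) / real N"
    by (intro divide_right_mono mult_right_mono) auto
  then show ?thesis using * by (simp add: grid_def)
qed

text \<open>\<open>\<Phi> u v\<close> plays the role of \<open>\<integral> g dP\<close> over \<open>[u,v]\<close>. Axiomatizing it treats the Lebesgue--Stieltjes
  integral and the integral against a density alike, without identifying the two measures.\<close>

definition rs_functional :: "(real \<Rightarrow> real) \<Rightarrow> (real \<Rightarrow> real) \<Rightarrow> real \<Rightarrow> real \<Rightarrow> (real \<Rightarrow> real \<Rightarrow> real) \<Rightarrow> bool" where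
  "rs_functional g P a b \<Phi> \<longleftrightarrow>
     mono_on {a..b} P \<and>
     (\<forall>u v w. a \<le> u \<and> u \<le> v \<and> v \<le> w \<and> w \<le> b \<longrightarrow> \<Phi> u w = \<Phi> u v + \<Phi> v w) \<and>
     (\<forall>u v c e. a \<le> u \<and> u \<le> v \<and> v \<le> b \<and> (\<forall>r\<in>{u..v}. \<bar>g r - c\<bar> \<le> e) \<longrightarrow>
        \<bar>\<Phi> u v - c * (P v - P u)\<bar> \<le> e * (P v - P u))"

lemma rs_functionalD:
  assumes "rs_functional g P a b \<Phi>"
  shows "mono_on {a..b} P"
    and "\<lbrakk>a \<le> u; u \<le> v; v \<le> w; w \<le> b\<rbrakk> \<Longrightarrow> \<Phi> u w = \<Phi> u v + \<Phi> v w"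
    and "\<lbrakk>a \<le> u; u \<le> v; v \<le> b; \<And>r. r \<in> {u..v} \<Longrightarrow> \<bar>g r - c\<bar> \<le> e\<rbrakk> \<Longrightarrow> \<bar>\<Phi> u v - c * (P v - P u)\<bar> \<le> e * (P v - P u)"
  using assms unfolding rs_functional_def by blast+

text \<open>The oscillation axiom on each grid cell, with \<open>c\<close> the value of
  \<open>g\<close> at the left end, adds up over the cells. The error depends on \<open>P\<close>
  only through its total increment, so the estimate is uniform along a sequence of integrators whose
  increments stay bounded.\<close>

lemma rs_functional_rsum_bound:
  assumes F: "rs_functional g P a b \<Phi>" and ab: "a \<le> b" and N: "N > 0"
    and osc: "\<And>r r'. \<lbrakk>r \<in> {a..b}; r' \<in> {a..b}; \<bar>r - r'\<bar> \<le> (b - a) / N\<rbrakk> \<Longrightarrow> \<bar>g r - g r'\<bar> \<le> e"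
  shows "\<bar>\<Phi> a b - rsum g P a b N\<bar> \<le> e * (P b - P a)"
proof -
  have "m \<le> N \<Longrightarrow> \<bar>\<Phi> a (grid a b N m) - (\<Sum>k<m. g (grid a b N k) * (P (grid a b N (Suc k)) - P (grid a b N k)))\<bar>
     \<le> e * (P (grid a b N m) - P a)" for m
  proof (induction m)
    case 0
    have "\<Phi> a a = 0" using rs_functionalD(2)[OF F, of a a a] ab by simp
    then show ?case by simp
  next
    case (Suc m)
    let ?u = "grid a b N m" and ?v = "grid a b N (Suc m)"
    have uv: "?u \<in> {a..b}" "?v \<in> {a..b}" "?u \<le> ?v" "?v = ?u + (b - a) / N"
      using Suc.prems N ab grid_mem[of a b m N] grid_mem[of a b "Suc m" N] by (auto simp: grid_Suc)
    have 1: "\<Phi> a ?v = \<Phi> a ?u + \<Phi> ?u ?v" using uv by (intro rs_functionalD(2)[OF F]) auto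
    have 2: "\<bar>\<Phi> ?u ?v - g ?u * (P ?v - P ?u)\<bar> \<le> e * (P ?v - P ?u)"
      using uv by (intro rs_functionalD(3)[OF F] osc) auto
    have 3: "e * (P ?v - P a) = e * (P ?u - P a) + e * (P ?v - P ?u)" by (simp add: algebra_simps)
    show ?case using Suc 2 unfolding 1 3 sum.lessThan_Suc by linarith
  qed
  from this[of N] show ?thesis using N by (simp add: rsum_def)
qed

lemma continuous_grid_oscillation:
  fixes g :: "real \<Rightarrow> real"
  assumes "continuous_on {a..b} g" "e > 0"
  shows "\<forall>\<^sub>F N in sequentially. \<forall>r\<in>{a..b}. \<forall>r'\<in>{a..b}. \<bar>r - r'\<bar> \<le> (b - a) / Suc N \<longrightarrow> \<bar>g r - g r'\<bar> \<le> e"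
proof -
  have "uniformly_continuous_on {a..b} g"
    using assms by (intro compact_uniformly_continuous) auto
  then obtain d where d: "d > 0" "\<And>x x'. x \<in> {a..b} \<Longrightarrow> x' \<in> {a..b} \<Longrightarrow> dist x' x < d \<Longrightarrow> dist (g x') (g x) < e"
    unfolding uniformly_continuous_on_def using assms(2) by metis
  have "(\<lambda>N. (b - a) / Suc N) \<longlonglongrightarrow> 0"
    by (rule LIMSEQ_Suc[OF lim_const_over_n])
  then have "\<forall>\<^sub>F N in sequentially. (b - a) / Suc N < d"
    using d(1) by (rule order_tendstoD)
  then show ?thesis
    by eventually_elim (use d(2) in \<open>force simp: dist_real_def abs_minus_commute\<close>)
qed

lemma rs_functional_rsum_tendsto:
  assumes F: "rs_functional g P a b \<Phi>" and ab: "a \<le> b" and g: "continuous_on {a..b} g"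
  shows "(\<lambda>N. rsum g P a b (Suc N)) \<longlonglongrightarrow> \<Phi> a b"
proof (rule tendstoI)
  fix e :: real assume e: "e > 0"
  have P: "P b - P a \<ge> 0" using rs_functionalD(1)[OF F] ab by (simp add: mono_on_def)
  define e' where "e' = e / (2 * (P b - P a + 1))"
  have e': "e' > 0" "e' * (P b - P a + 1) = e / 2" using e P by (auto simp: e'_def divide_eq_eq)
  show "\<forall>\<^sub>F N in sequentially. dist (rsum g P a b (Suc N)) (\<Phi> a b) < e"
    using continuous_grid_oscillation[OF g e'(1)]
  proof eventually_elim
    case (elim N)
    then have "\<bar>\<Phi> a b - rsum g P a b (Suc N)\<bar> \<le> e' * (P b - P a)"
      by (intro rs_functional_rsum_bound[OF F ab]) auto
    moreover have "e' * (P b - P a) < e' * (P b - P a + 1)" using e' by simp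
    ultimately show ?case using e' e by (simp add: dist_real_def abs_minus_commute)
  qed
qed

text \<open>A Helly--Bray statement. On a fixed grid only finitely many values of
  \<open>Pn n\<close> occur, so the sums converge, while both discretization errors are bounded by
  an oscillation of \<open>g\<close> times a total increment.\<close>

lemma rs_functional_convergence:
  assumes F: "rs_functional g P a b \<Phi>" and Fn: "\<And>n::nat. rs_functional g (Pn n) a b (\<Phi>n n)"
    and ab: "a \<le> b" and g: "continuous_on {a..b} g"
    and conv: "\<And>q. q \<in> {a..b} \<Longrightarrow> (\<lambda>n. Pn n q) \<longlonglongrightarrow> P q"
  shows "(\<lambda>n. \<Phi>n n a b) \<longlonglongrightarrow> \<Phi> a b"
proof (rule tendstoI)
  fix e :: real assume e: "e > 0"
  have P: "P b - P a \<ge> 0" using rs_functionalD(1)[OF F] ab by (simp add: mono_on_def)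
  \<comment> \<open>One third of \<open>e\<close> for each discretization error and one for the
    difference of the sums. The summand \<open>1\<close> is the room for
    \<open>Pn n b - Pn n a\<close>, which eventually falls below
    \<open>P b - P a + 1\<close>.\<close>
  define e' where "e' = e / (3 * (P b - P a + 1))"
  have e': "e' > 0" "e' * (P b - P a + 1) = e / 3" using e P by (auto simp: e'_def divide_eq_eq)
  obtain N where N: "\<forall>r\<in>{a..b}. \<forall>r'\<in>{a..b}. \<bar>r - r'\<bar> \<le> (b - a) / Suc N \<longrightarrow> \<bar>g r - g r'\<bar> \<le> e'"
    using continuous_grid_oscillation[OF g e'(1)] by (auto simp: eventually_sequentially)
  have b1: "\<bar>\<Phi> a b - rsum g P a b (Suc N)\<bar> \<le> e' * (P b - P a)"
    using N by (intro rs_functional_rsum_bound[OF F ab]) auto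
  have b2: "\<bar>\<Phi>n n a b - rsum g (Pn n) a b (Suc N)\<bar> \<le> e' * (Pn n b - Pn n a)" for n
    using N by (intro rs_functional_rsum_bound[OF Fn ab]) auto
  have c1: "(\<lambda>n. rsum g (Pn n) a b (Suc N)) \<longlonglongrightarrow> rsum g P a b (Suc N)"
    unfolding rsum_def using ab by (intro tendsto_intros conv grid_mem) auto
  have c2: "(\<lambda>n. Pn n b - Pn n a) \<longlonglongrightarrow> P b - P a"
    using ab by (intro tendsto_intros conv) auto
  have "\<forall>\<^sub>F n in sequentially. dist (rsum g (Pn n) a b (Suc N)) (rsum g P a b (Suc N)) < e / 3"
    using c1 e by (intro tendstoD) auto
  moreover have "\<forall>\<^sub>F n in sequentially. Pn n b - Pn n a < P b - P a + 1"
    using c2 by (rule order_tendstoD) auto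
  ultimately show "\<forall>\<^sub>F n in sequentially. dist (\<Phi>n n a b) (\<Phi> a b) < e"
  proof eventually_elim
    case (elim n)
    have "e' * (Pn n b - Pn n a) \<le> e' * (P b - P a + 1)" using elim e' by (intro mult_left_mono) auto
    moreover have "e' * (P b - P a) < e' * (P b - P a + 1)" using e' by simp
    ultimately show ?case using b1 b2[of n] elim(1) e'(2) unfolding dist_real_def by linarith
  qed
qed

lemma continuous_on_dist_dominated:
  assumes h: "continuous_on S h" and d: "\<And>x y. x \<in> S \<Longrightarrow> y \<in> S \<Longrightarrow> dist (f x) (f y) \<le> B * dist (h x) (h y)"
  shows "continuous_on S f"
  unfolding continuous_on_def
proof
  fix x assume x: "x \<in> S"
  have "((\<lambda>y. B * dist (h y) (h x)) \<longlongrightarrow> B * dist (h x) (h x)) (at x within S)"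
    using h x by (intro tendsto_intros) (auto simp: continuous_on_def)
  then have 0: "((\<lambda>y. B * dist (h y) (h x)) \<longlongrightarrow> 0) (at x within S)" by simp
  have "\<forall>\<^sub>F y in at x within S. norm (dist (f y) (f x)) \<le> B * dist (h y) (h x)"
    using d x by (auto simp: eventually_at_filter)
  from Lim_null_comparison[OF this 0] show "(f \<longlongrightarrow> f x) (at x within S)"
    by (rule tendsto_dist_iff[THEN iffD2])
qed

text \<open>The oscillation axiom with \<open>c = 0\<close> bounds the increments of
  \<open>\<Phi> a\<close> by \<open>B\<close> times those of \<open>P\<close>, so continuity is
  inherited from \<open>P\<close>.\<close>

lemma rs_functional_continuous:
  assumes F: "rs_functional g P a b \<Phi>" and g: "continuous_on {a..b} g" and P: "continuous_on {a..b} P"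
  shows "continuous_on {a..b} (\<Phi> a)"
proof -
  have "bounded (g ` {a..b})" using g by (intro compact_imp_bounded compact_continuous_image) auto
  then obtain B where B: "\<And>r. r \<in> {a..b} \<Longrightarrow> \<bar>g r\<bar> \<le> B" unfolding bounded_iff by force
  have *: "\<bar>\<Phi> a v - \<Phi> a u\<bar> \<le> B * \<bar>P v - P u\<bar>" if "u \<in> {a..b}" "v \<in> {a..b}" "u \<le> v" for u v
  proof -
    have "\<bar>\<Phi> u v - 0 * (P v - P u)\<bar> \<le> B * (P v - P u)"
      using that B by (intro rs_functionalD(3)[OF F]) auto
    moreover have "\<Phi> a v = \<Phi> a u + \<Phi> u v" using that by (intro rs_functionalD(2)[OF F]) auto
    moreover have "P u \<le> P v" using rs_functionalD(1)[OF F] that by (auto simp: mono_on_def)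
    ultimately show ?thesis by simp
  qed
  show ?thesis
  proof (rule continuous_on_dist_dominated[OF P, of _ B])
    fix x y assume "x \<in> {a..b}" "y \<in> {a..b}"
    then show "dist (\<Phi> a x) (\<Phi> a y) \<le> B * dist (P x) (P y)"
      using *[of x y] *[of y x] by (cases "x \<le> y") (auto simp: dist_real_def abs_minus_commute)
  qed
qed

section \<open>Lebesgue--Stieltjes integrals of continuous functions\<close>

lemma set_integrable_interval_measure:
  assumes P: "mono P" "continuous_on UNIV P" and g: "continuous_on {a..b} (g :: real \<Rightarrow> real)"
  shows "set_integrable (interval_measure P) {a..b} g"
proof (cases "a \<le> b")
  case True
  have "bounded (g ` {a..b})" using g by (intro compact_imp_bounded compact_continuous_image) auto
  then obtain B where B: "\<And>r. r \<in> {a..b} \<Longrightarrow> \<bar>g r\<bar> \<le> B" unfolding bounded_iff by force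
  have "emeasure (interval_measure P) {a..b} = P b - P a"
    using True P by (intro emeasure_interval_measure_Icc) (auto dest: monoD)
  then show ?thesis unfolding set_integrable_def
    using B g by (intro integrableI_bounded_set[where A = "{a..b}" and B = B])
      (auto intro!: borel_measurable_continuous_on_indicator[where f=g, unfolded real_scaleR_def] simp: measurable_cong_sets[OF sets_interval_measure refl])
qed (simp add: set_integrable_def)

lemma rs_functional_interval_measure:
  assumes P: "mono P" "continuous_on UNIV P" and g: "continuous_on {a..b} (g :: real \<Rightarrow> real)"
  shows "rs_functional g P a b (\<lambda>u v. LINT r:{u..v}|interval_measure P. g r)"
  unfolding rs_functional_def
proof (intro conjI allI impI; (elim conjE)?)
  have em: "emeasure (interval_measure P) {u..v} = ennreal (P v - P u)" if "u \<le> v" for u v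
    using that P by (intro emeasure_interval_measure_Icc) (auto dest: monoD)
  have int: "set_integrable (interval_measure P) {u..v} g" if "a \<le> u" "v \<le> b" for u v
    using P continuous_on_subset[OF g] that by (intro set_integrable_interval_measure) auto
  show "mono_on {a..b} P" using P(1) by (simp add: mono_on_def mono_def)
  {
    fix u v w assume uvw: "a \<le> u" "u \<le> v" "v \<le> w" "w \<le> b"
    \<comment> \<open>Points carry no mass since \<open>P\<close> is continuous, so the two closed
      intervals may share \<open>v\<close>.\<close>
    have null: "{v} \<in> null_sets (interval_measure P)" using em[of v v] by (auto simp: null_sets_def)
    have "(LINT r:{u..v} \<union> {v..w}|interval_measure P. g r) = (LINT r:{u..v}|interval_measure P. g r) + (LINT r:{v..w}|interval_measure P. g r)"
      using uvw by (intro set_integral_Un_AE int) (auto intro!: AE_I'[OF null])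
    moreover have "{u..v} \<union> {v..w} = {u..w}" using uvw by auto
    ultimately show "(LINT r:{u..w}|interval_measure P. g r) = (LINT r:{u..v}|interval_measure P. g r) + (LINT r:{v..w}|interval_measure P. g r)"
      by simp
  }
  fix u v c e assume uv: "a \<le> u" "u \<le> v" "v \<le> b" and e: "\<forall>r\<in>{u..v}. \<bar>g r - c\<bar> \<le> e"
  have m: "measure (interval_measure P) {u..v} = P v - P u"
    using em[OF uv(2)] P(1) uv by (simp add: measure_def mono_def)
  have c: "set_integrable (interval_measure P) {u..v} (\<lambda>r. c)" "(LINT r:{u..v}|interval_measure P. c) = c * (P v - P u)" for c
    using em[OF uv(2)] m by (auto simp: set_integral_const intro!: set_integrable_interval_measure P)
  have "(LINT r:{u..v}|interval_measure P. g r) - c * (P v - P u) = (LINT r:{u..v}|interval_measure P. g r - c)"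
    using int[OF uv(1,3)] c by (simp add: set_integral_diff)
  moreover have "\<bar>LINT r:{u..v}|interval_measure P. g r - c\<bar> \<le> (LINT r:{u..v}|interval_measure P. e)"
  proof -
    have i: "set_integrable (interval_measure P) {u..v} (\<lambda>r. g r - c)" using int[OF uv(1,3)] c by simp
    have "\<bar>LINT r:{u..v}|interval_measure P. g r - c\<bar> \<le> (LINT r:{u..v}|interval_measure P. \<bar>g r - c\<bar>)"
      using set_integral_norm_bound[OF i] by simp
    also have "\<dots> \<le> (LINT r:{u..v}|interval_measure P. e)"
      using e by (intro set_integral_mono set_integrable_abs i c) auto
    finally show ?thesis .
  qed
  ultimately show "\<bar>(LINT r:{u..v}|interval_measure P. g r) - c * (P v - P u)\<bar> \<le> e * (P v - P u)"
    using c by simp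
qed

lemma rs_functional_density:
  assumes \<rho>: "continuous_on {a..b} \<rho>" "\<And>r. r \<in> {a..b} \<Longrightarrow> 0 \<le> \<rho> r" and g: "continuous_on {a..b} (g :: real \<Rightarrow> real)"
  shows "rs_functional g (\<lambda>u. integral {a..u} \<rho>) a b (\<lambda>u v. integral {u..v} (\<lambda>r. g r * \<rho> r))"
  unfolding rs_functional_def
proof (intro conjI allI impI; (elim conjE)?)
  have int: "\<rho> integrable_on {u..v}" "(\<lambda>r. g r * \<rho> r) integrable_on {u..v}" if "a \<le> u" "v \<le> b" for u v
    using that by (auto intro!: integrable_continuous_interval continuous_intros continuous_on_subset[OF \<rho>(1)] continuous_on_subset[OF g])
  show "mono_on {a..b} (\<lambda>u. integral {a..u} \<rho>)"
    using \<rho>(2) by (auto simp: mono_on_def intro!: integral_subset_le int)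
  {
    fix u v w assume uvw: "a \<le> u" "u \<le> v" "v \<le> w" "w \<le> b"
    then show "integral {u..w} (\<lambda>r. g r * \<rho> r) = integral {u..v} (\<lambda>r. g r * \<rho> r) + integral {v..w} (\<lambda>r. g r * \<rho> r)"
      by (intro Henstock_Kurzweil_Integration.integral_combine[symmetric] int) auto
  }
  fix u v c e assume uv: "a \<le> u" "u \<le> v" "v \<le> b" and e: "\<forall>r\<in>{u..v}. \<bar>g r - c\<bar> \<le> e"
  have d: "integral {a..v} \<rho> - integral {a..u} \<rho> = integral {u..v} \<rho>"
    using Henstock_Kurzweil_Integration.integral_combine[of a u v \<rho>] uv int by simp
  have "integral {u..v} (\<lambda>r. g r * \<rho> r) - c * integral {u..v} \<rho> = integral {u..v} (\<lambda>r. (g r - c) * \<rho> r)"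
    using integral_diff[OF int(2)[OF uv(1,3)] integrable_on_cmult_left[OF int(1)[OF uv(1,3)], of c]]
    by (simp add: left_diff_distrib)
  moreover have "norm (integral {u..v} (\<lambda>r. (g r - c) * \<rho> r)) \<le> integral {u..v} (\<lambda>r. e * \<rho> r)"
  proof (rule integral_norm_bound_integral)
    show "(\<lambda>r. (g r - c) * \<rho> r) integrable_on {u..v}"
      using uv by (auto intro!: integrable_continuous_interval continuous_intros continuous_on_subset[OF \<rho>(1)] continuous_on_subset[OF g])
    show "(\<lambda>r. e * \<rho> r) integrable_on {u..v}" using integrable_on_cmult_left[OF int(1)[OF uv(1,3)], of e] by simp
    show "norm ((g x - c) * \<rho> x) \<le> e * \<rho> x" if "x \<in> {u..v}" for x
      using that e \<rho>(2)[of x] uv by (auto simp: abs_mult intro!: mult_right_mono)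
  qed
  ultimately show "\<bar>integral {u..v} (\<lambda>r. g r * \<rho> r) - c * (integral {a..v} \<rho> - integral {a..u} \<rho>)\<bar> \<le> e * (integral {a..v} \<rho> - integral {a..u} \<rho>)"
    unfolding d by simp
qed

lemma rsum_diff: "rsum g (\<lambda>r. A r - B r) a b N = rsum g A a b N - rsum g B a b N"
  unfolding rsum_def sum_subtractf[symmetric] by (simp add: algebra_simps)

lemma rsum_cong:
  assumes "a \<le> b" "\<And>r. r \<in> {a..b} \<Longrightarrow> A r = B r"
  shows "rsum g A a b N = rsum g B a b N"
  unfolding rsum_def using assms grid_mem[of a b] by (intro sum.cong refl) auto

text \<open>The sums mention only \<open>A\<close>, while the definition picks some \<open>P\<close>
  and \<open>N\<close>; hence every decomposition yields the same value. As limits of finite sums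
  the integrals also turn out to be measurable in \<open>\<omega>\<close> later on.\<close>

lemma has_stieltjes_integral_rsum_tendsto:
  assumes h: "has_stieltjes_integral g A a b z" and ab: "a \<le> b" and g: "continuous_on {a..b} g"
  shows "(\<lambda>N. rsum g A a b (Suc N)) \<longlonglongrightarrow> z"
proof -
  obtain P N where PN: "mono P" "mono N" "continuous_on UNIV P" "continuous_on UNIV N"
    "\<And>r. r \<in> {a..b} \<Longrightarrow> A r = P r - N r"
    "z = (LINT r:{a..b}|interval_measure P. g r) - (LINT r:{a..b}|interval_measure N. g r)"
    using h unfolding has_stieltjes_integral_def by blast
  have "(\<lambda>n. rsum g P a b (Suc n) - rsum g N a b (Suc n)) \<longlonglongrightarrow> z"
    unfolding PN(6)
    by (intro tendsto_diff rs_functional_rsum_tendsto[OF rs_functional_interval_measure ab g] PN g)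
  then show ?thesis
    using rsum_cong[of a b A "\<lambda>r. P r - N r" g, OF ab PN(5)] by (simp add: rsum_diff)
qed

lemma stieltjes_integral_eqI:
  assumes h: "has_stieltjes_integral g A a b z" and ab: "a \<le> b" and g: "continuous_on {a..b} g"
  shows "stieltjes_integral g A a b = z"
  unfolding stieltjes_integral_def
  by (rule the_equality) (use has_stieltjes_integral_rsum_tendsto[OF _ ab g] h LIMSEQ_unique in blast)+

lemma clamp_real: "a \<le> b \<Longrightarrow> clamp a b x = max a (min b (x::real))"
  unfolding clamp_def Basis_real_def by auto

lemma mono_ext_cont:
  assumes "mono_on {a..b} p" "a \<le> b"
  shows "mono (ext_cont p a b :: real \<Rightarrow> real)"
  unfolding ext_cont_def
proof (rule monoI)
  fix x y :: real assume "x \<le> y"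
  then show "p (clamp a b x) \<le> p (clamp a b y)"
    using assms by (intro mono_onD[OF assms(1)]) (auto simp: clamp_real)
qed

text \<open>The definition asks for integrators on the whole line, so \<open>p\<close> and
  \<open>n\<close> are continued by constants. One such pair serves every \<open>s\<close>, which
  gives continuity in the upper limit.\<close>

lemma stieltjes_integral_bounded_variation:
  assumes ab: "a \<le> b" and g: "continuous_on {a..b} g"
    and p: "mono_on {a..b} p" "continuous_on {a..b} p" and n: "mono_on {a..b} n" "continuous_on {a..b} n"
    and A: "\<And>r. r \<in> {a..b} \<Longrightarrow> A r = p r - n r"
  shows "\<And>s. s \<in> {a..b} \<Longrightarrow> stieltjes_integrable g A a s"
    and "\<And>s. s \<in> {a..b} \<Longrightarrow> (\<lambda>N. rsum g A a s (Suc N)) \<longlonglongrightarrow> stieltjes_integral g A a s"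
    and "continuous_on {a..b} (stieltjes_integral g A a)"
proof -
  let ?p = "ext_cont p a b" and ?n = "ext_cont n a b"
  let ?z = "\<lambda>s. (LINT r:{a..s}|interval_measure ?p. g r) - (LINT r:{a..s}|interval_measure ?n. g r)"
  have m: "mono ?p" "mono ?n" using p n ab by (auto intro: mono_ext_cont)
  have c: "continuous_on UNIV ?p" "continuous_on UNIV ?n" using p n by (auto intro!: continuous_on_ext_cont)
  have h: "has_stieltjes_integral g A a s (?z s)" if "s \<in> {a..b}" for s
    unfolding has_stieltjes_integral_def
    using that m c A by (intro exI[of _ ?p] exI[of _ ?n] conjI set_integrable_interval_measure continuous_on_subset[OF g]) auto
  then show "stieltjes_integrable g A a s" if "s \<in> {a..b}" for s
    using that by (auto simp: stieltjes_integrable_def)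
  have e: "stieltjes_integral g A a s = ?z s" if "s \<in> {a..b}" for s
    using that h by (intro stieltjes_integral_eqI continuous_on_subset[OF g]) auto
  show "(\<lambda>N. rsum g A a s (Suc N)) \<longlonglongrightarrow> stieltjes_integral g A a s" if "s \<in> {a..b}" for s
    unfolding e[OF that] using that
    by (intro has_stieltjes_integral_rsum_tendsto[OF h] continuous_on_subset[OF g]) auto
  have "continuous_on {a..b} ?z"
    by (intro continuous_on_diff rs_functional_continuous[OF rs_functional_interval_measure] m c g
       continuous_on_subset[OF c(1)] continuous_on_subset[OF c(2)]) auto
  then show "continuous_on {a..b} (stieltjes_integral g A a)"
    by (rule continuous_on_eq) (simp add: e)
qed

text \<open>Weak convergence of the measures with densities \<open>\<rho> k\<close> to the one
  generated by \<open>p\<close>. The two sides are integrals of different kinds, brought together by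
  \<open>rs_functional\<close>.\<close>

lemma stieltjes_integral_density_convergence:
  assumes ab: "a \<le> b" and g: "continuous_on {a..b} g"
    and p: "mono_on {a..b} p" "continuous_on {a..b} p"
    and \<rho>: "\<And>k::nat. continuous_on {a..b} (\<rho> k)" "\<And>k r. r \<in> {a..b} \<Longrightarrow> 0 \<le> \<rho> k r"
    and conv: "\<And>q. q \<in> {a..b} \<Longrightarrow> (\<lambda>k. integral {a..q} (\<rho> k)) \<longlonglongrightarrow> p q - p a"
  shows "(\<lambda>k. integral {a..b} (\<lambda>r. g r * \<rho> k r)) \<longlonglongrightarrow> stieltjes_integral g p a b"
proof -
  \<comment> \<open>Normalized to vanish at \<open>a\<close>, as the integrals of the densities do;
    a constant changes no increment and hence no sum.\<close>
  let ?p = "\<lambda>r. ext_cont p a b r - p a"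
  have m: "mono ?p" using mono_ext_cont[OF p(1) ab] by (auto simp: mono_def)
  have c: "continuous_on UNIV ?p" using p by (auto intro!: continuous_intros continuous_on_ext_cont)
  have F: "rs_functional g ?p a b (\<lambda>u v. LINT r:{u..v}|interval_measure ?p. g r)"
    by (intro rs_functional_interval_measure m c g)
  have "(\<lambda>N. rsum g ?p a b (Suc N)) \<longlonglongrightarrow> (LINT r:{a..b}|interval_measure ?p. g r)"
    by (rule rs_functional_rsum_tendsto[OF F ab g])
  moreover have "rsum g ?p a b N = rsum g p a b N" for N
    unfolding rsum_def using grid_mem[OF ab, of _ N] by (intro sum.cong refl) auto
  moreover have "(\<lambda>N. rsum g p a b (Suc N)) \<longlonglongrightarrow> stieltjes_integral g p a b"
    using ab by (intro stieltjes_integral_bounded_variation(2)[OF ab g p, of "\<lambda>_. 0"]) (auto simp: mono_on_def)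
  ultimately have "(LINT r:{a..b}|interval_measure ?p. g r) = stieltjes_integral g p a b"
    using LIMSEQ_unique by simp blast
  moreover have "(\<lambda>k. integral {a..b} (\<lambda>r. g r * \<rho> k r)) \<longlonglongrightarrow> (LINT r:{a..b}|interval_measure ?p. g r)"
    by (rule rs_functional_convergence[OF F rs_functional_density ab g]) (use \<rho> g conv in auto)
  ultimately show ?thesis by simp
qed

text \<open>The value of \<open>P k\<close> at \<open>q\<close> is squeezed between its values at
  two points of \<open>D\<close> on either side of \<open>q\<close>, chosen so close that the
  continuous limit hardly changes between them.\<close>

lemma monotone_convergence_from_dense:
  fixes p :: "real \<Rightarrow> real"
  assumes mono: "\<And>k::nat. mono_on {a..b} (P k)" and p: "continuous_on {a..b} p"
    and D: "D \<subseteq> {a..b}" "a \<in> D" "b \<in> D" and ex: "\<And>c c'. \<lbrakk>a \<le> c; c < c'; c' \<le> b\<rbrakk> \<Longrightarrow> \<exists>r\<in>D. c < r \<and> r < c'"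
    and conv: "\<And>q. q \<in> D \<Longrightarrow> (\<lambda>k. P k q) \<longlonglongrightarrow> p q" and q: "q \<in> {a..b}"
  shows "(\<lambda>k. P k q) \<longlonglongrightarrow> p q"
proof (cases "q \<in> D")
  case True
  then show ?thesis by (rule conv)
next
  case False
  then have q': "a < q" "q < b" using q D by (auto simp: order.strict_iff_order)
  show ?thesis
  proof (rule tendstoI)
    fix e :: real assume e: "e > 0"
    obtain d where d: "d > 0" "\<And>r. r \<in> {a..b} \<Longrightarrow> dist r q < d \<Longrightarrow> dist (p r) (p q) < e / 2"
      using p q e unfolding continuous_on_iff by (meson half_gt_zero)
    obtain r1 where r1: "r1 \<in> D" "max a (q - d) < r1" "r1 < q" using ex[of "max a (q - d)" q] q' d by auto
    obtain r2 where r2: "r2 \<in> D" "q < r2" "r2 < min b (q + d)" using ex[of q "min b (q + d)"] q' d by auto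
    have "dist (p r1) (p q) < e / 2" "dist (p r2) (p q) < e / 2"
      using r1 r2 q' d(2)[of r1] d(2)[of r2] by (auto simp: dist_real_def)
    note * = this
    have "\<forall>\<^sub>F k in sequentially. dist (P k r1) (p r1) < e / 2" "\<forall>\<^sub>F k in sequentially. dist (P k r2) (p r2) < e / 2"
      using e tendstoD[OF conv[OF r1(1)], of "e/2"] tendstoD[OF conv[OF r2(1)], of "e/2"] by auto
    then show "\<forall>\<^sub>F k in sequentially. dist (P k q) (p q) < e"
    proof eventually_elim
      case (elim k)
      have "P k r1 \<le> P k q" "P k q \<le> P k r2"
        using r1 r2 D q by (auto intro!: mono_onD[OF mono])
      then show ?case using * elim unfolding dist_real_def by linarith
    qed
  qed
qed

text \<open>With continuous paths the integral is a limit of Riemann sums (\<open>rsum\<close> for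
  the density \<open>1\<close>), each a finite combination of the measurable
  \<open>\<phi> r\<close>. This bypasses joint measurability in time and
  \<open>\<omega>\<close>.\<close>

lemma borel_measurable_integral_continuous:
  fixes \<phi> :: "real \<Rightarrow> 'w \<Rightarrow> real"
  assumes m: "\<And>r. r \<in> {a..b} \<Longrightarrow> \<phi> r \<in> borel_measurable M"
    and c: "\<And>\<omega>. \<omega> \<in> space M \<Longrightarrow> continuous_on {a..b} (\<lambda>r. \<phi> r \<omega>)"
  shows "(\<lambda>\<omega>. integral {a..b} (\<lambda>r. \<phi> r \<omega>)) \<in> borel_measurable M"
proof (cases "a \<le> b")
  case True
  show ?thesis
  proof (rule borel_measurable_LIMSEQ_real)
    fix \<omega> assume \<omega>: "\<omega> \<in> space M"
    have F: "rs_functional (\<lambda>r. \<phi> r \<omega>) (\<lambda>u. integral {a..u} (\<lambda>_. 1)) a b (\<lambda>u v. integral {u..v} (\<lambda>r. \<phi> r \<omega> * 1))"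
      by (rule rs_functional_density) (use c[OF \<omega>] in auto)
    show "(\<lambda>N. rsum (\<lambda>r. \<phi> r \<omega>) (\<lambda>u. integral {a..u} (\<lambda>_. 1)) a b (Suc N)) \<longlonglongrightarrow> integral {a..b} (\<lambda>r. \<phi> r \<omega>)"
      using rs_functional_rsum_tendsto[OF F True c[OF \<omega>]] by simp
  next
    fix N
    show "(\<lambda>\<omega>. rsum (\<lambda>r. \<phi> r \<omega>) (\<lambda>u. integral {a..u} (\<lambda>_. 1)) a b (Suc N)) \<in> borel_measurable M"
      unfolding rsum_def using m True
      by (intro borel_measurable_sum borel_measurable_times m grid_mem) auto
  qed
qed simp

section \<open>Time increments\<close>

text \<open>After a shift of variable the common stretch cancels and two end pieces of length
  \<open>\<epsilon>\<close> remain. This serves both to identify limits of increment quotients and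
  to bound averaged errors.\<close>

lemma integral_increment_shift:
  fixes \<phi> :: "real \<Rightarrow> real"
  assumes c: "continuous_on UNIV \<phi>" and "t \<le> s" "0 \<le> \<epsilon>"
  shows "integral {t..s} (\<lambda>r. \<phi> (r + \<epsilon>) - \<phi> r) = integral {s..s+\<epsilon>} \<phi> - integral {t..t+\<epsilon>} \<phi>"
proof -
  have i: "\<phi> integrable_on {a..b}" for a b
    by (intro integrable_continuous_interval continuous_on_subset[OF c]) auto
  have "(\<lambda>r. \<phi> (r + \<epsilon>)) integrable_on {t..s}"
    by (intro integrable_continuous_interval continuous_on_compose2[OF c] continuous_intros) auto
  then have "integral {t..s} (\<lambda>r. \<phi> (r + \<epsilon>) - \<phi> r) = integral {t..s} (\<lambda>r. \<phi> (r + \<epsilon>)) - integral {t..s} \<phi>"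
    using i by (rule integral_diff)
  also have "integral {t..s} (\<lambda>r. \<phi> (r + \<epsilon>)) = integral {t+\<epsilon>..s+\<epsilon>} \<phi>"
    using integral_shift[of t \<epsilon> s \<phi>] continuous_on_subset[OF c] by (simp add: o_def)
  finally show ?thesis
    using Henstock_Kurzweil_Integration.integral_combine[of t "t+\<epsilon>" "s+\<epsilon>" \<phi>]
      Henstock_Kurzweil_Integration.integral_combine[of t s "s+\<epsilon>" \<phi>] i assms by simp
qed

lemma integral_increment_quotient_tendsto:
  fixes \<phi> :: "real \<Rightarrow> real"
  assumes c: "continuous_on UNIV \<phi>" and ts: "t \<le> s" and e: "\<And>n. \<epsilon> n > 0" "\<epsilon> \<longlonglongrightarrow> 0"
  shows "(\<lambda>n. integral {t..s} (\<lambda>r. \<phi> (r + \<epsilon> n) - \<phi> r) / \<epsilon> n) \<longlonglongrightarrow> \<phi> s - \<phi> t"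
proof -
  have q: "(\<lambda>n. integral {s..s+\<epsilon> n} \<phi> / \<epsilon> n) \<longlonglongrightarrow> \<phi> s" for s
  proof -
    have "((\<lambda>x. integral {s..x} \<phi>) has_real_derivative \<phi> s) (at s within {s..s+1})"
      by (rule integral_has_real_derivative) (auto intro: continuous_on_subset[OF c])
    then have l: "((\<lambda>y. integral {s..y} \<phi> / (y - s)) \<longlongrightarrow> \<phi> s) (at s within {s..s+1})"
      by (simp add: has_field_derivative_iff)
    have "\<forall>\<^sub>F n in sequentially. \<epsilon> n < 1" using e by (auto intro: order_tendstoD)
    then have "\<forall>\<^sub>F n in sequentially. s + \<epsilon> n \<in> {s..s+1} \<and> s + \<epsilon> n \<noteq> s"
      by eventually_elim (use e(1) in \<open>auto simp: less_imp_le less_imp_neq[symmetric]\<close>)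
    moreover have "(\<lambda>n. s + \<epsilon> n) \<longlonglongrightarrow> s" using tendsto_add[OF tendsto_const e(2), of s] by simp
    ultimately have "filterlim (\<lambda>n. s + \<epsilon> n) (at s within {s..s+1}) sequentially"
      by (simp add: filterlim_at)
    from filterlim_compose[OF l this] show ?thesis by simp
  qed
  have "(\<lambda>n. integral {s..s+\<epsilon> n} \<phi> / \<epsilon> n - integral {t..t+\<epsilon> n} \<phi> / \<epsilon> n) \<longlonglongrightarrow> \<phi> s - \<phi> t"
    by (intro tendsto_diff q)
  then show ?thesis
    using integral_increment_shift[OF c ts] e(1) by (simp add: diff_divide_distrib less_imp_le)
qed

text \<open>Inside \<open>y\<close>, the time \<open>u\<close> is rounded down to a multiple of
  \<open>1 / Suc n\<close>. The rounded function coincides, for each of countably many values of the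
  floor, with a measurable slice of \<open>G\<close>; continuity of \<open>y\<close> and of
  \<open>G u\<close> gives the limit.\<close>

lemma caratheodory_measurable:
  fixes G :: "real \<Rightarrow> 'a::metric_space \<Rightarrow> real"
  assumes Gc: "\<And>u. continuous_on UNIV (G u)" and Gm: "\<And>y. (\<lambda>u. G u y) \<in> borel_measurable lebesgue"
    and y: "continuous_on UNIV y"
  shows "(\<lambda>u. G u (y u)) \<in> borel_measurable lebesgue"
proof (rule borel_measurable_LIMSEQ_real)
  fix u :: real
  have "(\<lambda>n. \<lfloor>real (Suc n) * u\<rfloor> / real (Suc n)) \<longlonglongrightarrow> u"
  proof (rule tendsto_sandwich[of "\<lambda>n. u - 1 / real (Suc n)" _ _ "\<lambda>n. u"])
    show "(\<lambda>n. u - 1 / real (Suc n)) \<longlonglongrightarrow> u"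
      using tendsto_diff[OF tendsto_const LIMSEQ_Suc[OF lim_const_over_n[of 1]], of u] by simp
    show "\<forall>\<^sub>F n in sequentially. u - 1 / real (Suc n) \<le> \<lfloor>real (Suc n) * u\<rfloor> / real (Suc n)"
    proof (rule always_eventually, rule allI)
      fix n
      have "real (Suc n) * u - 1 \<le> \<lfloor>real (Suc n) * u\<rfloor>" by linarith
      then have "(real (Suc n) * u - 1) / real (Suc n) \<le> \<lfloor>real (Suc n) * u\<rfloor> / real (Suc n)"
        by (rule divide_right_mono) simp
      then show "u - 1 / real (Suc n) \<le> \<lfloor>real (Suc n) * u\<rfloor> / real (Suc n)"
        by (simp add: diff_divide_distrib del: of_nat_Suc)
    qed
    show "\<forall>\<^sub>F n in sequentially. \<lfloor>real (Suc n) * u\<rfloor> / real (Suc n) \<le> u"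
    proof (rule always_eventually, rule allI)
      fix n
      have "\<lfloor>real (Suc n) * u\<rfloor> \<le> real (Suc n) * u" by linarith
      then show "\<lfloor>real (Suc n) * u\<rfloor> / real (Suc n) \<le> u"
        by (simp add: divide_le_eq mult.commute del: of_nat_Suc)
    qed
  qed simp
  then have "(\<lambda>n. y (\<lfloor>real (Suc n) * u\<rfloor> / real (Suc n))) \<longlonglongrightarrow> y u"
    using y by (intro continuous_on_tendsto_compose[OF y]) auto
  then show "(\<lambda>n. G u (y (\<lfloor>real (Suc n) * u\<rfloor> / real (Suc n)))) \<longlonglongrightarrow> G u (y u)"
    by (intro continuous_on_tendsto_compose[OF Gc]) auto
next
  fix n
  have [measurable]: "(\<lambda>u::real. \<lfloor>real (Suc n) * u\<rfloor>) \<in> lebesgue \<rightarrow>\<^sub>M count_space UNIV"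
    by (rule measurable_completion) measurable
  show "(\<lambda>u. G u (y (real_of_int \<lfloor>real (Suc n) * u\<rfloor> / real (Suc n)))) \<in> borel_measurable lebesgue"
    by (rule measurable_compose_countable[where f = "\<lambda>i u. G u (y (real_of_int i / real (Suc n)))"]) (use Gm in measurable)
qed

lemma integrable_lebesgue_interval:
  fixes h :: "real \<Rightarrow> real"
  assumes "integrable lebesgue h"
  shows "h integrable_on {a..b}" "(LINT u:{a..b}|lebesgue. h u) = integral {a..b} h"
proof -
  have "set_integrable lebesgue {a..b} h"
    unfolding set_integrable_def using assms by (intro integrable_mult_indicator) auto
  from set_lebesgue_integral_eq_integral[OF this]
  show "h integrable_on {a..b}" "(LINT u:{a..b}|lebesgue. h u) = integral {a..b} h" by auto
qed

lemma time_increment_convergence: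
  fixes G :: "real \<Rightarrow> 'a::metric_space \<Rightarrow> real" and x :: "real \<Rightarrow> 'a"
  assumes tT: "t \<le> T" and x: "continuous_on UNIV x"
    and Gc: "\<And>u. continuous_on UNIV (G u)" and Gm: "\<And>y. (\<lambda>u. G u y) \<in> borel_measurable lebesgue"
    and S: "integrable lebesgue S" "\<And>u r. \<bar>G u (x r)\<bar> \<le> S u"
    and ftc: "\<And>y a b. \<lbrakk>t \<le> a; a \<le> b; b \<le> T\<rbrakk> \<Longrightarrow> f b y - f a y = integral {a..b} (\<lambda>u. G u y)"
    and fc: "continuous_on ({t..T} \<times> UNIV) (\<lambda>(s, y). f s y)"
    and e: "\<And>n. \<epsilon> n > 0" "\<epsilon> \<longlonglongrightarrow> 0" and s: "s \<in> {t..T}"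
  shows "integrable lebesgue (\<lambda>u. G u (x u))"
    and "(\<lambda>n. integral {t..s} (\<lambda>r. f (clamp t T (r + \<epsilon> n)) (x (r + \<epsilon> n)) - f r (x (r + \<epsilon> n))) / \<epsilon> n)
          \<longlonglongrightarrow> integral {t..s} (\<lambda>u. G u (x u))"
proof -
  define h where "h = (\<lambda>u. G u (x u))"
  have Gxm: "(\<lambda>u. G u (x (u + q))) \<in> borel_measurable lebesgue" for q
    by (rule caratheodory_measurable[OF Gc Gm]) (intro continuous_on_compose2[OF x] continuous_intros; simp)
  have hm: "h \<in> borel_measurable lebesgue" using Gxm[of 0] by (simp add: h_def)
  have hS: "\<bar>h u\<bar> \<le> S u" for u by (simp add: h_def S)
  show hi: "integrable lebesgue (\<lambda>u. G u (x u))"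
    using hm hS by (intro Bochner_Integration.integrable_bound[OF S(1)]) (auto simp: h_def intro!: AE_I2 order_trans[OF _ abs_ge_self])
  then have hi: "integrable lebesgue h" by (simp add: h_def)
  have Gyi: "integrable lebesgue (\<lambda>u. G u (x r))" for r
    using Gm S by (intro Bochner_Integration.integrable_bound[OF S(1)]) (auto intro!: AE_I2 order_trans[OF _ abs_ge_self])
  have "\<exists>C. countable C \<and> C \<subseteq> {0..\<epsilon> n} \<and> {0..\<epsilon> n} \<subseteq> closure C" for n
    using separable[of "{0..\<epsilon> n}"] by metis
  then obtain C where C: "\<And>n. countable (C n)" "\<And>n. C n \<subseteq> {0..\<epsilon> n}" "\<And>n. {0..\<epsilon> n} \<subseteq> closure (C n)"
    by metis
  have Cne: "C n \<noteq> {}" for n using C(3)[of n] e(1)[of n] by (auto simp: less_imp_le)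
  \<comment> \<open>\<open>W n u\<close> is the modulus of \<open>q \<mapsto> G u (x (u + q))\<close> at \<open>0\<close>; the countable set \<open>C n\<close> keeps it measurable.\<close>
  define W where "W = (\<lambda>n u. SUP q\<in>C n. \<bar>G u (x (u + q)) - h u\<bar>)"
  have d2: "\<bar>G u (x (u + q)) - h u\<bar> \<le> 2 * S u" for u q
    using S(2)[of u "u + q"] hS[of u] by linarith
  have bdd: "bdd_above ((\<lambda>q. \<bar>G u (x (u + q)) - h u\<bar>) ` C n)" for u n
    using d2 by (intro bdd_aboveI2) auto
  have Wm: "W n \<in> borel_measurable lebesgue" for n
    unfolding W_def using Gxm hm bdd C(1) by (intro borel_measurable_cSUP) auto
  have W2: "W n u \<le> 2 * S u" for n u
    unfolding W_def by (rule cSUP_least[OF Cne d2])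
  have W0: "0 \<le> W n u" for n u
  proof -
    obtain q where "q \<in> C n" using Cne by blast
    then show ?thesis unfolding W_def by (rule cSUP_upper2[OF bdd]) simp
  qed
  have contq: "continuous_on UNIV (\<lambda>q. \<bar>G u (x (u + q)) - h u\<bar>)" for u
    by (intro continuous_intros continuous_on_compose2[OF Gc] continuous_on_compose2[OF x]) auto
  \<comment> \<open>Density of \<open>C n\<close> and continuity in \<open>q\<close> extend the
    bound from the countable set to every lag.\<close>
  have Wdom: "\<bar>G u (x (u + q)) - h u\<bar> \<le> W n u" if "q \<in> {0..\<epsilon> n}" for q n u
  proof (rule continuous_le_on_closure[where S = "C n" and f = "\<lambda>q. \<bar>G u (x (u + q)) - h u\<bar>"])
    show "continuous_on (closure (C n)) (\<lambda>q. \<bar>G u (x (u + q)) - h u\<bar>)" using contq by (rule continuous_on_subset) simp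
    show "q \<in> closure (C n)" using that C by blast
    show "\<bar>G u (x (u + q)) - h u\<bar> \<le> W n u" if "q \<in> C n" for q
      unfolding W_def using that bdd by (intro cSUP_upper) auto
  qed
  have Wlim: "(\<lambda>n. W n u) \<longlonglongrightarrow> 0" for u
  proof (rule tendstoI)
    fix e0 :: real assume e0: "e0 > 0"
    have "isCont (\<lambda>q. \<bar>G u (x (u + q)) - h u\<bar>) 0"
      using contq by (simp add: continuous_on_eq_continuous_at)
    then have "\<exists>d>0. \<forall>q. dist q 0 < d \<longrightarrow> dist \<bar>G u (x (u + q)) - h u\<bar> \<bar>G u (x (u + 0)) - h u\<bar> < e0 / 2"
      unfolding continuous_at_eps_delta using half_gt_zero[OF e0] by blast
    then obtain d where d: "d > 0" "\<And>q. \<bar>q\<bar> < d \<Longrightarrow> \<bar>G u (x (u + q)) - h u\<bar> < e0 / 2"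
      by (auto simp: h_def dist_real_def)
    have "\<forall>\<^sub>F n in sequentially. \<epsilon> n < d" using e d by (auto intro: order_tendstoD)
    then show "\<forall>\<^sub>F n in sequentially. dist (W n u) 0 < e0"
    proof eventually_elim
      case (elim n)
      have "W n u \<le> e0 / 2" unfolding W_def
      proof (rule cSUP_least[OF Cne])
        fix q assume "q \<in> C n"
        then have "\<bar>q\<bar> < d" using C(2)[of n] elim by auto
        then show "\<bar>G u (x (u + q)) - h u\<bar> \<le> e0 / 2" using d(2) by (simp add: less_imp_le)
      qed
      then show ?case using W0[of n u] e0 by (simp add: dist_real_def)
    qed
  qed
  have Wi: "integrable lebesgue (W n)" for n
    using Wm W0 W2 by (intro Bochner_Integration.integrable_bound[OF integrable_mult_right[OF S(1), of 2]])
      (auto intro!: AE_I2 order_trans[OF _ abs_ge_self])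
  \<comment> \<open>With clamped upper limits \<open>H\<close> and \<open>V n\<close> are constant
    outside \<open>{t..T}\<close>, in step with the paths, and continuous on the whole line, as
    \<open>integral_increment_shift\<close> requires.\<close>
  define H where "H = (\<lambda>r. integral {t..clamp t T r} h)"
  define V where "V = (\<lambda>n r. integral {t..clamp t T r} (W n))"
  have cl: "clamp t T r = max t (min T r)" for r using tT by (rule clamp_real)
  have clc: "continuous_on UNIV (clamp t T :: real \<Rightarrow> real)" unfolding cl[abs_def] by (intro continuous_intros)
  have indef: "continuous_on UNIV (\<lambda>r. integral {t..clamp t T r} k)" if "integrable lebesgue k" for k :: "real \<Rightarrow> real"
  proof (rule continuous_on_compose2[OF indefinite_integral_continuous_1[of k t T] clc])
    show "k integrable_on {t..T}" using that by (rule integrable_lebesgue_interval)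
  qed (use tT in \<open>auto simp: cl\<close>)
  have Hc: "continuous_on UNIV H" and Vc: "continuous_on UNIV (V n)" for n
    unfolding H_def V_def by (auto intro!: indef hi Wi)
  have VT: "(\<lambda>n. V n T) \<longlonglongrightarrow> 0"
  proof -
    have "(\<lambda>n. LINT u|lebesgue. indicator {t..T} u *\<^sub>R W n u) \<longlonglongrightarrow> (LINT (u::real)|lebesgue. (0::real))"
    proof (rule integral_dominated_convergence[where w = "\<lambda>u. 2 * S u"])
      show "AE u in lebesgue. (\<lambda>n. indicator {t..T} u *\<^sub>R W n u) \<longlonglongrightarrow> 0"
        using tendsto_mult[OF tendsto_const Wlim] by (intro AE_I2) simp
      show "AE u in lebesgue. norm (indicator {t..T} u *\<^sub>R W n u) \<le> 2 * S u" for n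
        using W0 W2 order_trans[OF W0 W2] by (auto simp: indicator_def)
      show "(\<lambda>u. indicator {t..T} u *\<^sub>R W n u) \<in> borel_measurable lebesgue" for n
        using Wm[of n] by (intro borel_measurable_scaleR borel_measurable_indicator) auto
    qed (use S in auto)
    moreover have "(LINT u|lebesgue. indicator {t..T} u *\<^sub>R W n u) = V n T" for n
      using integrable_lebesgue_interval(2)[OF Wi, of t T n] tT by (simp add: V_def cl set_lebesgue_integral_def)
    ultimately show ?thesis by simp
  qed
  have Vr: "0 \<le> V n r" "V n r \<le> V n T" for n r
    unfolding V_def using W0 tT
    by (auto simp: cl intro!: integral_nonneg integral_subset_le integrable_lebesgue_interval Wi)
  define R where "R = (\<lambda>n r. f (clamp t T (r + \<epsilon> n)) (x (r + \<epsilon> n)) - f r (x (r + \<epsilon> n)))"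
  \<comment> \<open>For \<open>u\<close> between \<open>r\<close> and the clamped end
    \<open>?b\<close>, the lag \<open>r + \<epsilon> n - u\<close> lies in
    \<open>{0..\<epsilon> n}\<close>, where \<open>W n u\<close> dominates.\<close>
  have key: "\<bar>R n r - (H (r + \<epsilon> n) - H r)\<bar> \<le> V n (r + \<epsilon> n) - V n r" if r: "r \<in> {t..s}" for n r
  proof -
    let ?b = "clamp t T (r + \<epsilon> n)"
    have b: "t \<le> r" "r \<le> ?b" "?b \<le> T" "?b \<le> r + \<epsilon> n" "clamp t T r = r"
      using r s e(1)[of n] by (auto simp: cl)
    have comb: "integral {t..?b} k - integral {t..r} k = integral {r..?b} k" if "integrable lebesgue k" for k :: "real \<Rightarrow> real"
      using Henstock_Kurzweil_Integration.integral_combine[of t r ?b k] b integrable_lebesgue_interval(1)[OF that] by simp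
    have "R n r - (H (r + \<epsilon> n) - H r) = integral {r..?b} (\<lambda>u. G u (x (r + \<epsilon> n))) - integral {r..?b} h"
      unfolding R_def H_def b(5) comb[OF hi] using ftc[OF b(1-3)] by simp
    also have "\<dots> = integral {r..?b} (\<lambda>u. G u (x (r + \<epsilon> n)) - h u)"
      by (intro integral_diff[symmetric] integrable_lebesgue_interval Gyi hi)
    finally have 1: "R n r - (H (r + \<epsilon> n) - H r) = integral {r..?b} (\<lambda>u. G u (x (r + \<epsilon> n)) - h u)" .
    have "norm (integral {r..?b} (\<lambda>u. G u (x (r + \<epsilon> n)) - h u)) \<le> integral {r..?b} (W n)"
    proof (rule integral_norm_bound_integral)
      fix u assume "u \<in> {r..?b}"
      then show "norm (G u (x (r + \<epsilon> n)) - h u) \<le> W n u"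
        using Wdom[of "r + \<epsilon> n - u" n u] b by auto
    qed (intro integrable_diff integrable_lebesgue_interval Gyi hi Wi)+
    then show ?thesis unfolding 1 V_def b(5) comb[OF Wi] by simp
  qed
  have Rc: "continuous_on {t..s} (R n)" for n
  proof -
    have 1: "continuous_on {t..s} (\<lambda>r. (clamp t T (r + \<epsilon> n), x (r + \<epsilon> n)))"
      "continuous_on {t..s} (\<lambda>r. (r, x (r + \<epsilon> n)))"
      by (intro continuous_intros continuous_on_compose2[OF x] continuous_on_compose2[OF clc]; simp)+
    have "continuous_on {t..s} (\<lambda>r. f (clamp t T (r + \<epsilon> n)) (x (r + \<epsilon> n)))" "continuous_on {t..s} (\<lambda>r. f r (x (r + \<epsilon> n)))"
      using continuous_on_compose2[OF fc 1(1)] continuous_on_compose2[OF fc 1(2)] s tT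
      by (auto simp: cl image_subset_iff)
    then show ?thesis unfolding R_def by (intro continuous_intros)
  qed
  have sc: "(\<lambda>r. \<phi> (r + c) - \<phi> r) integrable_on {t..s}" if "continuous_on UNIV \<phi>" for \<phi> :: "real \<Rightarrow> real" and c
    by (intro integrable_continuous_interval continuous_intros continuous_on_compose2[OF that]) auto
  \<comment> \<open>The shift identity reduces the averaged error to two end pieces of
    \<open>V n\<close>: the one at \<open>t\<close> enters with a favourable sign, the one at
    \<open>s\<close> is at most \<open>\<epsilon> n * V n T\<close>.\<close>
  have est: "\<bar>integral {t..s} (R n) / \<epsilon> n - integral {t..s} (\<lambda>r. H (r + \<epsilon> n) - H r) / \<epsilon> n\<bar> \<le> V n T" for n
  proof -
    have Ri: "R n integrable_on {t..s}" using Rc by (rule integrable_continuous_interval)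
    have Vi: "V n integrable_on {a..b}" for a b by (intro integrable_continuous_interval continuous_on_subset[OF Vc]) auto
    have "integral {t..s} (R n) - integral {t..s} (\<lambda>r. H (r + \<epsilon> n) - H r) = integral {t..s} (\<lambda>r. R n r - (H (r + \<epsilon> n) - H r))"
      by (rule integral_diff[symmetric, OF Ri sc[OF Hc]])
    moreover have "norm (integral {t..s} (\<lambda>r. R n r - (H (r + \<epsilon> n) - H r))) \<le> integral {t..s} (\<lambda>r. V n (r + \<epsilon> n) - V n r)"
      by (rule integral_norm_bound_integral) (use key in \<open>auto intro!: integrable_diff[OF Ri sc[OF Hc]] sc[OF Vc]\<close>)
    moreover have "integral {t..s} (\<lambda>r. V n (r + \<epsilon> n) - V n r) = integral {s..s+\<epsilon> n} (V n) - integral {t..t+\<epsilon> n} (V n)"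
      using s e(1)[of n] by (intro integral_increment_shift Vc) auto
    moreover have "integral {s..s+\<epsilon> n} (V n) \<le> integral {s..s+\<epsilon> n} (\<lambda>_. V n T)"
      using Vr Vi by (intro integral_le) auto
    moreover have "0 \<le> integral {t..t+\<epsilon> n} (V n)" using Vr Vi by (intro integral_nonneg) auto
    ultimately have "\<bar>integral {t..s} (R n) - integral {t..s} (\<lambda>r. H (r + \<epsilon> n) - H r)\<bar> \<le> \<epsilon> n * V n T"
      using e(1)[of n] by simp
    then have "\<bar>integral {t..s} (R n) - integral {t..s} (\<lambda>r. H (r + \<epsilon> n) - H r)\<bar> / \<epsilon> n \<le> V n T"
      using e(1)[of n] by (simp add: divide_le_eq mult.commute)
    then show ?thesis using e(1)[of n] by (simp add: diff_divide_distrib[symmetric] abs_divide)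
  qed
  have "(\<lambda>n. integral {t..s} (R n) / \<epsilon> n - integral {t..s} (\<lambda>r. H (r + \<epsilon> n) - H r) / \<epsilon> n) \<longlonglongrightarrow> 0"
    by (rule Lim_null_comparison[OF _ VT]) (use est in auto)
  moreover have "(\<lambda>n. integral {t..s} (\<lambda>r. H (r + \<epsilon> n) - H r) / \<epsilon> n) \<longlonglongrightarrow> H s - H t"
    using s by (intro integral_increment_quotient_tendsto Hc e) auto
  ultimately have "(\<lambda>n. integral {t..s} (R n) / \<epsilon> n) \<longlonglongrightarrow> H s - H t"
    using tendsto_add by fastforce
  moreover have "H s - H t = integral {t..s} h" using s tT by (simp add: H_def cl)
  ultimately show "(\<lambda>n. integral {t..s} (\<lambda>r. f (clamp t T (r + \<epsilon> n)) (x (r + \<epsilon> n)) - f r (x (r + \<epsilon> n))) / \<epsilon> n)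
          \<longlonglongrightarrow> integral {t..s} (\<lambda>u. G u (x u))"
    by (simp add: R_def h_def)
qed

section \<open>Convergence in probability\<close>

context prob_space begin

text \<open>A diagonal choice for countably many limits at once: step \<open>n\<close> controls the
  indices up to \<open>n\<close>, so each \<open>k\<close> is covered from step \<open>k\<close> on,
  and Borel--Cantelli applies to the summable exceptional probabilities.\<close>

lemma tendsto_in_prob_AE_subseq:
  fixes Z :: "nat \<Rightarrow> 'e \<Rightarrow> 'a \<Rightarrow> real"
  assumes Z: "\<And>k. tendsto_in_prob M (Z k) (L k) F" and e: "filterlim e F sequentially"
  obtains r :: "nat \<Rightarrow> nat" where "strict_mono r" "AE \<omega> in M. \<forall>k. (\<lambda>n. Z k (e (r n)) \<omega>) \<longlonglongrightarrow> L k \<omega>"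
proof -
  define B where "B = (\<lambda>n k m. {\<omega>\<in>space M. 1 / real (Suc n) < \<bar>Z k (e m) \<omega> - L k \<omega>\<bar>})"
  \<comment> \<open>The factor \<open>1 / real (Suc n)\<close> pays for the \<open>n + 1\<close>
    indices in \<open>{..n}\<close>, so their union has probability at most \<open>(1/2)^n\<close>.
    Measurability is part of the choice because it is granted only eventually along the
    filter.\<close>
  define Q where "Q = (\<lambda>n m. \<forall>k\<in>{..n}. Z k (e m) \<in> borel_measurable M \<and> prob (B n k m) < (1/2)^n / real (Suc n))"
  have evQ: "eventually (Q n) sequentially" for n
    unfolding Q_def
  proof (intro eventually_ball_finite ballI eventually_conj)
    fix k
    show "\<forall>\<^sub>F m in sequentially. Z k (e m) \<in> borel_measurable M"
      using Z[of k] e unfolding tendsto_in_prob_def by (auto intro: eventually_compose_filterlim)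
    have "((\<lambda>a. prob {\<omega>\<in>space M. 1 / real (Suc n) < \<bar>Z k a \<omega> - L k \<omega>\<bar>}) \<longlongrightarrow> 0) F"
      using Z[of k] unfolding tendsto_in_prob_def by auto
    then have "(\<lambda>m. prob (B n k m)) \<longlonglongrightarrow> 0" unfolding B_def
      using e by (rule filterlim_compose)
    then show "\<forall>\<^sub>F m in sequentially. prob (B n k m) < (1/2)^n / real (Suc n)"
      by (rule order_tendstoD) auto
  qed simp
  have "\<exists>r. \<forall>n. Q n (r n) \<and> r n < r (Suc n)"
  proof (rule dependent_nat_choice)
    show "\<exists>m. Q 0 m" using evQ[of 0] by (auto simp: eventually_sequentially)
    show "\<exists>y. Q (Suc n) y \<and> m < y" for m n
      using eventually_conj[OF evQ[of "Suc n"] eventually_gt_at_top[of m]] by (auto simp: eventually_sequentially)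
  qed
  then obtain r where r: "\<And>n. Q n (r n)" "\<And>n. r n < r (Suc n)" by blast
  have sm: "strict_mono r" using r(2) by (simp add: strict_mono_Suc_iff)
  have Lm: "L k \<in> borel_measurable M" for k using Z[of k] by (simp add: tendsto_in_prob_def)
  define A where "A = (\<lambda>n. \<Union>k\<in>{..n}. B n k (r n))"
  have Bs: "B n k (r n) \<in> sets M" if "k \<le> n" for n k
  proof -
    have [measurable]: "Z k (e (r n)) \<in> borel_measurable M" "L k \<in> borel_measurable M"
      using r(1)[of n] that Lm by (auto simp: Q_def)
    show ?thesis unfolding B_def by measurable
  qed
  have As: "A n \<in> sets M" for n unfolding A_def using Bs by auto
  have Ap: "prob (A n) \<le> (1/2)^n" for n
  proof -
    have "prob (A n) \<le> (\<Sum>k\<in>{..n}. prob (B n k (r n)))"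
      unfolding A_def using Bs by (intro finite_measure_subadditive_finite) auto
    also have "\<dots> \<le> (\<Sum>k\<in>{..n}. (1/2)^n / real (Suc n))"
      using r(1)[of n] by (intro sum_mono) (auto simp: Q_def less_imp_le)
    also have "\<dots> = (1/2)^n" by simp
    finally show ?thesis .
  qed
  have "AE \<omega> in M. \<forall>\<^sub>F n in sequentially. \<omega> \<in> space M - A n"
  proof (rule borel_cantelli_AE1)
    show "summable (\<lambda>n. prob (A n))"
      by (rule summable_comparison_test[of _ "\<lambda>n. (1/2)^n"]) (use Ap in \<open>auto simp: summable_geometric\<close>)
  qed (use As in \<open>auto simp: less_top[symmetric]\<close>)
  then have "AE \<omega> in M. \<forall>k. (\<lambda>n. Z k (e (r n)) \<omega>) \<longlonglongrightarrow> L k \<omega>"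
  proof eventually_elim
    case (elim \<omega>)
    show ?case
    proof
      fix k
      have "(\<lambda>n. Z k (e (r n)) \<omega> - L k \<omega>) \<longlonglongrightarrow> 0"
      proof (rule Lim_null_comparison)
        show "\<forall>\<^sub>F n in sequentially. norm (Z k (e (r n)) \<omega> - L k \<omega>) \<le> 1 / real (Suc n)"
          using elim eventually_ge_at_top[of k]
          by eventually_elim (auto simp: A_def B_def not_less)
        show "(\<lambda>n. 1 / real (Suc n)) \<longlonglongrightarrow> 0" by (rule LIMSEQ_Suc[OF lim_const_over_n])
      qed
      then show "(\<lambda>n. Z k (e (r n)) \<omega>) \<longlonglongrightarrow> L k \<omega>" by (rule LIM_zero_cancel)
    qed
  qed
  with sm show ?thesis by (rule that)
qed

lemma AE_tendsto_imp_measure_tendsto: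
  fixes Z :: "nat \<Rightarrow> 'a \<Rightarrow> real"
  assumes [measurable]: "\<And>n. Z n \<in> borel_measurable M" "L \<in> borel_measurable M"
    and ae: "AE \<omega> in M. (\<lambda>n. Z n \<omega>) \<longlonglongrightarrow> L \<omega>" and d: "\<delta> > 0"
  shows "(\<lambda>n. prob {\<omega>\<in>space M. \<delta> < \<bar>Z n \<omega> - L \<omega>\<bar>}) \<longlonglongrightarrow> 0"
proof -
  have "(\<lambda>n. LINT \<omega>|M. indicator {\<omega>\<in>space M. \<delta> < \<bar>Z n \<omega> - L \<omega>\<bar>} \<omega>) \<longlonglongrightarrow> (LINT \<omega>|M. (0::real))"
  proof (rule integral_dominated_convergence[where w = "\<lambda>_. 1"])
    show "AE \<omega> in M. (\<lambda>n. indicator {\<omega>\<in>space M. \<delta> < \<bar>Z n \<omega> - L \<omega>\<bar>} \<omega> :: real) \<longlonglongrightarrow> 0"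
      using ae
    proof eventually_elim
      case (elim \<omega>)
      then have "\<forall>\<^sub>F n in sequentially. dist (Z n \<omega>) (L \<omega>) < \<delta>" using d by (rule tendstoD)
      then have "\<forall>\<^sub>F n in sequentially. (indicator {\<omega>\<in>space M. \<delta> < \<bar>Z n \<omega> - L \<omega>\<bar>} \<omega> :: real) = 0"
        by eventually_elim (auto simp: indicator_def dist_real_def)
      then show ?case by (rule tendsto_eventually)
    qed
  qed (auto simp: indicator_def)
  then show ?thesis by (simp add: measure_def[symmetric])
qed

text \<open>If convergence failed along some sequence, a subsequence would keep the probabilities at
  or above some \<open>c > 0\<close>, which a further, almost surely convergent subsequence
  contradicts. The null set may vary with the sequence.\<close>

lemma tendsto_in_prob_at_right_subseqI:
  fixes Z :: "real \<Rightarrow> 'a \<Rightarrow> real"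
  assumes Zm: "\<And>e. e > 0 \<Longrightarrow> Z e \<in> borel_measurable M" and Lm: "L \<in> borel_measurable M"
    and sub: "\<And>e::nat \<Rightarrow> real. (\<And>n. e n > 0) \<Longrightarrow> e \<longlonglongrightarrow> 0 \<Longrightarrow>
       \<exists>r. strict_mono (r :: nat \<Rightarrow> nat) \<and> (AE \<omega> in M. (\<lambda>n. Z (e (r n)) \<omega>) \<longlonglongrightarrow> L \<omega>)"
  shows "tendsto_in_prob M Z L (at_right 0)"
  unfolding tendsto_in_prob_def
proof (intro conjI allI impI)
  show "\<forall>\<^sub>F e in at_right 0. Z e \<in> borel_measurable M"
    using Zm by (auto simp: eventually_at_filter)
  fix \<delta> :: real assume d: "\<delta> > 0"
  let ?p = "\<lambda>e. prob {\<omega>\<in>space M. \<delta> < \<bar>Z e \<omega> - L \<omega>\<bar>}"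
  show "(?p \<longlongrightarrow> 0) (at_right 0)"
  proof (rule tendsto_at_right_sequentially[of _ 1])
    fix S :: "nat \<Rightarrow> real" assume S: "\<And>n. 0 < S n" "S \<longlonglongrightarrow> 0"
    show "(\<lambda>n. ?p (S n)) \<longlonglongrightarrow> 0"
    proof (rule ccontr)
      assume "\<not> (\<lambda>n. ?p (S n)) \<longlonglongrightarrow> 0"
      then obtain c where c: "c > 0" "\<And>N. \<exists>n\<ge>N. \<not> dist (?p (S n)) 0 < c"
        unfolding lim_sequentially by blast
      then have "infinite {n. \<not> dist (?p (S n)) 0 < c}"
        unfolding infinite_nat_iff_unbounded_le by blast
      from infinite_enumerate[OF this] obtain r0 :: "nat \<Rightarrow> nat"
        where r0: "strict_mono r0" "\<And>n. \<not> dist (?p (S (r0 n))) 0 < c" by blast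
      have "(\<lambda>n. S (r0 n)) \<longlonglongrightarrow> 0" using LIMSEQ_subseq_LIMSEQ[OF S(2) r0(1)] by (simp add: o_def)
      from sub[of "\<lambda>n. S (r0 n)", OF S(1) this] obtain r :: "nat \<Rightarrow> nat"
        where r: "AE \<omega> in M. (\<lambda>n. Z (S (r0 (r n))) \<omega>) \<longlonglongrightarrow> L \<omega>" by blast
      have "(\<lambda>n. ?p (S (r0 (r n)))) \<longlonglongrightarrow> 0"
        by (rule AE_tendsto_imp_measure_tendsto[OF _ Lm r d]) (rule Zm[OF S(1)])
      from tendstoD[OF this c(1)] show False
        using r0(2) by (auto simp: eventually_sequentially)
    qed
  qed simp
qed (rule Lm)

lemma tendsto_in_prob_at_right_unique:
  fixes Z :: "real \<Rightarrow> 'a \<Rightarrow> real"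
  assumes "tendsto_in_prob M Z L (at_right 0)" "tendsto_in_prob M Z L' (at_right 0)"
  shows "AE \<omega> in M. L \<omega> = L' \<omega>"
proof -
  have e: "filterlim (\<lambda>n. 1 / real (Suc n)) (at_right 0) sequentially"
    using LIMSEQ_Suc[OF lim_const_over_n[of "1::real"]] by (auto simp: filterlim_at)
  \<comment> \<open>Both limits are placed in one family with the same \<open>Z\<close>, so a single
    subsequence converges almost surely to both.\<close>
  obtain r where r: "AE \<omega> in M. \<forall>k. (\<lambda>n. Z (1 / real (Suc (r n))) \<omega>) \<longlonglongrightarrow> (if k = (0::nat) then L else L') \<omega>"
    by (rule tendsto_in_prob_AE_subseq[where Z = "\<lambda>_. Z" and L = "\<lambda>k. if k = 0 then L else L'", OF _ e])
      (use assms in \<open>auto split: if_splits\<close>)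
  then show ?thesis
  proof eventually_elim
    case (elim \<omega>)
    from elim[rule_format, of 0] elim[rule_format, of 1] show ?case
      by (auto intro: LIMSEQ_unique)
  qed
qed

end

section \<open>The pathwise formula\<close>

lemma absolutely_continuous_on_subset:
  "absolutely_continuous_on I \<phi> \<Longrightarrow> J \<subseteq> I \<Longrightarrow> absolutely_continuous_on J \<phi>"
  unfolding absolutely_continuous_on_def by (meson subset_trans)

text \<open>The time derivative is set to \<open>0\<close> at the negligible bad times and outside
  \<open>{t..T}\<close>. Continuity in space and domination on compact sets then hold at every
  \<open>u\<close>, as \<open>time_increment_convergence\<close> demands, and integrals over
  \<open>{t..T}\<close> do not notice the change.\<close>

lemma C02_time_derivative_version:
  fixes f :: "real \<Rightarrow> real ^ 'n::finite \<Rightarrow> real"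
  assumes f: "f \<in> C02_ac_base {t..T}" and tT: "t \<le> T"
  obtains G N where "negligible N" "\<And>u y. u \<in> {t..T} - N \<Longrightarrow> G u y = time_deriv {t..T} f u y"
    "\<And>u. continuous_on UNIV (G u)" "\<And>y. (\<lambda>u. G u y) \<in> borel_measurable lebesgue"
    "\<And>y a b. \<lbrakk>t \<le> a; a \<le> b; b \<le> T\<rbrakk> \<Longrightarrow> f b y - f a y = integral {a..b} (\<lambda>u. G u y)"
    "\<And>K. compact K \<Longrightarrow> \<exists>S. integrable lebesgue S \<and> (\<forall>u. \<forall>y\<in>K. \<bar>G u y\<bar> \<le> S u)"
proof -
  let ?I = "{t..T}"
  define ok where "ok = (\<lambda>s. (\<forall>x. (\<lambda>r. f r x) differentiable (at s within ?I)) \<and> continuous_on UNIV (time_deriv ?I f s))"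
  define N where "N = {s \<in> ?I. \<not> ok s}"
  define G where "G = (\<lambda>u y. if u \<in> ?I - N then time_deriv ?I f u y else 0)"
  have ac: "absolutely_continuous_on ?I (\<lambda>s. f s y)" for y using f by (simp add: C02_ac_base_def)
  have "AE s in lebesgue. s \<in> ?I \<longrightarrow> ok s" using f unfolding C02_ac_base_def mem_Collect_eq ok_def by (elim conjE)
  then obtain N' where N': "N' \<in> null_sets lebesgue" "{s \<in> space lebesgue. \<not> (s \<in> ?I \<longrightarrow> ok s)} \<subseteq> N'"
    by (auto simp: eventually_ae_filter)
  have "negligible N'" using N'(1) by (simp add: negligible_iff_null_sets)
  moreover have "N \<subseteq> N'" using N'(2) unfolding N_def by simp
  ultimately have N: "negligible N" by (rule negligible_subset)
  have hi: "((\<lambda>u. G u y) has_integral (f b y - f a y)) {a..b}" if ab: "t \<le> a" "a \<le> b" "b \<le> T" for a b y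
  proof (rule absolutely_continuous_has_integral[OF absolutely_continuous_on_subset[OF ac] ab(2) N])
    fix u assume u: "u \<in> {a..b} - N"
    then have "u \<in> ?I" using ab by auto
    then have "(\<lambda>r. f r y) differentiable (at u within ?I)" using u by (auto simp: N_def ok_def)
    then have "((\<lambda>r. f r y) has_vector_derivative time_deriv ?I f u y) (at u within ?I)"
      unfolding time_deriv_def by (rule vector_derivative_works[THEN iffD1])
    then have "((\<lambda>r. f r y) has_vector_derivative time_deriv ?I f u y) (at u within {a..b})"
      by (rule has_vector_derivative_within_subset) (use ab in auto)
    then show "((\<lambda>r. f r y) has_vector_derivative G u y) (at u within {a..b})"
      using \<open>u \<in> ?I\<close> u by (simp add: G_def)
  qed (use ab in auto)
  show ?thesis
  proof (rule that[OF N])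
    show "G u y = time_deriv ?I f u y" if "u \<in> ?I - N" for u y using that by (simp add: G_def)
    show "continuous_on UNIV (G u)" for u
    proof (cases "u \<in> ?I - N")
      case True
      then have "G u = time_deriv ?I f u" "ok u" by (auto simp: G_def N_def)
      then show ?thesis by (simp add: ok_def)
    next
      case False
      then have "G u = (\<lambda>_. 0)" unfolding G_def by presburger
      then show ?thesis by simp
    qed
    show "f b y - f a y = integral {a..b} (\<lambda>u. G u y)" if "t \<le> a" "a \<le> b" "b \<le> T" for a b y
      using hi[OF that, of y] by (simp add: integral_unique)
    show "(\<lambda>u. G u y) \<in> borel_measurable lebesgue" for y
    proof -
      \<comment> \<open>Measurability in time is a by-product of the fundamental theorem: a
        Henstock--Kurzweil integrable function is Lebesgue measurable.\<close>
      have "(\<lambda>u. G u y) \<in> borel_measurable (lebesgue_on ?I)"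
        using hi[of t T y] tT by (intro integrable_imp_measurable) auto
      then have "(\<lambda>u. if u \<in> ?I then G u y else 0) \<in> borel_measurable lebesgue"
        by (rule borel_measurable_if_I) simp
      moreover have "(\<lambda>u. if u \<in> ?I then G u y else 0) = (\<lambda>u. G u y)" by (auto simp: G_def)
      ultimately show ?thesis by simp
    qed
    fix K :: "(real ^ 'n) set" assume K: "compact K"
    \<comment> \<open>The absolute value guards the bad times: there \<open>G\<close> is
      \<open>0\<close>, but the supremum may be over an unbounded set and have no useful
      sign.\<close>
    define S where "S = (\<lambda>u. \<bar>indicator ?I u *\<^sub>R (SUP y\<in>K. \<bar>time_deriv ?I f u y\<bar>)\<bar>)"
    have "set_integrable lebesgue ?I (\<lambda>s. SUP x\<in>K. \<bar>time_deriv ?I f s x\<bar>)"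
      using f K by (simp add: C02_ac_base_def)
    then have "integrable lebesgue S"
      unfolding S_def set_integrable_def by (rule integrable_abs)
    moreover have "\<bar>G u y\<bar> \<le> S u" if "y \<in> K" for u y
    proof (cases "u \<in> ?I - N")
      case True
      then have "continuous_on K (\<lambda>y. \<bar>time_deriv ?I f u y\<bar>)"
        by (auto simp: N_def ok_def intro!: continuous_intros intro: continuous_on_subset)
      then have "bdd_above ((\<lambda>y. \<bar>time_deriv ?I f u y\<bar>) ` K)"
        using K by (intro bounded_imp_bdd_above compact_imp_bounded compact_continuous_image)
      then have "\<bar>time_deriv ?I f u y\<bar> \<le> (SUP y\<in>K. \<bar>time_deriv ?I f u y\<bar>)"
        using that by (intro cSUP_upper)
      then show ?thesis using True by (simp add: S_def G_def)
    qed (auto simp: G_def S_def)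
    ultimately show "\<exists>S. integrable lebesgue S \<and> (\<forall>u. \<forall>y\<in>K. \<bar>G u y\<bar> \<le> S u)" by blast
  qed
qed

text \<open>Supplies the compact set on which the time derivative is dominated, and the bound on the
  path used in the Taylor estimate.\<close>

lemma clamped_path_range_compact:
  fixes x :: "real \<Rightarrow> 'a::metric_space"
  assumes tT: "t \<le> T" and x: "continuous_on UNIV x" and xc: "\<And>r. x (clamp t T r) = x r"
  shows "compact (range x)"
proof -
  have "range x = x ` {t..T}"
  proof (intro equalityI subsetI)
    fix y assume "y \<in> range x"
    then obtain r where "y = x (clamp t T r)" using xc by auto
    then show "y \<in> x ` {t..T}" using tT by (auto simp: clamp_real)
  qed auto
  then show ?thesis using compact_continuous_image[OF continuous_on_subset[OF x]] by simp
qed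

lemma C02_time_increment_convergence:
  fixes f :: "real \<Rightarrow> real ^ 'n::finite \<Rightarrow> real"
  assumes f: "f \<in> C02_ac_base {t..T}" and tT: "t \<le> T"
    and x: "continuous_on UNIV x" and xc: "\<And>r. x (clamp t T r) = x r"
  shows "set_integrable lebesgue {t..T} (\<lambda>r. time_deriv {t..T} f r (x r))"
    and "\<And>\<epsilon> s. \<lbrakk>\<And>n. \<epsilon> n > 0; \<epsilon> \<longlonglongrightarrow> 0; s \<in> {t..T}\<rbrakk> \<Longrightarrow>
      (\<lambda>n. integral {t..s} (\<lambda>r. f (clamp t T (r + \<epsilon> n)) (x (r + \<epsilon> n)) - f r (x (r + \<epsilon> n))) / \<epsilon> n)
          \<longlonglongrightarrow> (LINT r:{t..s}|lebesgue. time_deriv {t..T} f r (x r))"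
proof -
  obtain G N where N: "negligible N" and GN: "\<And>u y. u \<in> {t..T} - N \<Longrightarrow> G u y = time_deriv {t..T} f u y"
    and G: "\<And>u. continuous_on UNIV (G u)" "\<And>y. (\<lambda>u. G u y) \<in> borel_measurable lebesgue"
    and ftc: "\<And>y a b. \<lbrakk>t \<le> a; a \<le> b; b \<le> T\<rbrakk> \<Longrightarrow> f b y - f a y = integral {a..b} (\<lambda>u. G u y)"
    and K: "\<And>K. compact K \<Longrightarrow> \<exists>S. integrable lebesgue S \<and> (\<forall>u. \<forall>y\<in>K. \<bar>G u y\<bar> \<le> S u)"
    by (rule C02_time_derivative_version[OF f tT]) (rule that)
  obtain S where S: "integrable lebesgue S" "\<And>u r. \<bar>G u (x r)\<bar> \<le> S u"
    using K[OF clamped_path_range_compact[OF tT x xc]] by auto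
  have fc: "continuous_on ({t..T} \<times> UNIV) (\<lambda>(s, y). f s y)" using f by (simp add: C02_ac_base_def)
  have "integrable lebesgue (\<lambda>u. G u (x u))"
    by (rule time_increment_convergence(1)[OF tT x G S _ fc, of "\<lambda>n. 1 / real (Suc n)" t])
      (use ftc tT LIMSEQ_Suc[OF lim_const_over_n[of "1::real"]] in auto)
  then have "set_integrable lebesgue {t..T} (\<lambda>u. G u (x u))"
    unfolding set_integrable_def by (intro integrable_mult_indicator) auto
  then show si: "set_integrable lebesgue {t..T} (\<lambda>r. time_deriv {t..T} f r (x r))"
    by (rule absolutely_integrable_spike[OF _ N]) (simp add: GN)
  fix \<epsilon> :: "nat \<Rightarrow> real" and s assume e: "\<And>n. \<epsilon> n > 0" "\<epsilon> \<longlonglongrightarrow> 0" and s: "s \<in> {t..T}"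
  have "set_integrable lebesgue {t..s} (\<lambda>r. time_deriv {t..T} f r (x r))"
    using si by (rule set_integrable_subset) (use s in auto)
  then have "(LINT r:{t..s}|lebesgue. time_deriv {t..T} f r (x r)) = integral {t..s} (\<lambda>r. time_deriv {t..T} f r (x r))"
    by (rule set_lebesgue_integral_eq_integral)
  also have "\<dots> = integral {t..s} (\<lambda>u. G u (x u))"
    by (rule integral_spike[OF N]) (use s GN in auto)
  finally show "(\<lambda>n. integral {t..s} (\<lambda>r. f (clamp t T (r + \<epsilon> n)) (x (r + \<epsilon> n)) - f r (x (r + \<epsilon> n))) / \<epsilon> n)
          \<longlonglongrightarrow> (LINT r:{t..s}|lebesgue. time_deriv {t..T} f r (x r))"
    using time_increment_convergence(2)[OF tT x G S _ fc e s] ftc by simp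
qed

text \<open>Polarization: \<open>a b = (a + b)\<^sup>2 / 2 - (2 a)\<^sup>2 / 8 - (2 b)\<^sup>2 / 8\<close> writes a covariation
  in terms of nondecreasing ones.\<close>

definition polarized :: "('n \<Rightarrow> 'n \<Rightarrow> real \<Rightarrow> real) \<Rightarrow> 'n \<Rightarrow> 'n \<Rightarrow> real \<Rightarrow> real" where
  "polarized Q i j q = Q i i q + Q j j q + 2 * Q i j q"

section \<open>Covariations as integrators\<close>

lemma polarized_covariation_stieltjes:
  fixes Q :: "'n \<Rightarrow> 'n \<Rightarrow> real \<Rightarrow> real"
  assumes ab: "a \<le> b" and g: "continuous_on {a..b} g"
    and Q: "\<And>i j. continuous_on {a..b} (Q i j)" and m: "\<And>i j. mono_on {a..b} (polarized Q i j)"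
  shows "\<And>s. s \<in> {a..b} \<Longrightarrow> stieltjes_integrable g (Q i j) a s"
    and "\<And>s. s \<in> {a..b} \<Longrightarrow> (\<lambda>N. rsum g (Q i j) a s (Suc N)) \<longlonglongrightarrow> stieltjes_integral g (Q i j) a s"
    and "continuous_on {a..b} (stieltjes_integral g (Q i j) a)"
    and "stieltjes_integral g (Q i j) a b = stieltjes_integral g (polarized Q i j) a b / 2
      - stieltjes_integral g (polarized Q i i) a b / 8 - stieltjes_integral g (polarized Q j j) a b / 8"
proof -
  have c: "continuous_on {a..b} (polarized Q i j)" for i j
    unfolding polarized_def[abs_def] by (intro continuous_intros Q)
  note bv = stieltjes_integral_bounded_variation[OF ab g, where p = "\<lambda>q. polarized Q i j q / 2"
      and n = "\<lambda>q. polarized Q i i q / 8 + polarized Q j j q / 8" and A = "Q i j"]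
  have mm: "mono_on {a..b} (\<lambda>q. polarized Q i j q / 2)" "continuous_on {a..b} (\<lambda>q. polarized Q i j q / 2)"
     "mono_on {a..b} (\<lambda>q. polarized Q i i q / 8 + polarized Q j j q / 8)"
     "continuous_on {a..b} (\<lambda>q. polarized Q i i q / 8 + polarized Q j j q / 8)"
    using m[of i j] m[of i i] m[of j j] by (auto simp: mono_on_def intro!: continuous_intros c add_mono)
  have eq: "Q i j r = polarized Q i j r / 2 - (polarized Q i i r / 8 + polarized Q j j r / 8)" for r
    by (simp add: polarized_def field_simps)
  show "stieltjes_integrable g (Q i j) a s" if "s \<in> {a..b}" for s by (rule bv(1)[OF mm eq that])
  show l: "(\<lambda>N. rsum g (Q i j) a s (Suc N)) \<longlonglongrightarrow> stieltjes_integral g (Q i j) a s" if "s \<in> {a..b}" for s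
    by (rule bv(2)[OF mm eq that])
  show "continuous_on {a..b} (stieltjes_integral g (Q i j) a)" by (rule bv(3)[OF mm eq])
  have lm: "(\<lambda>N. rsum g (polarized Q i j) a b (Suc N)) \<longlonglongrightarrow> stieltjes_integral g (polarized Q i j) a b" for i j
    by (rule stieltjes_integral_bounded_variation(2)[OF ab g m c, of "\<lambda>_. 0"]) (use ab in \<open>auto simp: mono_on_def\<close>)
  \<comment> \<open>Riemann sums are linear in the integrator; in the limit this carries the
    polarization identity over to the integrals.\<close>
  have rs: "rsum g (Q i j) a b N = rsum g (polarized Q i j) a b N / 2 - rsum g (polarized Q i i) a b N / 8 - rsum g (polarized Q j j) a b N / 8" for N
    unfolding rsum_def sum_divide_distrib sum_subtractf[symmetric]
    by (intro sum.cong refl) (simp add: polarized_def field_simps)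
  have "(\<lambda>N. rsum g (Q i j) a b (Suc N)) \<longlonglongrightarrow> stieltjes_integral g (polarized Q i j) a b / 2
      - stieltjes_integral g (polarized Q i i) a b / 8 - stieltjes_integral g (polarized Q j j) a b / 8"
    unfolding rs by (intro tendsto_intros lm) auto
  then show "stieltjes_integral g (Q i j) a b = stieltjes_integral g (polarized Q i j) a b / 2
      - stieltjes_integral g (polarized Q i i) a b / 8 - stieltjes_integral g (polarized Q j j) a b / 8"
    using l[of b] ab LIMSEQ_unique by auto
qed

text \<open>The squares are nonnegative, so their integrals are nondecreasing in the upper limit.
  This upgrades convergence on \<open>D\<close> to convergence everywhere, and the limit inherits
  monotonicity.\<close>

lemma polarized_path_covariation:
  fixes Q :: "'n \<Rightarrow> 'n \<Rightarrow> real \<Rightarrow> real" and d :: "nat \<Rightarrow> real \<Rightarrow> 'n \<Rightarrow> real"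
  assumes tT: "t \<le> T" and Q: "\<And>i j. continuous_on {t..T} (Q i j)"
    and d: "\<And>n i. continuous_on {t..T} (\<lambda>r. d n r i)" and e: "\<And>n. \<epsilon> n > 0"
    and D: "D \<subseteq> {t..T}" "t \<in> D" "T \<in> D" and dense: "\<And>c c'. \<lbrakk>t \<le> c; c < c'; c' \<le> T\<rbrakk> \<Longrightarrow> \<exists>r\<in>D. c < r \<and> r < c'"
    and conv: "\<And>i j q. q \<in> D \<Longrightarrow> (\<lambda>n. 1 / \<epsilon> n * integral {t..q} (\<lambda>r. d n r i * d n r j)) \<longlonglongrightarrow> Q i j q"
  shows "\<And>q. q \<in> {t..T} \<Longrightarrow> (\<lambda>n. integral {t..q} (\<lambda>r. (d n r i + d n r j)\<^sup>2 / \<epsilon> n)) \<longlonglongrightarrow> polarized Q i j q"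
    and "mono_on {t..T} (polarized Q i j)"
proof -
  have int: "(\<lambda>r. d n r i * d n r j) integrable_on {t..q}" if "q \<in> {t..T}" for n i j q
    using that by (intro integrable_continuous_interval continuous_intros continuous_on_subset[OF d]) auto
  \<comment> \<open>The integrand \<open>0\<close> is a placeholder: what is extracted is the
    monotonicity contained in \<open>rs_functional\<close>.\<close>
  have F: "rs_functional (\<lambda>_. 0) (\<lambda>u. integral {t..u} (\<lambda>r. (d n r i + d n r j)\<^sup>2 / \<epsilon> n)) t T (\<lambda>u v. integral {u..v} (\<lambda>r. 0 * ((d n r i + d n r j)\<^sup>2 / \<epsilon> n)))" for n
    by (rule rs_functional_density) (use e[of n] in \<open>auto intro!: continuous_intros d simp: less_imp_le less_imp_neq[symmetric]\<close>)
  have cD: "(\<lambda>n. integral {t..q} (\<lambda>r. (d n r i + d n r j)\<^sup>2 / \<epsilon> n)) \<longlonglongrightarrow> polarized Q i j q" if q: "q \<in> D" for q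
  proof -
    have qq: "q \<in> {t..T}" using q D by auto
    have "integral {t..q} (\<lambda>r. (d n r i + d n r j)\<^sup>2 / \<epsilon> n) =
      1 / \<epsilon> n * integral {t..q} (\<lambda>r. d n r i * d n r i) + 1 / \<epsilon> n * integral {t..q} (\<lambda>r. d n r j * d n r j)
       + 2 * (1 / \<epsilon> n * integral {t..q} (\<lambda>r. d n r i * d n r j))" for n
    proof (rule integral_unique)
      have "((\<lambda>r. 1 / \<epsilon> n * (d n r i * d n r i) + 1 / \<epsilon> n * (d n r j * d n r j) + 2 * (1 / \<epsilon> n * (d n r i * d n r j))) has_integral
        1 / \<epsilon> n * integral {t..q} (\<lambda>r. d n r i * d n r i) + 1 / \<epsilon> n * integral {t..q} (\<lambda>r. d n r j * d n r j)
       + 2 * (1 / \<epsilon> n * integral {t..q} (\<lambda>r. d n r i * d n r j))) {t..q}"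
        by (intro has_integral_add has_integral_mult_right integrable_integral int qq)
      then show "((\<lambda>r. (d n r i + d n r j)\<^sup>2 / \<epsilon> n) has_integral
        1 / \<epsilon> n * integral {t..q} (\<lambda>r. d n r i * d n r i) + 1 / \<epsilon> n * integral {t..q} (\<lambda>r. d n r j * d n r j)
       + 2 * (1 / \<epsilon> n * integral {t..q} (\<lambda>r. d n r i * d n r j))) {t..q}"
        by (rule has_integral_eq[rotated]) (simp add: power2_eq_square add_divide_distrib algebra_simps)
    qed
    then show ?thesis unfolding polarized_def by (simp only:) (intro tendsto_intros conv q)
  qed
  show all: "(\<lambda>n. integral {t..q} (\<lambda>r. (d n r i + d n r j)\<^sup>2 / \<epsilon> n)) \<longlonglongrightarrow> polarized Q i j q" if "q \<in> {t..T}" for q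
    by (rule monotone_convergence_from_dense[OF rs_functionalD(1)[OF F] _ D dense cD that])
      (auto simp: polarized_def[abs_def] intro!: continuous_intros Q)
  show "mono_on {t..T} (polarized Q i j)"
  proof (rule mono_onI)
    fix p q assume pq: "p \<in> {t..T}" "q \<in> {t..T}" "p \<le> q"
    show "polarized Q i j p \<le> polarized Q i j q"
      by (rule LIMSEQ_le[OF all[OF pq(1)] all[OF pq(2)]]) (use mono_onD[OF rs_functionalD(1)[OF F] pq] in blast)
  qed
qed

text \<open>The products \<open>d n r i * d n r j\<close> have no sign, so weak convergence is
  applied to the three squares of the polarization identity, and the results are recombined on the
  regularized side and in the limit.\<close>

lemma weighted_covariation_convergence:
  fixes Q :: "'n \<Rightarrow> 'n \<Rightarrow> real \<Rightarrow> real" and d :: "nat \<Rightarrow> real \<Rightarrow> 'n \<Rightarrow> real"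
  assumes tT: "t \<le> T" and Q: "\<And>i j. continuous_on {t..T} (Q i j)"
    and d: "\<And>n i. continuous_on {t..T} (\<lambda>r. d n r i)" and e: "\<And>n. \<epsilon> n > 0"
    and D: "D \<subseteq> {t..T}" "t \<in> D" "T \<in> D" and dense: "\<And>c c'. \<lbrakk>t \<le> c; c < c'; c' \<le> T\<rbrakk> \<Longrightarrow> \<exists>r\<in>D. c < r \<and> r < c'"
    and conv: "\<And>i j q. q \<in> D \<Longrightarrow> (\<lambda>n. 1 / \<epsilon> n * integral {t..q} (\<lambda>r. d n r i * d n r j)) \<longlonglongrightarrow> Q i j q"
    and s: "s \<in> {t..T}" and g: "continuous_on {t..T} g"
  shows "(\<lambda>n. integral {t..s} (\<lambda>r. g r * (d n r i * d n r j / \<epsilon> n))) \<longlonglongrightarrow> stieltjes_integral g (Q i j) t s"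
proof -
  have pol1: "(\<lambda>n. integral {t..q} (\<lambda>r. (d n r i + d n r j)\<^sup>2 / \<epsilon> n)) \<longlonglongrightarrow> polarized Q i j q"
    if "q \<in> {t..T}" for q i j
    by (rule polarized_path_covariation(1)[OF tT Q d e D _ _ that]) (fact dense, fact conv)
  have pol2: "mono_on {t..T} (polarized Q i j)" for i j
    by (rule polarized_path_covariation(2)[OF tT Q d e D]) (fact dense, fact conv)
  have gs: "continuous_on {t..s} g" by (rule continuous_on_subset[OF g]) (use s in auto)
  have ts: "t \<le> s" using s by simp
  have Qs: "continuous_on {t..s} (Q i j)" for i j by (rule continuous_on_subset[OF Q]) (use s in auto)
  have ds: "continuous_on {t..s} (\<lambda>r. d n r i)" for n i by (rule continuous_on_subset[OF d]) (use s in auto)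
  have ms: "mono_on {t..s} (polarized Q i j)" for i j by (rule mono_on_subset[OF pol2]) (use s in auto)
  let ?\<rho> = "\<lambda>i j n r. (d n r i + d n r j)\<^sup>2 / \<epsilon> n"
  have \<rho>c: "continuous_on {t..s} (?\<rho> i j n)" for i j n
    using e[of n] by (auto intro!: continuous_intros ds)
  \<comment> \<open>At \<open>q = t\<close> the regularized integrals vanish. Hence the limit from
    \<open>pol1\<close> is already an increment from \<open>t\<close>, as the density lemma
    wants.\<close>
  have p0: "polarized Q i j t = 0" for i j
    using pol1[of t i j] tT LIMSEQ_unique[OF tendsto_const, of 0 "polarized Q i j t"] by simp
  have L: "(\<lambda>n. integral {t..s} (\<lambda>r. g r * ?\<rho> i j n r)) \<longlonglongrightarrow> stieltjes_integral g (polarized Q i j) t s" for i j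
  proof (rule stieltjes_integral_density_convergence[OF ts gs ms _ \<rho>c])
    show "continuous_on {t..s} (polarized Q i j)" unfolding polarized_def[abs_def] by (intro continuous_intros Qs)
    show "(\<lambda>n. integral {t..q} (?\<rho> i j n)) \<longlonglongrightarrow> polarized Q i j q - polarized Q i j t" if "q \<in> {t..s}" for q
      using pol1[of q i j] that s p0 by simp
  qed (use e in \<open>auto simp: less_imp_le\<close>)
  have eq: "integral {t..s} (\<lambda>r. g r * (d n r i * d n r j / \<epsilon> n)) = integral {t..s} (\<lambda>r. g r * ?\<rho> i j n r) / 2
     - integral {t..s} (\<lambda>r. g r * ?\<rho> i i n r) / 8 - integral {t..s} (\<lambda>r. g r * ?\<rho> j j n r) / 8" for n
  proof (rule integral_unique)
    have int: "((\<lambda>r. g r * ?\<rho> i j n r) has_integral integral {t..s} (\<lambda>r. g r * ?\<rho> i j n r)) {t..s}" for i j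
      by (intro integrable_integral integrable_continuous_interval continuous_intros gs ds) (use e[of n] in auto)
    have "((\<lambda>r. g r * ?\<rho> i j n r / 2 - g r * ?\<rho> i i n r / 8 - g r * ?\<rho> j j n r / 8) has_integral
        integral {t..s} (\<lambda>r. g r * ?\<rho> i j n r) / 2
     - integral {t..s} (\<lambda>r. g r * ?\<rho> i i n r) / 8 - integral {t..s} (\<lambda>r. g r * ?\<rho> j j n r) / 8) {t..s}"
      by (intro has_integral_diff has_integral_divide int)
    then show "((\<lambda>r. g r * (d n r i * d n r j / \<epsilon> n)) has_integral
        integral {t..s} (\<lambda>r. g r * ?\<rho> i j n r) / 2
     - integral {t..s} (\<lambda>r. g r * ?\<rho> i i n r) / 8 - integral {t..s} (\<lambda>r. g r * ?\<rho> j j n r) / 8) {t..s}"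
      by (rule has_integral_eq[rotated]) (use e[of n] in \<open>simp add: power2_eq_square field_simps\<close>)
  qed
  show ?thesis
    unfolding eq polarized_covariation_stieltjes(4)[OF ts gs Qs ms, of i j]
    by (intro tendsto_diff tendsto_divide L tendsto_const) auto
qed

section \<open>Taylor expansion along a path\<close>

lemma C02_ac_base_regularity:
  fixes f :: "real \<Rightarrow> real ^ 'n::finite \<Rightarrow> real"
  assumes f: "f \<in> C02_ac_base I"
  shows "continuous_on (I \<times> UNIV) (\<lambda>(s, y). f s y)"
    and "\<And>s. s \<in> I \<Longrightarrow> f s \<in> C2"
    and "\<And>j. continuous_on (I \<times> UNIV) (\<lambda>(s, y). partial_deriv j (f s) y)"
    and "\<And>i j. continuous_on (I \<times> UNIV) (\<lambda>(s, y). hess_x f i j s y)"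
proof -
  show 1: "continuous_on (I \<times> UNIV) (\<lambda>(s, y). f s y)" and 2: "\<And>s. s \<in> I \<Longrightarrow> f s \<in> C2"
    using f by (simp_all add: C02_ac_base_def)
  show "\<And>j. continuous_on (I \<times> UNIV) (\<lambda>(s, y). partial_deriv j (f s) y)"
    by (rule partial_deriv_jointly_continuous[OF 1 2 C02_ac_base_hess_equicontinuous[OF f]])
  show "\<And>i j. continuous_on (I \<times> UNIV) (\<lambda>(s, y). hess_x f i j s y)"
    by (rule hess_jointly_continuous[OF 1 2 C02_ac_base_hess_equicontinuous[OF f]])
qed

lemma continuous_on_joint_compose:
  fixes F :: "real \<Rightarrow> 'a::topological_space \<Rightarrow> 'b::topological_space"
  assumes "continuous_on (I \<times> UNIV) (\<lambda>(s, y). F s y)" "continuous_on S u" "continuous_on S v"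
    and "\<And>r. r \<in> S \<Longrightarrow> u r \<in> I"
  shows "continuous_on S (\<lambda>r. F (u r) (v r))"
  using continuous_on_compose2[OF assms(1) continuous_on_Pair[OF assms(2,3)]] assms(4) by force

text \<open>The remainder is half a quadratic form whose coefficients are differences of the Hessian
  at an intermediate point and at \<open>x r\<close>. Uniform continuity, of the Hessian on a
  compact set and of the path, makes them small simultaneously for all \<open>r\<close>.\<close>

lemma taylor_remainder_along_path:
  fixes f :: "real \<Rightarrow> real ^ 'n::finite \<Rightarrow> real"
  assumes f: "f \<in> C02_ac_base {t..T}" and tT: "t \<le> T"
    and x: "continuous_on UNIV x" and xc: "\<And>r. x (clamp t T r) = x r" and w: "w > 0"
  shows "\<exists>\<delta>>0. \<forall>h\<ge>0. h < \<delta> \<longrightarrow> (\<forall>r\<in>{t..T}.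
    \<bar>f r (x (r + h)) - f r (x r) - grad_x f r (x r) \<bullet> (x (r + h) - x r)
      - 1/2 * (\<Sum>i\<in>UNIV. \<Sum>j\<in>UNIV. hess_x f i j r (x r) * ((x (r + h) - x r) $ i * (x (r + h) - x r) $ j))\<bar>
     \<le> w * (\<Sum>i\<in>UNIV. ((x (r + h) - x r) $ i)\<^sup>2))"
proof -
  note reg = C02_ac_base_regularity[OF f]
  define n where "n = real CARD('n)"
  have n: "n > 0" by (simp add: n_def)
  have "bounded (range x)" using clamped_path_range_compact[OF tT x xc] by (rule compact_imp_bounded)
  \<comment> \<open>A ball replaces the range of \<open>x\<close> because the intermediate point
    lies on a chord, so a convex set is needed.\<close>
  then obtain B where B: "\<And>r. x r \<in> cball 0 B" by (auto simp: bounded_iff)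
  have "\<exists>d>0. \<forall>r\<in>{t..T}. \<forall>y\<in>cball 0 B. \<forall>z\<in>cball 0 B. dist y z < d \<longrightarrow> \<bar>hess_x f i j r y - hess_x f i j r z\<bar> \<le> w / n" for i j
  proof -
    have "uniformly_continuous_on ({t..T} \<times> cball 0 B) (\<lambda>(s, y). hess_x f i j s y)"
      by (intro compact_uniformly_continuous compact_Times continuous_on_subset[OF reg(4)]) auto
    then obtain d where d: "d > 0" "\<And>p q. p \<in> {t..T} \<times> cball 0 B \<Longrightarrow> q \<in> {t..T} \<times> cball 0 B \<Longrightarrow> dist q p < d \<Longrightarrow>
        dist ((\<lambda>(s, y). hess_x f i j s y) q) ((\<lambda>(s, y). hess_x f i j s y) p) < w / n"
      unfolding uniformly_continuous_on_def using w n by (metis divide_pos_pos)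
    show ?thesis
    proof (intro exI[of _ d] conjI ballI impI)
      fix r and y z :: "real ^ 'n" assume "r \<in> {t..T}" "y \<in> cball 0 B" "z \<in> cball 0 B" "dist y z < d"
      then show "\<bar>hess_x f i j r y - hess_x f i j r z\<bar> \<le> w / n"
        using d(2)[of "(r, z)" "(r, y)"] by (simp add: dist_Pair_Pair dist_real_def)
    qed (rule d)
  qed
  then obtain d where d: "\<And>i j. d i j > 0" "\<And>i j r y z. \<lbrakk>r \<in> {t..T}; y \<in> cball 0 B; z \<in> cball 0 B; dist y z < d i j\<rbrakk>
      \<Longrightarrow> \<bar>hess_x f i j r y - hess_x f i j r z\<bar> \<le> w / n"
    by metis
  define d0 where "d0 = Min (range (\<lambda>(i, j). d i j))"
  have d0: "d0 > 0" "\<And>i j. d0 \<le> d i j"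
  proof -
    show "d0 > 0" unfolding d0_def using d(1) by (subst Min_gr_iff) auto
    show "d0 \<le> d i j" for i j unfolding d0_def by (rule Min_le) (auto intro!: rev_image_eqI[of "(i, j)"])
  qed
  \<comment> \<open>Together with \<open>h < 1\<close>, the interval up to \<open>T + 1\<close>
    contains \<open>r + h\<close> as well as \<open>r\<close>.\<close>
  have "uniformly_continuous_on {t..T+1} x"
    by (intro compact_uniformly_continuous continuous_on_subset[OF x]) auto
  then obtain \<delta> where \<delta>: "\<delta> > 0" "\<And>p q. p \<in> {t..T+1} \<Longrightarrow> q \<in> {t..T+1} \<Longrightarrow> dist q p < \<delta> \<Longrightarrow> dist (x q) (x p) < d0"
    unfolding uniformly_continuous_on_def using d0(1) by metis
  show ?thesis
  proof (intro exI[of _ "min \<delta> 1"] conjI allI impI ballI)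
    fix h r assume h: "0 \<le> h" "h < min \<delta> 1" and r: "r \<in> {t..T}"
    define v where "v = x (r + h) - x r"
    have dv: "norm v < d0" using \<delta>(2)[of r "r + h"] h r by (simp add: v_def dist_norm)
    obtain \<theta> where "0 \<le> \<theta>" "\<theta> \<le> 1"
      "f r (x (r + h)) = f r (x r) + (\<Sum>i\<in>UNIV. partial_deriv i (f r) (x r) * (x (r + h) - x r) $ i)
       + 1/2 * (\<Sum>i\<in>UNIV. \<Sum>j\<in>UNIV. partial_deriv i (partial_deriv j (f r)) (x r + \<theta> *\<^sub>R (x (r + h) - x r))
          * (x (r + h) - x r) $ i * (x (r + h) - x r) $ j)"
      by (rule C2_taylor[OF reg(2)[OF r], of "x (r + h)" "x r"]) (rule that)
    note \<theta> = this[folded v_def]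
    define y where "y = x r + \<theta> *\<^sub>R v"
    have "y = (1 - \<theta>) *\<^sub>R x r + \<theta> *\<^sub>R x (r + h)" by (simp add: y_def v_def algebra_simps)
    then have yB: "y \<in> cball 0 B" using \<theta> B convexD_alt[OF convex_cball, of "x r" 0 B "x (r + h)" \<theta>] by simp
    have "dist y (x r) \<le> norm v"
      using \<theta> by (simp add: y_def dist_norm mult_left_le_one_le)
    then have he: "\<bar>hess_x f i j r y - hess_x f i j r (x r)\<bar> \<le> w / n" for i j
      using dv d0(2)[of i j] by (intro d(2) r yB B) simp
    have g: "grad_x f r (x r) \<bullet> v = (\<Sum>i\<in>UNIV. partial_deriv i (f r) (x r) * v $ i)"
      by (simp add: grad_x_def inner_vec_def)
    have "f r (x (r + h)) - f r (x r) - grad_x f r (x r) \<bullet> v - 1/2 * (\<Sum>i\<in>UNIV. \<Sum>j\<in>UNIV. hess_x f i j r (x r) * (v $ i * v $ j))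
       = 1/2 * (\<Sum>i\<in>UNIV. \<Sum>j\<in>UNIV. (hess_x f i j r y - hess_x f i j r (x r)) * (v $ i * v $ j))"
      unfolding \<theta>(3) g y_def[symmetric] hess_x_def by (simp add: sum_subtractf algebra_simps)
    \<comment> \<open>Products are bounded by half the sum of the two squares. Summed over all pairs
      this gives \<open>n\<close> times the sum of squares, which is why the Hessian tolerance was
      \<open>w / n\<close>.\<close>
    also have "\<bar>\<dots>\<bar> \<le> 1/2 * (\<Sum>i\<in>UNIV. \<Sum>j\<in>UNIV. w / n * (((v $ i)\<^sup>2 + (v $ j)\<^sup>2) / 2))"
    proof -
      have "\<bar>(hess_x f i j r y - hess_x f i j r (x r)) * (v $ i * v $ j)\<bar> \<le> w / n * (((v $ i)\<^sup>2 + (v $ j)\<^sup>2) / 2)" for i j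
        unfolding abs_mult[of "hess_x f i j r y - hess_x f i j r (x r)"]
      proof (rule mult_mono[OF he])
        show "\<bar>v $ i * v $ j\<bar> \<le> ((v $ i)\<^sup>2 + (v $ j)\<^sup>2) / 2"
          using sum_squares_bound[of "\<bar>v $ i\<bar>" "\<bar>v $ j\<bar>"] by (simp add: abs_mult)
      qed (use w n in auto)
      then have "\<bar>\<Sum>i\<in>UNIV. \<Sum>j\<in>UNIV. (hess_x f i j r y - hess_x f i j r (x r)) * (v $ i * v $ j)\<bar>
        \<le> (\<Sum>i\<in>UNIV. \<Sum>j\<in>UNIV. w / n * (((v $ i)\<^sup>2 + (v $ j)\<^sup>2) / 2))"
        by (intro order_trans[OF sum_abs] sum_mono) 
      then show ?thesis by simp
    qed
    also have "(\<Sum>i\<in>UNIV. \<Sum>j\<in>UNIV. w / n * (((v $ i)\<^sup>2 + (v $ j)\<^sup>2) / 2)) = w * (\<Sum>i\<in>UNIV. (v $ i)\<^sup>2)"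
    proof -
      have "(\<Sum>i\<in>UNIV. \<Sum>j\<in>UNIV. w / n * (((v $ i)\<^sup>2 + (v $ j)\<^sup>2) / 2))
        = w / n * ((\<Sum>i\<in>UNIV. \<Sum>j\<in>(UNIV :: 'n set). (v $ i)\<^sup>2) / 2 + (\<Sum>i\<in>(UNIV :: 'n set). \<Sum>j\<in>UNIV. (v $ j)\<^sup>2) / 2)"
        unfolding sum_divide_distrib sum.distrib[symmetric] sum_distrib_left by (simp add: field_simps)
      also have "\<dots> = w / n * (n * (\<Sum>i\<in>UNIV. (v $ i)\<^sup>2))"
        by (simp add: n_def sum_distrib_left)
      finally show ?thesis using n by simp
    qed
    also have "1 / 2 * (w * (\<Sum>i\<in>UNIV. (v $ i)\<^sup>2)) \<le> w * (\<Sum>i\<in>UNIV. (v $ i)\<^sup>2)"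
      using w sum_nonneg[of UNIV "\<lambda>i. (v $ i)\<^sup>2"] by simp
    finally show "\<bar>f r (x (r + h)) - f r (x r) - grad_x f r (x r) \<bullet> (x (r + h) - x r)
      - 1/2 * (\<Sum>i\<in>UNIV. \<Sum>j\<in>UNIV. hess_x f i j r (x r) * ((x (r + h) - x r) $ i * (x (r + h) - x r) $ j))\<bar>
     \<le> w * (\<Sum>i\<in>UNIV. ((x (r + h) - x r) $ i)\<^sup>2)"
      by (simp only: v_def)
  qed (use \<delta> in auto)
qed

text \<open>The gradient term alone has no known limit. It is solved for in the decomposition, and
  the limits of all other terms determine its own.\<close>

lemma ito_formula_along_path:
  fixes f :: "real \<Rightarrow> real ^ 'n::finite \<Rightarrow> real" and Q :: "'n \<Rightarrow> 'n \<Rightarrow> real \<Rightarrow> real"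
  assumes f: "f \<in> C02_ac_base {t..T}" and tT: "t \<le> T"
    and x: "continuous_on UNIV x" and xc: "\<And>r. x (clamp t T r) = x r"
    and e: "\<And>n. \<epsilon> n > 0" "\<epsilon> \<longlonglongrightarrow> 0"
    and Q: "\<And>i j. continuous_on {t..T} (Q i j)"
    and D: "D \<subseteq> {t..T}" "t \<in> D" "T \<in> D" and dense: "\<And>c c'. \<lbrakk>t \<le> c; c < c'; c' \<le> T\<rbrakk> \<Longrightarrow> \<exists>r\<in>D. c < r \<and> r < c'"
    and conv: "\<And>i j q. q \<in> D \<Longrightarrow>
      (\<lambda>n. 1 / \<epsilon> n * integral {t..q} (\<lambda>r. (x (r + \<epsilon> n) - x r) $ i * (x (r + \<epsilon> n) - x r) $ j)) \<longlonglongrightarrow> Q i j q"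
    and s: "s \<in> {t..T}"
  shows "(\<lambda>n. integral {t..s} (\<lambda>r. grad_x f r (x r) \<bullet> ((x (r + \<epsilon> n) - x r) /\<^sub>R \<epsilon> n))) \<longlonglongrightarrow>
    f s (x s) - f t (x t) - (LINT r:{t..s}|lebesgue. time_deriv {t..T} f r (x r))
     - 1/2 * (\<Sum>i\<in>UNIV. \<Sum>j\<in>UNIV. stieltjes_integral (\<lambda>r. hess_x f i j r (x r)) (Q i j) t s)"
proof -
  note reg = C02_ac_base_regularity[OF f]
  have cl: "clamp t T r = max t (min T r)" for r using tT by (rule clamp_real)
  have clc: "continuous_on S (\<lambda>r. clamp t T (r + c))" for S c unfolding cl by (intro continuous_intros)
  have xs: "continuous_on S (\<lambda>r. x (r + c))" for S c
    by (intro continuous_on_compose2[OF x] continuous_intros) auto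
  have xs0: "continuous_on S x" for S by (rule continuous_on_subset[OF x]) simp
  define d where "d = (\<lambda>n r i. (x (r + \<epsilon> n) - x r) $ i)"
  have dc: "continuous_on S (\<lambda>r. d n r i)" for S n i unfolding d_def by (intro continuous_intros xs xs0)
  \<comment> \<open>Clamping the time as well makes \<open>F\<close> a continuous function on the
    whole line, constant outside \<open>{t..T}\<close>, so its increment quotients are
    covered.\<close>
  define F where "F = (\<lambda>r. f (clamp t T r) (x r))"
  have Fc: "continuous_on UNIV F" unfolding F_def
    by (rule continuous_on_joint_compose[OF reg(1)]) (use tT clc[of UNIV 0] x in \<open>auto simp: cl\<close>)
  define A where "A = (\<lambda>n r. F (r + \<epsilon> n) - F r)"
  define B where "B = (\<lambda>n r. f (clamp t T (r + \<epsilon> n)) (x (r + \<epsilon> n)) - f r (x (r + \<epsilon> n)))"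
  define C where "C = (\<lambda>i j n r. hess_x f i j r (x r) * (d n r i * d n r j / \<epsilon> n))"
  define Z where "Z = (\<lambda>n r. grad_x f r (x r) \<bullet> ((x (r + \<epsilon> n) - x r) /\<^sub>R \<epsilon> n))"
  \<comment> \<open>\<open>A\<close> is the total increment, \<open>B\<close> its part in time,
    \<open>C\<close> the second order terms and \<open>Z\<close> the gradient term. \<open>R\<close>
    is whatever is left, so \<open>Zeq\<close> is mere linearity and Taylor's formula enters only
    through \<open>Rlim\<close>.\<close>
  define R where "R = (\<lambda>n r. A n r / \<epsilon> n - B n r / \<epsilon> n - 1/2 * (\<Sum>i\<in>UNIV. \<Sum>j\<in>UNIV. C i j n r) - Z n r)"
  have sub: "{t..s} \<subseteq> {t..T}" using s by auto
  have hc: "continuous_on {t..T} (\<lambda>r. hess_x f i j r (x r))" for i j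
    by (rule continuous_on_joint_compose[OF reg(4)]) (auto intro: xs0 continuous_on_id)
  have gc: "continuous_on {t..T} (\<lambda>r. grad_x f r (x r))" unfolding grad_x_def
    by (intro continuous_on_vec_lambda continuous_on_joint_compose[OF reg(3)]) (auto intro: xs0 continuous_on_id)
  have Ac: "continuous_on {t..s} (A n)" for n unfolding A_def
    by (intro continuous_intros continuous_on_compose2[OF Fc]) auto
  have Bc: "continuous_on {t..s} (B n)" for n unfolding B_def
    by (intro continuous_intros continuous_on_joint_compose[OF reg(1)] clc xs) (use s tT in \<open>auto simp: cl\<close>)
  have Cc: "continuous_on {t..s} (C i j n)" for i j n unfolding C_def
    by (intro continuous_intros dc continuous_on_subset[OF hc sub]) (use e(1)[of n] in auto)
  have Zc: "continuous_on {t..s} (Z n)" for n unfolding Z_def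
    by (intro continuous_intros xs xs0 continuous_on_subset[OF gc sub])
  have Rc: "continuous_on {t..s} (R n)" for n unfolding R_def
    by (intro continuous_intros Ac Bc Cc Zc) (use e(1)[of n] in auto)
  note int = integrable_continuous_interval[OF Ac] integrable_continuous_interval[OF Bc]
     integrable_continuous_interval[OF Cc] integrable_continuous_interval[OF Zc] integrable_continuous_interval[OF Rc]
  have Zeq: "integral {t..s} (Z n) = integral {t..s} (A n) / \<epsilon> n - integral {t..s} (B n) / \<epsilon> n
     - 1/2 * (\<Sum>i\<in>UNIV. \<Sum>j\<in>UNIV. integral {t..s} (C i j n)) - integral {t..s} (R n)" for n
  proof (rule integral_unique)
    have "((\<lambda>r. A n r / \<epsilon> n - B n r / \<epsilon> n - 1/2 * (\<Sum>i\<in>UNIV. \<Sum>j\<in>UNIV. C i j n r) - R n r) has_integral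
       integral {t..s} (A n) / \<epsilon> n - integral {t..s} (B n) / \<epsilon> n
     - 1/2 * (\<Sum>i\<in>UNIV. \<Sum>j\<in>UNIV. integral {t..s} (C i j n)) - integral {t..s} (R n)) {t..s}"
      by (intro has_integral_diff has_integral_divide has_integral_mult_right has_integral_sum integrable_integral int) auto
    then show "(Z n has_integral
       integral {t..s} (A n) / \<epsilon> n - integral {t..s} (B n) / \<epsilon> n
     - 1/2 * (\<Sum>i\<in>UNIV. \<Sum>j\<in>UNIV. integral {t..s} (C i j n)) - integral {t..s} (R n)) {t..s}"
      by (rule has_integral_eq[rotated]) (simp add: R_def)
  qed
  have conv': "(\<lambda>n. 1 / \<epsilon> n * integral {t..q} (\<lambda>r. d n r i * d n r j)) \<longlonglongrightarrow> Q i j q" if "q \<in> D" for i j q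
    using conv[OF that] by (simp add: d_def)
  have wc: "(\<lambda>n. integral {t..s} (\<lambda>r. g r * (d n r i * d n r j / \<epsilon> n))) \<longlonglongrightarrow> stieltjes_integral g (Q i j) t s"
    if "continuous_on {t..T} g" for g i j
    by (rule weighted_covariation_convergence[OF tT Q dc e(1) D _ _ s that]) (fact dense, fact conv')
  have Alim: "(\<lambda>n. integral {t..s} (A n) / \<epsilon> n) \<longlonglongrightarrow> F s - F t"
    unfolding A_def by (rule integral_increment_quotient_tendsto[OF Fc _ e]) (use s in auto)
  have Blim: "(\<lambda>n. integral {t..s} (B n) / \<epsilon> n) \<longlonglongrightarrow> (LINT r:{t..s}|lebesgue. time_deriv {t..T} f r (x r))"
    unfolding B_def by (rule C02_time_increment_convergence(2)[OF f tT x xc e s])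
  have Clim: "(\<lambda>n. integral {t..s} (C i j n)) \<longlonglongrightarrow> stieltjes_integral (\<lambda>r. hess_x f i j r (x r)) (Q i j) t s" for i j
    unfolding C_def by (rule wc[OF hc])
  have Rlim: "(\<lambda>n. integral {t..s} (R n)) \<longlonglongrightarrow> 0"
  proof (rule tendstoI)
    fix e0 :: real assume e0: "e0 > 0"
    \<comment> \<open>The regularized trace of the covariation, written with weight \<open>1\<close>
      to fit \<open>wc\<close>. It converges to \<open>L\<close>, so it is eventually below
      \<open>L + 1\<close>; this fixes \<open>w\<close> below.\<close>
    let ?S = "\<lambda>n. \<Sum>i\<in>UNIV. integral {t..s} (\<lambda>r. 1 * (d n r i * d n r i / \<epsilon> n))"
    define L where "L = (\<Sum>i\<in>UNIV. stieltjes_integral (\<lambda>_. 1) (Q i i) t s)"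
    have SL: "?S \<longlonglongrightarrow> L" unfolding L_def by (intro tendsto_sum wc) simp
    have S0: "?S n \<ge> 0" for n
      by (intro sum_nonneg integral_nonneg integrable_continuous_interval continuous_intros dc) (use e(1)[of n] in \<open>auto simp: less_imp_le\<close>)
    have L0: "L \<ge> 0" by (rule LIMSEQ_le_const[OF SL]) (use S0 in auto)
    define w where "w = e0 / (2 * (L + 1))"
    have w: "w > 0" "w * (L + 1) = e0 / 2" using e0 L0 by (auto simp: w_def divide_eq_eq)
    obtain \<delta> where \<delta>: "\<delta> > 0" "\<And>h r. \<lbrakk>0 \<le> h; h < \<delta>; r \<in> {t..T}\<rbrakk> \<Longrightarrow>
      \<bar>f r (x (r + h)) - f r (x r) - grad_x f r (x r) \<bullet> (x (r + h) - x r)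
      - 1/2 * (\<Sum>i\<in>UNIV. \<Sum>j\<in>UNIV. hess_x f i j r (x r) * ((x (r + h) - x r) $ i * (x (r + h) - x r) $ j))\<bar>
     \<le> w * (\<Sum>i\<in>UNIV. ((x (r + h) - x r) $ i)\<^sup>2)"
      using taylor_remainder_along_path[OF f tT x xc w(1)] by blast
    have Rb: "\<bar>integral {t..s} (R n)\<bar> \<le> w * ?S n" if n: "\<epsilon> n < \<delta>" for n
    proof -
      have "norm (integral {t..s} (R n)) \<le> integral {t..s} (\<lambda>r. w * (\<Sum>i\<in>UNIV. 1 * (d n r i * d n r i / \<epsilon> n)))"
      proof (rule integral_norm_bound_integral[OF int(5)])
        show "(\<lambda>r. w * (\<Sum>i\<in>UNIV. 1 * (d n r i * d n r i / \<epsilon> n))) integrable_on {t..s}"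
          by (intro integrable_continuous_interval continuous_intros dc) (use e(1)[of n] in auto)
        fix r assume r: "r \<in> {t..s}"
        then have rT: "r \<in> {t..T}" "clamp t T r = r" using s by (auto simp: cl)
        let ?Y = "f r (x (r + \<epsilon> n)) - f r (x r) - grad_x f r (x r) \<bullet> (x (r + \<epsilon> n) - x r)
          - 1/2 * (\<Sum>i\<in>UNIV. \<Sum>j\<in>UNIV. hess_x f i j r (x r) * (d n r i * d n r j))"
        have "A n r - B n r = f r (x (r + \<epsilon> n)) - f r (x r)" by (simp add: A_def B_def F_def rT)
        then have "R n r = (f r (x (r + \<epsilon> n)) - f r (x r)) / \<epsilon> n - 1/2 * (\<Sum>i\<in>UNIV. \<Sum>j\<in>UNIV. C i j n r) - Z n r"
          unfolding R_def by (simp add: diff_divide_distrib[symmetric])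
        also have "(\<Sum>i\<in>UNIV. \<Sum>j\<in>UNIV. C i j n r) = (\<Sum>i\<in>UNIV. \<Sum>j\<in>UNIV. hess_x f i j r (x r) * (d n r i * d n r j)) / \<epsilon> n"
          by (simp add: C_def sum_divide_distrib)
        also have "Z n r = grad_x f r (x r) \<bullet> (x (r + \<epsilon> n) - x r) / \<epsilon> n"
          by (simp add: Z_def divide_inverse mult.commute)
        finally have "R n r = ?Y / \<epsilon> n" by (simp add: diff_divide_distrib)
        moreover have "\<bar>?Y\<bar> \<le> w * (\<Sum>i\<in>UNIV. (d n r i)\<^sup>2)"
          using \<delta>(2)[of "\<epsilon> n" r] n e(1)[of n] rT by (simp add: d_def)
        ultimately have "\<bar>R n r\<bar> \<le> w * (\<Sum>i\<in>UNIV. (d n r i)\<^sup>2) / \<epsilon> n"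
          using e(1)[of n] by (simp add: abs_divide divide_right_mono)
        then show "norm (R n r) \<le> w * (\<Sum>i\<in>UNIV. 1 * (d n r i * d n r i / \<epsilon> n))"
          by (simp add: sum_divide_distrib[symmetric] power2_eq_square)
      qed
      also have "\<dots> = w * ?S n"
        by (simp only: integral_mult_right, subst integral_sum)
          (auto intro!: integrable_continuous_interval continuous_intros dc less_imp_neq[OF e(1), symmetric])
      finally show ?thesis by simp
    qed
    have "\<forall>\<^sub>F n in sequentially. ?S n < L + 1" by (rule order_tendstoD(2)[OF SL]) simp
    moreover have "\<forall>\<^sub>F n in sequentially. \<epsilon> n < \<delta>" by (rule order_tendstoD(2)[OF e(2) \<delta>(1)])
    ultimately show "\<forall>\<^sub>F n in sequentially. dist (integral {t..s} (R n)) 0 < e0"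
    proof eventually_elim
      case (elim n)
      have "\<bar>integral {t..s} (R n)\<bar> \<le> w * ?S n" by (rule Rb[OF elim(2)])
      also have "\<dots> \<le> w * (L + 1)" using elim(1) w by (intro mult_left_mono) auto
      finally show ?case using w e0 by (simp add: dist_real_def)
    qed
  qed
  have "(\<lambda>n. integral {t..s} (Z n)) \<longlonglongrightarrow> (F s - F t) - (LINT r:{t..s}|lebesgue. time_deriv {t..T} f r (x r))
     - 1/2 * (\<Sum>i\<in>UNIV. \<Sum>j\<in>UNIV. stieltjes_integral (\<lambda>r. hess_x f i j r (x r)) (Q i j) t s) - 0"
    unfolding Zeq by (intro tendsto_diff tendsto_mult tendsto_sum tendsto_const Alim Blim Clim Rlim)
  moreover have "F s = f s (x s)" "F t = f t (x t)" using s tT by (auto simp: F_def cl)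
  ultimately show ?thesis by (simp add: Z_def)
qed

lemma has_stieltjes_integral_cong:
  assumes "\<And>r. r \<in> {a..b} \<Longrightarrow> g r = g' r"
  shows "has_stieltjes_integral g A a b z = has_stieltjes_integral g' A a b z"
proof -
  have "set_integrable (interval_measure P) {a..b} g = set_integrable (interval_measure P) {a..b} g'" for P
    by (rule set_integrable_cong) (use assms in auto)
  moreover have "(LINT r:{a..b}|interval_measure P. g r) = (LINT r:{a..b}|interval_measure P. g' r)" for P
    by (rule set_lebesgue_integral_cong) (use assms in auto)
  ultimately show ?thesis unfolding has_stieltjes_integral_def by simp
qed

lemma stieltjes_integral_cong:
  assumes "\<And>r. r \<in> {a..b} \<Longrightarrow> g r = g' r"
  shows "stieltjes_integrable g A a b = stieltjes_integrable g' A a b"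
    and "stieltjes_integral g A a b = stieltjes_integral g' A a b"
proof -
  have "has_stieltjes_integral g A a b = has_stieltjes_integral g' A a b"
    by (rule ext) (rule has_stieltjes_integral_cong[OF assms])
  then show "stieltjes_integrable g A a b = stieltjes_integrable g' A a b"
    and "stieltjes_integral g A a b = stieltjes_integral g' A a b"
    by (simp_all add: stieltjes_integrable_def stieltjes_integral_def)
qed

section \<open>The formula for processes\<close>

lemma countable_dense_in_interval:
  fixes t T :: real
  assumes "t < T"
  obtains D where "countable D" "D \<subseteq> {t..T}" "t \<in> D" "T \<in> D" "{t..T} \<subseteq> closure D"
    "\<And>c c'. \<lbrakk>t \<le> c; c < c'; c' \<le> T\<rbrakk> \<Longrightarrow> \<exists>r\<in>D. c < r \<and> r < c'"
proof -
  obtain D where D: "countable D" "D \<subseteq> {t..T}" "{t..T} \<subseteq> closure D" using separable by metis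
  show ?thesis
  proof (rule that[of "insert t (insert T D)"])
    show "{t..T} \<subseteq> closure (insert t (insert T D))"
      using D(3) closure_mono[of D "insert t (insert T D)"] by blast
    fix c c' assume c: "t \<le> c" "c < c'" "c' \<le> T"
    then have "(c + c') / 2 \<in> closure D" using D(3) by auto
    then obtain r where "r \<in> D" "dist r ((c + c') / 2) < (c' - c) / 2"
      using c unfolding closure_approachable by (metis diff_gt_0_iff_gt half_gt_zero)
    then have "r \<in> D" "c < r" "r < c'" by (auto simp: dist_real_def abs_less_iff field_simps)
    then show "\<exists>r\<in>insert t (insert T D). c < r \<and> r < c'" by blast
  qed (use D assms in auto)
qed

text \<open>A forward integral is determined only up to almost sure equality at each time. The
  formula is therefore claimed for every continuous version \<open>J\<close>, with one null set for
  all \<open>s\<close>, next to the existence of such a version.\<close>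

theorem proposition2p7:
  fixes M :: "'w measure"
    and t T :: real
    and f :: "real \<Rightarrow> real ^ 'n::finite \<Rightarrow> real"
    and X :: "real \<Rightarrow> 'w \<Rightarrow> real ^ 'n"
    and XX :: "'n \<Rightarrow> 'n \<Rightarrow> real \<Rightarrow> 'w \<Rightarrow> real"
  assumes "prob_space M"
    and "0 \<le> t" and "t < T"
    and "f \<in> C02_ac {t..T}"
    and "continuous_process M t T X"
    and "\<And>i j. has_covariation M t T (\<lambda>s \<omega>. X s \<omega> $ i) (\<lambda>s \<omega>. X s \<omega> $ j) (XX i j)"
    and "f \<in> C02_ac_count {t..T} \<or>
         (\<forall>i j. AE \<omega> in M. absolutely_continuous_on {t..T} (\<lambda>s. XX i j s \<omega>))"
  shows "(\<exists>J. has_forward_integral M t T (\<lambda>r \<omega>. grad_x f r (X r \<omega>)) X J) \<and>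
    (\<forall>J. has_forward_integral M t T (\<lambda>r \<omega>. grad_x f r (X r \<omega>)) X J \<longrightarrow>
      (AE \<omega> in M. \<forall>s\<in>{t..T}.
         set_integrable lebesgue {t..s} (\<lambda>r. time_deriv {t..T} f r (X r \<omega>)) \<and>
         (\<forall>i j. stieltjes_integrable (\<lambda>r. hess_x f i j r (X r \<omega>)) (\<lambda>r. XX i j r \<omega>) t s) \<and>
         f s (X s \<omega>) = f t (X t \<omega>)
           + (LINT r:{t..s}|lebesgue. time_deriv {t..T} f r (X r \<omega>))
           + J s \<omega>
           + 1 / 2 * (\<Sum>i\<in>UNIV. \<Sum>j\<in>UNIV.
               stieltjes_integral (\<lambda>r. hess_x f i j r (X r \<omega>)) (\<lambda>r. XX i j r \<omega>) t s)))"
proof -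
  interpret prob_space M by fact
  have f: "f \<in> C02_ac_base {t..T}" using assms(4) by (simp add: C02_ac_def)
  have tT: "t \<le> T" using assms(3) by simp
  note reg = C02_ac_base_regularity[OF f]
  have cl: "clamp t T r = max t (min T r)" for r using tT by (rule clamp_real)
  have Xm: "X s \<in> borel_measurable M" if "s \<in> {t..T}" for s
    using assms(5) that by (simp add: continuous_process_def)
  have Xc: "continuous_on {t..T} (\<lambda>s. X s \<omega>)" if "\<omega> \<in> space M" for \<omega>
    using assms(5) that by (simp add: continuous_process_def)
  have Qm: "XX i j s \<in> borel_measurable M" if "s \<in> {t..T}" for s i j
    using assms(6)[of i j] that by (simp add: continuous_process_def has_covariation_def)
  have Qc: "continuous_on {t..T} (\<lambda>s. XX i j s \<omega>)" if "\<omega> \<in> space M" for \<omega> i j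
    using assms(6)[of i j] that by (simp add: continuous_process_def has_covariation_def)
  \<comment> \<open>The path extended by constants beyond \<open>{t..T}\<close>, so that
    \<open>x \<omega> (r + \<epsilon>)\<close> is meaningful for every
    \<open>\<epsilon>\<close>.\<close>
  define x where "x = (\<lambda>\<omega> r. X (clamp t T r) \<omega>)"
  have xX: "x \<omega> r = X r \<omega>" if "r \<in> {t..T}" for \<omega> r using that by (auto simp: x_def cl)
  have xc: "x \<omega> (clamp t T r) = x \<omega> r" for \<omega> r by (simp add: x_def cl max_def min_def)
  have xm: "(\<lambda>\<omega>. x \<omega> r) \<in> borel_measurable M" for r
    unfolding x_def using Xm[of "clamp t T r"] tT by (auto simp: cl)
  have clc: "continuous_on S (\<lambda>r. clamp t T (r + c))" for S c unfolding cl by (intro continuous_intros)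
  have x: "continuous_on UNIV (x \<omega>)" if "\<omega> \<in> space M" for \<omega>
    unfolding x_def by (rule continuous_on_compose2[OF Xc[OF that]]) (use clc[of UNIV 0] tT in \<open>auto simp: cl\<close>)
  have xs: "continuous_on S (\<lambda>r. x \<omega> (r + c))" if "\<omega> \<in> space M" for S c \<omega>
    by (intro continuous_on_compose2[OF x[OF that]] continuous_intros) auto
  have xs0: "continuous_on S (x \<omega>)" if "\<omega> \<in> space M" for S \<omega> by (rule continuous_on_subset[OF x[OF that]]) simp
  have inc: "incr t T X \<epsilon> r \<omega> = x \<omega> (r + \<epsilon>) - x \<omega> r" for \<epsilon> r \<omega>
    by (simp add: incr_def ext_cont_def x_def)
  have inci: "incr t T (\<lambda>s \<omega>. X s \<omega> $ i) \<epsilon> r \<omega> = (x \<omega> (r + \<epsilon>) - x \<omega> r) $ i" for \<epsilon> r \<omega> i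
    by (simp add: incr_def ext_cont_def x_def)
  have LI: "(LINT r:{a..b}|lebesgue. k r) = integral {a..b} k" if "continuous_on {a..b} k" for a b and k :: "real \<Rightarrow> real"
    using set_lebesgue_integral_eq_integral(2)[OF absolutely_integrable_continuous_real[OF that]] .
  define I where "I = (\<lambda>s \<omega>. LINT r:{t..s}|lebesgue. time_deriv {t..T} f r (x \<omega> r))"
  define H where "H = (\<lambda>i j s \<omega>. stieltjes_integral (\<lambda>r. hess_x f i j r (x \<omega> r)) (\<lambda>r. XX i j r \<omega>) t s)"
  \<comment> \<open>The value that the formula forces upon the forward integral.\<close>
  define E where "E = (\<lambda>s \<omega>. f s (x \<omega> s) - f t (x \<omega> t) - I s \<omega> - 1/2 * (\<Sum>i\<in>UNIV. \<Sum>j\<in>UNIV. H i j s \<omega>))"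
  define Y where "Y = (\<lambda>s \<epsilon> \<omega>. LINT r:{t..s}|lebesgue. grad_x f r (X r \<omega>) \<bullet> (incr t T X \<epsilon> r \<omega> /\<^sub>R \<epsilon>))"
  obtain D where D: "countable D" "D \<subseteq> {t..T}" "t \<in> D" "T \<in> D" "{t..T} \<subseteq> closure D"
    and dense: "\<And>c c'. \<lbrakk>t \<le> c; c < c'; c' \<le> T\<rbrakk> \<Longrightarrow> \<exists>r\<in>D. c < r \<and> r < c'"
    by (rule countable_dense_in_interval[OF assms(3)]) (rule that)
  define cov where "cov = (\<lambda>\<omega> \<epsilon> i j q. 1 / \<epsilon> * integral {t..q} (\<lambda>r. (x \<omega> (r + \<epsilon>) - x \<omega> r) $ i * (x \<omega> (r + \<epsilon>) - x \<omega> r) $ j))"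
  \<comment> \<open>The triples of a time in \<open>D\<close> and two indices are enumerated as one
    sequence, so that a single subsequence and a single null set serve all of them.\<close>
  have subseq: "\<exists>r. strict_mono r \<and> (AE \<omega> in M. \<forall>i j. \<forall>q\<in>D. (\<lambda>n. cov \<omega> (e (r n)) i j q) \<longlonglongrightarrow> XX i j q \<omega>)"
    if e: "\<And>n. e n > 0" "e \<longlonglongrightarrow> 0" for e :: "nat \<Rightarrow> real"
  proof -
    let ?A = "D \<times> (UNIV :: ('n \<times> 'n) set)"
    have A: "countable ?A" "?A \<noteq> {}" using D by auto
    define idx where "idx = from_nat_into ?A"
    have idx: "idx k \<in> ?A" for k unfolding idx_def by (rule from_nat_into[OF A(2)])
    define Z where "Z = (\<lambda>k \<epsilon> \<omega>. 1 / \<epsilon> * (LINT r:{t..fst (idx k)}|lebesgue.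
       incr t T (\<lambda>s \<omega>. X s \<omega> $ fst (snd (idx k))) \<epsilon> r \<omega> * incr t T (\<lambda>s \<omega>. X s \<omega> $ snd (snd (idx k))) \<epsilon> r \<omega>))"
    define L where "L = (\<lambda>k. XX (fst (snd (idx k))) (snd (snd (idx k))) (fst (idx k)))"
    have "tendsto_in_prob M (Z k) (L k) (at_right 0)" for k
    proof -
      have "fst (idx k) \<in> {t..T}" using idx[of k] D(2) by auto
      then show ?thesis
        using assms(6)[of "fst (snd (idx k))" "snd (snd (idx k))"] unfolding has_covariation_def Z_def L_def by blast
    qed
    moreover have "filterlim e (at_right 0) sequentially"
      using e by (auto simp: filterlim_at less_imp_neq[OF e(1), symmetric])
    ultimately obtain r where r: "strict_mono r" "AE \<omega> in M. \<forall>k. (\<lambda>n. Z k (e (r n)) \<omega>) \<longlonglongrightarrow> L k \<omega>"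
      by (rule tendsto_in_prob_AE_subseq) (rule that)
    have "AE \<omega> in M. \<forall>i j. \<forall>q\<in>D. (\<lambda>n. cov \<omega> (e (r n)) i j q) \<longlonglongrightarrow> XX i j q \<omega>"
      using r(2) AE_space
    proof eventually_elim
      case (elim \<omega>)
      show ?case
      proof (intro allI ballI)
        fix i j q assume "q \<in> D"
        then obtain k where k: "idx k = (q, i, j)"
          using from_nat_into_surj[OF A(1), of "(q, i, j)"] unfolding idx_def by auto
        have "Z k \<epsilon> \<omega> = cov \<omega> \<epsilon> i j q" for \<epsilon>
          unfolding Z_def cov_def k inci fst_conv snd_conv
          by (subst LI) (auto intro!: continuous_intros xs xs0 elim)
        then show "(\<lambda>n. cov \<omega> (e (r n)) i j q) \<longlonglongrightarrow> XX i j q \<omega>"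
          using elim(1)[rule_format, of k] by (simp add: L_def k)
      qed
    qed
    with r(1) show ?thesis by blast
  qed
  \<comment> \<open>Monotonicity concerns the limits \<open>XX\<close> alone, so one fixed sequence
    is enough to establish it. The resulting event is independent of the sequences considered later,
    and \<open>J\<close> can be defined once and for all.\<close>
  have "AE \<omega> in M. \<forall>i j. mono_on {t..T} (polarized (\<lambda>i j s. XX i j s \<omega>) i j)"
  proof -
    have e: "1 / real (Suc n) > 0" "(\<lambda>n. 1 / real (Suc n)) \<longlonglongrightarrow> 0" for n
      using LIMSEQ_Suc[OF lim_const_over_n[of "1::real"]] by auto
    obtain r where r: "AE \<omega> in M. \<forall>i j. \<forall>q\<in>D. (\<lambda>n. cov \<omega> (1 / real (Suc (r n))) i j q) \<longlonglongrightarrow> XX i j q \<omega>"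
      using subseq[OF e] by blast
    show ?thesis
      using r AE_space
    proof eventually_elim
      case (elim \<omega>)
      show ?case
      proof (intro allI)
        fix i j
        show "mono_on {t..T} (polarized (\<lambda>i j s. XX i j s \<omega>) i j)"
        proof (rule polarized_path_covariation(2)[OF tT Qc[OF elim(2)] _ _ D(2-4) dense, where
              d = "\<lambda>n u i. (x \<omega> (u + 1 / real (Suc (r n))) - x \<omega> u) $ i" and \<epsilon> = "\<lambda>n. 1 / real (Suc (r n))"])
          show "(\<lambda>n. 1 / (1 / real (Suc (r n))) * integral {t..q} (\<lambda>u. (x \<omega> (u + 1 / real (Suc (r n))) - x \<omega> u) $ i *
              (x \<omega> (u + 1 / real (Suc (r n))) - x \<omega> u) $ j)) \<longlonglongrightarrow> XX i j q \<omega>" if "q \<in> D" for i j q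
            using elim(1) that unfolding cov_def by blast
        qed (auto intro!: continuous_intros xs xs0 elim(2))
      qed
    qed
  qed
  then obtain N where N: "N \<in> null_sets M"
    "\<And>\<omega> i j. \<omega> \<in> space M - N \<Longrightarrow> mono_on {t..T} (polarized (\<lambda>i j s. XX i j s \<omega>) i j)"
    unfolding eventually_ae_filter by blast
  define \<Omega> where "\<Omega> = space M - N"
  have \<Omega>: "\<Omega> \<in> sets M" "\<Omega> \<subseteq> space M" using N(1) by (auto simp: \<Omega>_def)
  have AE\<Omega>: "AE \<omega> in M. \<omega> \<in> \<Omega>" using AE_not_in[OF N(1)] AE_space by eventually_elim (auto simp: \<Omega>_def)
  have mono: "mono_on {t..T} (polarized (\<lambda>i j s. XX i j s \<omega>) i j)" if "\<omega> \<in> \<Omega>" for \<omega> i j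
    using N(2) that by (simp add: \<Omega>_def)
  have hc: "continuous_on {t..T} (\<lambda>r. hess_x f i j r (x \<omega> r))" if "\<omega> \<in> space M" for i j \<omega>
    by (rule continuous_on_joint_compose[OF reg(4)]) (auto intro: xs0 that continuous_on_id)
  have gc: "continuous_on {t..T} (\<lambda>r. grad_x f r (x \<omega> r))" if "\<omega> \<in> space M" for \<omega> unfolding grad_x_def
    by (intro continuous_on_vec_lambda continuous_on_joint_compose[OF reg(3)]) (auto intro: xs0 that continuous_on_id)
  note st = polarized_covariation_stieltjes[OF tT hc Qc mono]
  have Yeq: "Y s \<epsilon> \<omega> = integral {t..s} (\<lambda>r. grad_x f r (x \<omega> r) \<bullet> ((x \<omega> (r + \<epsilon>) - x \<omega> r) /\<^sub>R \<epsilon>))"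
    and Ycont: "continuous_on {t..s} (\<lambda>r. grad_x f r (x \<omega> r) \<bullet> ((x \<omega> (r + \<epsilon>) - x \<omega> r) /\<^sub>R \<epsilon>))"
    if s: "s \<in> {t..T}" and \<omega>: "\<omega> \<in> space M" for s \<epsilon> \<omega>
  proof -
    have g: "continuous_on {t..s} (\<lambda>r. grad_x f r (x \<omega> r))" by (rule continuous_on_subset[OF gc[OF \<omega>]]) (use s in auto)
    show c: "continuous_on {t..s} (\<lambda>r. grad_x f r (x \<omega> r) \<bullet> ((x \<omega> (r + \<epsilon>) - x \<omega> r) /\<^sub>R \<epsilon>))"
      by (intro continuous_intros g xs xs0 \<omega>)
    have "Y s \<epsilon> \<omega> = (LINT r:{t..s}|lebesgue. grad_x f r (x \<omega> r) \<bullet> ((x \<omega> (r + \<epsilon>) - x \<omega> r) /\<^sub>R \<epsilon>))"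
      unfolding Y_def inc by (rule set_lebesgue_integral_cong) (use s xX in auto)
    then show "Y s \<epsilon> \<omega> = integral {t..s} (\<lambda>r. grad_x f r (x \<omega> r) \<bullet> ((x \<omega> (r + \<epsilon>) - x \<omega> r) /\<^sub>R \<epsilon>))"
      using LI[OF c] by simp
  qed
  have gradc: "continuous_on UNIV (grad_x f r)" if "r \<in> {t..T}" for r
    using reg(2)[OF that] unfolding grad_x_def by (intro continuous_on_vec_lambda) (simp add: C2_def C1_def)
  have gradm: "(\<lambda>\<omega>. grad_x f r (x \<omega> r)) \<in> borel_measurable M" if "r \<in> {t..T}" for r
    by (rule measurable_compose[OF xm borel_measurable_continuous_onI[OF gradc[OF that]]])
  have Ym: "Y s \<epsilon> \<in> borel_measurable M" if s: "s \<in> {t..T}" for s \<epsilon>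
  proof -
    have "(\<lambda>\<omega>. integral {t..s} (\<lambda>r. grad_x f r (x \<omega> r) \<bullet> ((x \<omega> (r + \<epsilon>) - x \<omega> r) /\<^sub>R \<epsilon>))) \<in> borel_measurable M"
    proof (rule borel_measurable_integral_continuous)
      fix r assume "r \<in> {t..s}"
      then show "(\<lambda>\<omega>. grad_x f r (x \<omega> r) \<bullet> ((x \<omega> (r + \<epsilon>) - x \<omega> r) /\<^sub>R \<epsilon>)) \<in> borel_measurable M"
        using s by (intro borel_measurable_inner borel_measurable_scaleR borel_measurable_const borel_measurable_diff xm gradm) auto
    qed (rule Ycont[OF s])
    then show ?thesis by (rule measurable_cong[THEN iffD2, rotated]) (rule Yeq[OF s])
  qed
  \<comment> \<open>The value \<open>0\<close> off \<open>\<Omega>\<close>, where the Stieltjes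
    integrals may fail to exist, makes every path continuous and keeps \<open>J s\<close>
    measurable.\<close>
  define J where "J = (\<lambda>s \<omega>. if \<omega> \<in> \<Omega> then E s \<omega> else 0)"
  have Jm: "J s \<in> borel_measurable M" if s: "s \<in> {t..T}" for s
  proof -
    define \<epsilon> where "\<epsilon> = (\<lambda>n. 1 / real (Suc n))"
    have e: "\<epsilon> n > 0" "\<epsilon> \<longlonglongrightarrow> 0" for n
      using LIMSEQ_Suc[OF lim_const_over_n[of "1::real"]] by (auto simp: \<epsilon>_def)
    \<comment> \<open>\<open>H\<close> is given by a definite description and \<open>I\<close>
      integrates a derivative, so neither is visibly measurable in \<open>\<omega>\<close>. On
      \<open>\<Omega>\<close> both are limits of measurable quantities: averaged time increments and
      Riemann sums.\<close>
    define In where "In = (\<lambda>n \<omega>. integral {t..s} (\<lambda>r. f (clamp t T (r + \<epsilon> n)) (x \<omega> (r + \<epsilon> n)) - f r (x \<omega> (r + \<epsilon> n))) / \<epsilon> n)"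
    define Hn where "Hn = (\<lambda>i j n \<omega>. rsum (\<lambda>r. hess_x f i j r (x \<omega> r)) (\<lambda>r. XX i j r \<omega>) t s (Suc n))"
    define En where "En = (\<lambda>n \<omega>. f s (x \<omega> s) - f t (x \<omega> t) - In n \<omega> - 1/2 * (\<Sum>i\<in>UNIV. \<Sum>j\<in>UNIV. Hn i j n \<omega>))"
    have fm: "(\<lambda>\<omega>. f u (x \<omega> r)) \<in> borel_measurable M" if "u \<in> {t..T}" for u r
    proof -
      have "continuous_on UNIV (f u)" using reg(2)[OF that] by (intro C1_continuous_on) (simp add: C2_def)
      then show ?thesis by (intro measurable_compose[OF xm] borel_measurable_continuous_onI)
    qed
    have hm: "(\<lambda>\<omega>. hess_x f i j u (x \<omega> r)) \<in> borel_measurable M" if "u \<in> {t..T}" for u r i j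
    proof -
      have "continuous_on UNIV (hess_x f i j u)"
        using reg(2)[OF that] by (simp add: C2_def C1_def hess_x_def[abs_def])
      then show ?thesis by (intro measurable_compose[OF xm] borel_measurable_continuous_onI)
    qed
    have "In n \<in> borel_measurable M" for n unfolding In_def
    proof (intro borel_measurable_divide borel_measurable_const borel_measurable_integral_continuous)
      fix r assume "r \<in> {t..s}"
      then show "(\<lambda>\<omega>. f (clamp t T (r + \<epsilon> n)) (x \<omega> (r + \<epsilon> n)) - f r (x \<omega> (r + \<epsilon> n))) \<in> borel_measurable M"
        using s tT by (intro borel_measurable_diff fm) (auto simp: cl)
    next
      fix \<omega> assume "\<omega> \<in> space M"
      then show "continuous_on {t..s} (\<lambda>r. f (clamp t T (r + \<epsilon> n)) (x \<omega> (r + \<epsilon> n)) - f r (x \<omega> (r + \<epsilon> n)))"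
        by (intro continuous_intros continuous_on_joint_compose[OF reg(1)] clc xs) (use s tT in \<open>auto simp: cl\<close>)
    qed
    moreover have "Hn i j n \<in> borel_measurable M" for i j n
    proof -
      have gr: "grid t s (Suc n) k \<in> {t..T}" if "k \<le> Suc n" for k
        using grid_mem[of t s k "Suc n"] that s by auto
      show ?thesis unfolding Hn_def rsum_def
        by (intro borel_measurable_sum borel_measurable_times borel_measurable_diff hm Qm gr) auto
    qed
    ultimately have "(\<lambda>\<omega>. if \<omega> \<in> \<Omega> then En n \<omega> else 0) \<in> borel_measurable M" for n
      unfolding En_def using s tT \<Omega>
      by (intro measurable_If_set borel_measurable_diff borel_measurable_times borel_measurable_sum borel_measurable_const fm) auto
    then show ?thesis
    proof (rule borel_measurable_LIMSEQ_real[rotated])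
      fix \<omega> assume \<omega>: "\<omega> \<in> space M"
      show "(\<lambda>n. if \<omega> \<in> \<Omega> then En n \<omega> else 0) \<longlonglongrightarrow> J s \<omega>"
      proof (cases "\<omega> \<in> \<Omega>")
        case True
        have "(\<lambda>n. In n \<omega>) \<longlonglongrightarrow> I s \<omega>"
          unfolding In_def I_def by (rule C02_time_increment_convergence(2)[OF f tT x[OF \<omega>] xc e s])
        moreover have "(\<lambda>n. Hn i j n \<omega>) \<longlonglongrightarrow> H i j s \<omega>" for i j
          unfolding Hn_def H_def by (rule st(2)[OF \<omega> \<omega> True s])
        ultimately have "(\<lambda>n. En n \<omega>) \<longlonglongrightarrow> E s \<omega>"
          unfolding En_def E_def by (intro tendsto_diff tendsto_mult tendsto_sum tendsto_const)
        then show ?thesis using True by (simp add: J_def)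
      qed (simp add: J_def)
    qed
  qed
  have Jc: "continuous_on {t..T} (\<lambda>s. J s \<omega>)" if \<omega>: "\<omega> \<in> space M" for \<omega>
  proof (cases "\<omega> \<in> \<Omega>")
    case True
    have "continuous_on {t..T} (\<lambda>s. I s \<omega>)"
    proof -
      have si: "set_integrable lebesgue {t..T} (\<lambda>r. time_deriv {t..T} f r (x \<omega> r))"
        by (rule C02_time_increment_convergence(1)[OF f tT x[OF \<omega>] xc])
      have "I s \<omega> = integral {t..s} (\<lambda>r. time_deriv {t..T} f r (x \<omega> r))" if "s \<in> {t..T}" for s
        unfolding I_def using that by (intro set_lebesgue_integral_eq_integral set_integrable_subset[OF si]) auto
      moreover have "continuous_on {t..T} (\<lambda>s. integral {t..s} (\<lambda>r. time_deriv {t..T} f r (x \<omega> r)))"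
        by (rule indefinite_integral_continuous_1[OF set_lebesgue_integral_eq_integral(1)[OF si]])
      ultimately show ?thesis by (subst continuous_on_cong[OF refl]) auto
    qed
    moreover have "continuous_on {t..T} (\<lambda>s. H i j s \<omega>)" for i j
      unfolding H_def by (rule st(3)[OF \<omega> \<omega> True])
    moreover have "continuous_on {t..T} (\<lambda>s. f s (x \<omega> s))"
      by (rule continuous_on_joint_compose[OF reg(1)]) (auto intro: xs0 \<omega> continuous_on_id)
    ultimately have "continuous_on {t..T} (\<lambda>s. E s \<omega>)"
      unfolding E_def by (intro continuous_intros)
    then show ?thesis using True by (simp add: J_def)
  qed (simp add: J_def)
  \<comment> \<open>The pathwise formula is available along a subsequence on which the covariations
    converge, off a null set depending on it; the limit \<open>J\<close> is the same each time, as
    the subsequence criterion requires.\<close>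
  have YJ: "tendsto_in_prob M (Y s) (J s) (at_right 0)" if s: "s \<in> {t..T}" for s
  proof (rule tendsto_in_prob_at_right_subseqI[OF Ym[OF s] Jm[OF s]])
    fix e :: "nat \<Rightarrow> real" assume e: "\<And>n. e n > 0" "e \<longlonglongrightarrow> 0"
    obtain r where r: "strict_mono r" "AE \<omega> in M. \<forall>i j. \<forall>q\<in>D. (\<lambda>n. cov \<omega> (e (r n)) i j q) \<longlonglongrightarrow> XX i j q \<omega>"
      using subseq[OF e] by blast
    have er: "e (r n) > 0" "(\<lambda>n. e (r n)) \<longlonglongrightarrow> 0" for n
      using e LIMSEQ_subseq_LIMSEQ[OF e(2) r(1)] by (auto simp: o_def)
    have "AE \<omega> in M. (\<lambda>n. Y s (e (r n)) \<omega>) \<longlonglongrightarrow> J s \<omega>"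
      using r(2) AE\<Omega>
    proof eventually_elim
      case (elim \<omega>)
      then have \<omega>: "\<omega> \<in> space M" using \<Omega> by auto
      have "(\<lambda>n. integral {t..s} (\<lambda>u. grad_x f u (x \<omega> u) \<bullet> ((x \<omega> (u + e (r n)) - x \<omega> u) /\<^sub>R e (r n)))) \<longlonglongrightarrow> E s \<omega>"
        unfolding E_def I_def H_def
        by (rule ito_formula_along_path[OF f tT x[OF \<omega>] xc er Qc[OF \<omega>] D(2-4) _ _ s])
          (fact dense, use elim(1) in \<open>simp add: cov_def\<close>)
      then show ?case using elim(2) by (simp add: Yeq[OF s \<omega>] J_def)
    qed
    with r(1) show "\<exists>r. strict_mono r \<and> (AE \<omega> in M. (\<lambda>n. Y s (e (r n)) \<omega>) \<longlonglongrightarrow> J s \<omega>)" by blast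
  qed
  have fwd: "has_forward_integral M t T (\<lambda>r \<omega>. grad_x f r (X r \<omega>)) X J"
    unfolding has_forward_integral_def
  proof (intro conjI ballI)
    show "(\<lambda>\<omega>. grad_x f s (X s \<omega>)) \<in> borel_measurable M" if "s \<in> {t..T}" for s
      using gradm[OF that] xX[OF that] by simp
    show "set_integrable lebesgue {t..T} (\<lambda>r. grad_x f r (X r \<omega>))" if "\<omega> \<in> space M" for \<omega>
      by (rule absolutely_integrable_continuous_real) (use continuous_on_eq[OF gc[OF that]] xX in simp)
    show "continuous_process M t T J" using Jm Jc by (simp add: continuous_process_def)
    show "tendsto_in_prob M (\<lambda>\<epsilon> \<omega>. LINT r:{t..s}|lebesgue. grad_x f r (X r \<omega>) \<bullet> (incr t T X \<epsilon> r \<omega> /\<^sub>R \<epsilon>)) (J s) (at_right 0)"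
      if "s \<in> {t..T}" for s
      using YJ[OF that] by (simp add: Y_def)
  qed
  moreover have "AE \<omega> in M. \<forall>s\<in>{t..T}.
         set_integrable lebesgue {t..s} (\<lambda>r. time_deriv {t..T} f r (X r \<omega>)) \<and>
         (\<forall>i j. stieltjes_integrable (\<lambda>r. hess_x f i j r (X r \<omega>)) (\<lambda>r. XX i j r \<omega>) t s) \<and>
         f s (X s \<omega>) = f t (X t \<omega>)
           + (LINT r:{t..s}|lebesgue. time_deriv {t..T} f r (X r \<omega>))
           + J' s \<omega>
           + 1 / 2 * (\<Sum>i\<in>UNIV. \<Sum>j\<in>UNIV.
               stieltjes_integral (\<lambda>r. hess_x f i j r (X r \<omega>)) (\<lambda>r. XX i j r \<omega>) t s)"
    if J': "has_forward_integral M t T (\<lambda>r \<omega>. grad_x f r (X r \<omega>)) X J'" for J'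
  proof -
    have J'c: "continuous_on {t..T} (\<lambda>s. J' s \<omega>)" if "\<omega> \<in> space M" for \<omega>
      using J' that by (simp add: has_forward_integral_def continuous_process_def)
    have "AE \<omega> in M. J s \<omega> = J' s \<omega>" if "s \<in> {t..T}" for s
      using J' that unfolding has_forward_integral_def
      by (intro tendsto_in_prob_at_right_unique[OF YJ[OF that]]) (simp add: Y_def)
    \<comment> \<open>Uniqueness of limits gives a null set for each time. Countability of
      \<open>D\<close> merges them into one, and continuity of both versions extends the equality
      from \<open>D\<close> to its closure \<open>{t..T}\<close>.\<close>
    then have "AE \<omega> in M. \<forall>s\<in>D. J s \<omega> = J' s \<omega>"
      using D(1,2) by (intro AE_ball_countable[THEN iffD2]) auto
    with AE\<Omega> show ?thesis
    proof eventually_elim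
      case (elim \<omega>)
      then have \<omega>: "\<omega> \<in> space M" using \<Omega> by auto
      have "closure D \<subseteq> {t..T}" using D(2) by (intro closure_minimal) auto
      then have cD: "closure D = {t..T}" using D(5) by auto
      have JJ: "J s \<omega> = J' s \<omega>" if "s \<in> {t..T}" for s
      proof -
        have "continuous_on (closure D) (\<lambda>s. J s \<omega> - J' s \<omega>)"
          unfolding cD by (intro continuous_intros Jc J'c \<omega>)
        then have "J s \<omega> - J' s \<omega> = 0"
          by (rule continuous_constant_on_closure) (use elim(2) that cD in auto)
        then show ?thesis by simp
      qed
      show ?case
      proof (intro ballI conjI allI)
        fix s assume s: "s \<in> {t..T}"
        have xX': "x \<omega> r = X r \<omega>" if "r \<in> {t..s}" for r using that s by (intro xX) auto
        have td: "set_integrable lebesgue {t..s} (\<lambda>r. time_deriv {t..T} f r (x \<omega> r)) =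
            set_integrable lebesgue {t..s} (\<lambda>r. time_deriv {t..T} f r (X r \<omega>))"
          by (rule set_integrable_cong) (use xX' in auto)
        have "set_integrable lebesgue {t..s} (\<lambda>r. time_deriv {t..T} f r (x \<omega> r))"
          by (rule set_integrable_subset[OF C02_time_increment_convergence(1)[OF f tT x[OF \<omega>] xc]]) (use s in auto)
        then show "set_integrable lebesgue {t..s} (\<lambda>r. time_deriv {t..T} f r (X r \<omega>))" by (simp only: td)
        have I: "I s \<omega> = (LINT r:{t..s}|lebesgue. time_deriv {t..T} f r (X r \<omega>))"
          unfolding I_def by (rule set_lebesgue_integral_cong) (use xX' in auto)
        have hX: "hess_x f i j r (x \<omega> r) = hess_x f i j r (X r \<omega>)" if "r \<in> {t..s}" for i j r
          using xX'[OF that] by simp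
        show "stieltjes_integrable (\<lambda>r. hess_x f i j r (X r \<omega>)) (\<lambda>r. XX i j r \<omega>) t s" for i j
        proof -
          have "stieltjes_integrable (\<lambda>r. hess_x f i j r (x \<omega> r)) (\<lambda>r. XX i j r \<omega>) t s =
              stieltjes_integrable (\<lambda>r. hess_x f i j r (X r \<omega>)) (\<lambda>r. XX i j r \<omega>) t s"
            by (rule stieltjes_integral_cong(1)[OF hX])
          with st(1)[OF \<omega> \<omega> elim(1) s] show ?thesis by blast
        qed
        have H: "H i j s \<omega> = stieltjes_integral (\<lambda>r. hess_x f i j r (X r \<omega>)) (\<lambda>r. XX i j r \<omega>) t s" for i j
          unfolding H_def by (rule stieltjes_integral_cong(2)[OF hX])
        have "J' s \<omega> = E s \<omega>" using JJ[OF s] elim(1) by (simp add: J_def)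
        moreover have "x \<omega> s = X s \<omega>" "x \<omega> t = X t \<omega>" using s tT by (auto intro!: xX)
        ultimately show "f s (X s \<omega>) = f t (X t \<omega>)
           + (LINT r:{t..s}|lebesgue. time_deriv {t..T} f r (X r \<omega>))
           + J' s \<omega>
           + 1 / 2 * (\<Sum>i\<in>UNIV. \<Sum>j\<in>UNIV.
               stieltjes_integral (\<lambda>r. hess_x f i j r (X r \<omega>)) (\<lambda>r. XX i j r \<omega>) t s)"
          unfolding E_def I H by simp
      qed
    qed
  qed
  ultimately show ?thesis by blast
qed

end
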